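(* Let $T>0$ and let $a:[0,1]\to\mathbb R$ satisfy hypothesis (H$_{\rm nd}$) below, with degeneracy point $x_0$ and constant $K$. Let $\varphi(t,x)=\Theta(t)\psi(x)$, $\Theta(t)=[t(T-t)]^{-4}$, $\psi(x)=d_1\left(\int_{x_0}^x\frac{y-x_0}{a(y)}e^{R(y-x_0)^2}dy-d_2\right)$ with $R>0$, $d_1>0$ and $d_2>\max\left\{\frac{(1-x_0)^2e^{R(1-x_0)^2}}{(2-K)a(1)},\frac{x_0^2e^{Rx_0^2}}{(2-K)a(0)}\right\}$. Then there exist positive constants $C$ and $s_0$ such that every solution $v\in\mathcal S_2:=H^1(0,T;\mathcal H^1_{\frac1a}(0,1))\cap L^2(0,T;\mathcal H^2_{\frac1a}(0,1))$ of $$v_t+av_{xx}=h\text{ in }(0,T)\times(0,1),\qquad v(t,0)=v(t,1)=0,$$ satisfies, for all $s\ge s_0$, $$\int_0^T\!\!\int_0^1\left(s\Theta v_x^2+s^3\Theta^3\Big(\frac{x-x_0}{a}\Big)^2v^2\right)e^{2s\varphi}dxdt\le C\left(\int_0^T\!\!\int_0^1h^2\frac{e^{2s\varphi}}{a}dxdt+sd_1\int_0^T\left[\Theta e^{2s\varphi}(x-x_0)v_x^2\right]_{x=0}^{x=1}dt\right).$$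
   Context: (WD): there exists $x_0\in(0,1)$ with $a(x_0)=0$, $a>0$ on $[0,1]\setminus\{x_0\}$, $a\in W^{1,1}(0,1)$, and $K\in(0,1)$ with $(x-x_0)a'\le Ka$ a.e. in $[0,1]$. (SD): same with $a\in W^{1,\infty}(0,1)$ and $K\in[1,2)$. (H$_{\rm nd}$): $a$ satisfies (WD) or (SD); $\frac{(x-x_0)a'(x)}{a(x)}\in W^{1,\infty}(0,1)$; and if $K\ge1/2$ there is $\vartheta\in(0,K]$ such that $x\mapsto a(x)/|x-x_0|^\vartheta$ is nonincreasing on $[0,x_0)$ and nondecreasing on $(x_0,1]$. Spaces: $L^2_{\frac1a}(0,1)=\{u\in L^2(0,1):\int_0^1u^2/a<\infty\}$, $\mathcal H^1_{\frac1a}(0,1)=L^2_{\frac1a}(0,1)\cap H^1_0(0,1)$, $\mathcal H^2_{\frac1a}(0,1)=\{u\in\mathcal H^1_{\frac1a}(0,1):u'\in H^1(0,1)\}$. *)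

theory Defs
  imports "HOL-Analysis.Analysis"
begin

text \<open>f is absolutely continuous on [0,1] with (weak) derivative g in L^1(0,1):
  f x = f 0 + int_0^x g for every x in [0,1]. This is membership in W^{1,1}(0,1)
  (for the continuous representative) with weak derivative g.\<close>
definition W11_with_deriv :: "(real \<Rightarrow> real) \<Rightarrow> (real \<Rightarrow> real) \<Rightarrow> bool" where
  "W11_with_deriv f g \<longleftrightarrow>
     g \<in> borel_measurable lborel \<and> set_integrable lborel {0..1} g \<and>
     (\<forall>x\<in>{0..1}. f x = f 0 + (LBINT y=ereal 0..ereal x. g y))"

definition W1inf_with_deriv :: "(real \<Rightarrow> real) \<Rightarrow> (real \<Rightarrow> real) \<Rightarrow> bool" where
  "W1inf_with_deriv f g \<longleftrightarrow>
     W11_with_deriv f g \<and> (\<exists>B. AE x in lborel. x \<in> {0..1} \<longrightarrow> \<bar>g x\<bar> \<le> B)"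

definition in_W1inf :: "(real \<Rightarrow> real) \<Rightarrow> bool" where
  "in_W1inf f \<longleftrightarrow> (\<exists>g g'. W1inf_with_deriv g g' \<and>
                         (AE x in lborel. x \<in> {0..1} \<longrightarrow> g x = f x))"

definition degenerate_base :: "(real \<Rightarrow> real) \<Rightarrow> real \<Rightarrow> bool" where
  "degenerate_base a x0 \<longleftrightarrow> x0 \<in> {0<..<1} \<and> a x0 = 0 \<and> (\<forall>x\<in>{0..1} - {x0}. a x > 0)"

definition WD_with :: "(real \<Rightarrow> real) \<Rightarrow> (real \<Rightarrow> real) \<Rightarrow> real \<Rightarrow> real \<Rightarrow> bool" where
  "WD_with a a' x0 K \<longleftrightarrow> degenerate_base a x0 \<and> W11_with_deriv a a' \<and>
     K \<in> {0<..<1} \<and> (AE x in lborel. x \<in> {0..1} \<longrightarrow> (x - x0) * a' x \<le> K * a x)"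

definition SD_with :: "(real \<Rightarrow> real) \<Rightarrow> (real \<Rightarrow> real) \<Rightarrow> real \<Rightarrow> real \<Rightarrow> bool" where
  "SD_with a a' x0 K \<longleftrightarrow> degenerate_base a x0 \<and> W1inf_with_deriv a a' \<and>
     K \<in> {1..<2} \<and> (AE x in lborel. x \<in> {0..1} \<longrightarrow> (x - x0) * a' x \<le> K * a x)"

definition Hnd :: "(real \<Rightarrow> real) \<Rightarrow> real \<Rightarrow> real \<Rightarrow> bool" where
  "Hnd a x0 K \<longleftrightarrow> (\<exists>a'. (WD_with a a' x0 K \<or> SD_with a a' x0 K) \<and>
     in_W1inf (\<lambda>x. (x - x0) * a' x / a x) \<and>
     (K \<ge> 1/2 \<longrightarrow> (\<exists>th. 0 < th \<and> th \<le> K \<and>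
        (\<forall>x y. 0 \<le> x \<and> x \<le> y \<and> y < x0 \<longrightarrow>
             a y / \<bar>y - x0\<bar> powr th \<le> a x / \<bar>x - x0\<bar> powr th) \<and>
        (\<forall>x y. x0 < x \<and> x \<le> y \<and> y \<le> 1 \<longrightarrow>
             a x / \<bar>x - x0\<bar> powr th \<le> a y / \<bar>y - x0\<bar> powr th))))"

definition test_fun :: "real \<Rightarrow> real \<Rightarrow> (real \<Rightarrow> real) \<Rightarrow> (real \<Rightarrow> real) \<Rightarrow> bool" where
  "test_fun l r \<phi> \<phi>' \<longleftrightarrow> (\<forall>x. (\<phi> has_real_derivative \<phi>' x) (at x)) \<and> continuous_on UNIV \<phi>' \<and>
     (\<exists>c d. l < c \<and> c \<le> d \<and> d < r \<and> (\<forall>x. x \<notin> {c..d} \<longrightarrow> \<phi> x = 0))"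

definition Qset :: "real \<Rightarrow> (real \<times> real) set" where
  "Qset T = {0<..<T} \<times> {0<..<1}"

definition L2Q :: "real \<Rightarrow> (real \<Rightarrow> real) \<Rightarrow> (real \<Rightarrow> real \<Rightarrow> real) \<Rightarrow> bool" where
  "L2Q T w f \<longleftrightarrow> (\<lambda>z. f (fst z) (snd z)) \<in> borel_measurable lborel \<and>
     (\<integral>\<^sup>+ z. indicator (Qset T) z * ennreal ((f (fst z) (snd z))\<^sup>2 * w (snd z)) \<partial>lborel) < \<infinity>"

text \<open>w is the distributional time derivative of f on Q (tested against
  products of C^1_c test functions, which span a dense subspace).\<close>
definition weak_dt :: "real \<Rightarrow> (real \<Rightarrow> real \<Rightarrow> real) \<Rightarrow> (real \<Rightarrow> real \<Rightarrow> real) \<Rightarrow> bool" where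
  "weak_dt T f w \<longleftrightarrow> (\<forall>\<alpha> \<alpha>' \<beta> \<beta>'. test_fun 0 T \<alpha> \<alpha>' \<and> test_fun 0 1 \<beta> \<beta>' \<longrightarrow>
     (LINT z:Qset T|lborel. f (fst z) (snd z) * \<alpha>' (fst z) * \<beta> (snd z)) =
     - (LINT z:Qset T|lborel. w (fst z) (snd z) * \<alpha> (fst z) * \<beta> (snd z)))"

text \<open>v belongs to S_2 = H^1(0,T; H^1_{1/a}) \<inter> L^2(0,T; H^2_{1/a}),
  with time derivative vt, space derivatives vx, vxx.  For a.e. t the functions
  v(t,.) and vx(t,.) are the absolutely continuous representatives (so the
  traces vx(t,0), vx(t,1) make sense), and v(t,0)=v(t,1)=0.\<close>
definition S2 :: "real \<Rightarrow> (real \<Rightarrow> real) \<Rightarrow> (real \<Rightarrow> real \<Rightarrow> real) \<Rightarrow> (real \<Rightarrow> real \<Rightarrow> real)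
                   \<Rightarrow> (real \<Rightarrow> real \<Rightarrow> real) \<Rightarrow> (real \<Rightarrow> real \<Rightarrow> real) \<Rightarrow> bool" where
  "S2 T a v vt vx vxx \<longleftrightarrow>
     (\<exists>vtx.
       L2Q T (\<lambda>_. 1) v \<and> L2Q T (\<lambda>x. 1 / a x) v \<and> L2Q T (\<lambda>_. 1) vx \<and> L2Q T (\<lambda>_. 1) vxx \<and>
       L2Q T (\<lambda>_. 1) vt \<and> L2Q T (\<lambda>x. 1 / a x) vt \<and> L2Q T (\<lambda>_. 1) vtx \<and>
       (AE t in lborel. t \<in> {0<..<T} \<longrightarrow>
          set_integrable lborel {0..1} (vx t) \<and> set_integrable lborel {0..1} (vxx t) \<and>
          (\<forall>x\<in>{0..1}. v t x = (LBINT y=ereal 0..ereal x. vx t y)) \<and>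
          (\<forall>x\<in>{0..1}. vx t x = vx t 0 + (LBINT y=ereal 0..ereal x. vxx t y)) \<and>
          v t 0 = 0 \<and> v t 1 = 0) \<and>
       weak_dt T v vt \<and> weak_dt T vx vtx)"

definition Theta :: "real \<Rightarrow> real \<Rightarrow> real" where
  "Theta T t = 1 / (t * (T - t)) ^ 4"

definition psi :: "(real \<Rightarrow> real) \<Rightarrow> real \<Rightarrow> real \<Rightarrow> real \<Rightarrow> real \<Rightarrow> real \<Rightarrow> real" where
  "psi a x0 R d1 d2 x =
     d1 * ((LBINT y=ereal x0..ereal x. (y - x0) / a y * exp (R * (y - x0)\<^sup>2)) - d2)"

definition varphi :: "real \<Rightarrow> (real \<Rightarrow> real) \<Rightarrow> real \<Rightarrow> real \<Rightarrow> real \<Rightarrow> real \<Rightarrow> real \<Rightarrow> real \<Rightarrow> real" where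
  "varphi T a x0 R d1 d2 t x = Theta T t * psi a x0 R d1 d2 x"

end

theory Submission
  imports Defs
begin

text \<open>
  Put \<open>w = e\<^bsup>s\<phi>\<^esup> v\<close> and split the conjugated operator as \<open>e\<^bsup>s\<phi>\<^esup> h = L\<^sup>+ + L\<^sup>-\<close> with
  \<open>L\<^sup>+ = a w\<^sub>x\<^sub>x + (s\<^sup>2 a \<phi>\<^sub>x\<^sup>2 - s \<phi>\<^sub>t) w\<close> and \<open>L\<^sup>- = w\<^sub>t - 2 s a \<phi>\<^sub>x w\<^sub>x - s a \<phi>\<^sub>x\<^sub>x w\<close>; then
  \<open>4 L\<^sup>+ L\<^sup>- / a \<le> (e\<^bsup>s\<phi>\<^esup> h)\<^sup>2 / a\<close>. Almost everywhere \<open>L\<^sup>+ L\<^sup>- / a\<close> is the sum of a time derivative,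
  an \<open>x\<close>-derivative and a quadratic form \<open>D\<close> in \<open>(w, w\<^sub>x)\<close>. The time derivative integrates to zero because
  \<open>e\<^bsup>2s\<phi>\<^esup>\<close> vanishes to infinite order at \<open>t = 0\<close> and \<open>t = T\<close>; the flux is continuous across \<open>x\<^sub>0\<close>, so its
  derivative contributes only the boundary term; and \<open>D\<close> controls \<open>s\<Theta> w\<^sub>x\<^sup>2 + (s\<Theta>)\<^sup>3 ((x - x\<^sub>0)/a)\<^sup>2 w\<^sup>2\<close>
  for large \<open>s\<close>, since \<open>(x - x\<^sub>0) a' \<le> K a\<close> with \<open>K < 2\<close>. The term of \<open>D\<close> in \<open>w\<^sup>2/a\<close> is absorbed by
  \<open>\<sigma> \<integral> w\<^sup>2/a \<le> C (\<integral> w\<^sub>x\<^sup>2 + \<sigma>\<^sup>2 \<integral> ((x - x\<^sub>0)/a)\<^sup>2 w\<^sup>2)\<close>.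

  Regularity enters in two places. As \<open>b = (x - x\<^sub>0) a'/a\<close> is Lipschitz, \<open>a\<close> is \<open>C\<^sup>1\<close> off \<open>x\<^sub>0\<close>, so the
  integrations by parts in \<open>x\<close> need only the product rule for absolutely continuous functions. The weak time
  derivatives are turned into primitives in \<open>t\<close> for almost every \<open>x\<close>.
\<close>

section \<open>Absolutely continuous functions on an interval\<close>

text \<open>The obstacle is \<open>r = p/a\<close>, the \<open>x\<close>-derivative of the weight up
  to the factor \<open>d1\<close>. It is continuous for \<open>K < 1\<close>, but for
  \<open>K \<ge> 1\<close> it may blow up at \<open>x0\<close>. In that case \<open>a\<close> is at
  most linear at \<open>x0\<close>, and integrability of \<open>v^2/a\<close> forces
  \<open>v\<close> to vanish there. Hence \<open>r v\<close> is continuous in both cases, and the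
  same dichotomy puts \<open>r v\<close> and \<open>r v_t\<close> into L^2. The lower bound on
  \<open>d2\<close> makes \<open>\<psi>\<close> negative and bounded away from 0; this is why
  \<open>e^{s\<phi>}\<close> beats every power of \<open>\<Theta>\<close>. The form \<open>D\<close>
  is positive to leading order because
  \<open>p' + a r' = E (2 + 4 R (x - x0)^2 - b) \<ge> 2 - K\<close>, where
  \<open>E = exp (R (x - x0)^2) \<ge> 1\<close>. The remainder can be absorbed because
  \<open>\<Theta>'\<close> and \<open>\<Theta>''\<close> are bounded by multiples of
  \<open>\<Theta>^2\<close>: with \<open>\<sigma> = s \<Theta>\<close> every error term carries a
  factor \<open>1/s\<close>. The flux contains \<open>v_t\<close>, which is given no regularity in
  \<open>x\<close>. Comparing two time representations of \<open>v\<close> shows that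
  \<open>v_t\<close> is the \<open>x\<close>-primitive of \<open>v_tx\<close>, which yields
  absolutely continuous slices that vanish at both ends.\<close>

definition ac_on :: "real \<Rightarrow> real \<Rightarrow> (real \<Rightarrow> real) \<Rightarrow> (real \<Rightarrow> real) \<Rightarrow> bool" where
  "ac_on l r f f' \<longleftrightarrow> set_integrable lborel {l..r} f' \<and>
     (\<forall>x y. l \<le> x \<and> x \<le> y \<and> y \<le> r \<longrightarrow> f y - f x = (LBINT u:{x..y}. f' u))"

lemma ac_onD:
  "ac_on l r f f' \<Longrightarrow> set_integrable lborel {l..r} f'"
  "ac_on l r f f' \<Longrightarrow> l \<le> x \<Longrightarrow> x \<le> y \<Longrightarrow> y \<le> r \<Longrightarrow> f y - f x = (LBINT u:{x..y}. f' u)"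
  by (auto simp: ac_on_def)

lemma ac_on_subset: "ac_on l r f f' \<Longrightarrow> l \<le> l' \<Longrightarrow> r' \<le> r \<Longrightarrow> ac_on l' r' f f'"
  unfolding ac_on_def by (auto intro: set_integrable_subset)

lemma set_integral_Icc_split:
  fixes f :: "real \<Rightarrow> real"
  assumes "set_integrable lborel {l..r} f" "l \<le> x" "x \<le> y" "y \<le> r"
  shows "(LBINT u:{l..y}. f u) = (LBINT u:{l..x}. f u) + (LBINT u:{x..y}. f u)"
proof -
  have "(LBINT u:{l..y}. f u) = (LBINT u:{l..x}\<union>{x..y}. f u)"
    using ivl_disj_un_two_touch(4)[OF assms(2,3)] by simp
  also have "\<dots> = (LBINT u:{l..x}. f u) + (LBINT u:{x..y}. f u)"
  proof (rule set_integral_Un_AE)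
    show "AE u in lborel. \<not> (u \<in> {l..x} \<and> u \<in> {x..y})"
      using AE_lborel_singleton[of x] by eventually_elim auto
    show "set_integrable lborel {l..x} f" "set_integrable lborel {x..y} f"
      by (rule set_integrable_subset[OF assms(1)]; use assms in simp)+
  qed simp_all
  finally show ?thesis .
qed

lemma ac_onI:
  assumes "set_integrable lborel {l..r} f'"
    and "\<And>x. l \<le> x \<Longrightarrow> x \<le> r \<Longrightarrow> f x = c + (LBINT u:{l..x}. f' u)"
  shows "ac_on l r f f'"
proof -
  have "f y - f x = (LBINT u:{x..y}. f' u)" if "l \<le> x" "x \<le> y" "y \<le> r" for x y
    using set_integral_Icc_split[OF assms(1) that] assms(2)[of x] assms(2)[of y] that by linarith
  thus ?thesis using assms(1) by (simp add: ac_on_def)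
qed

text \<open>Measurability of \<open>g'\<close> is a separate premise because \<open>lborel\<close>
  is not complete: an almost everywhere modification of a Borel function need not be Borel.\<close>

lemma ac_on_cong:
  assumes "ac_on l r f f'" "\<And>x. l \<le> x \<Longrightarrow> x \<le> r \<Longrightarrow> f x = g x"
    "AE x in lborel. l \<le> x \<longrightarrow> x \<le> r \<longrightarrow> f' x = g' x" "set_borel_measurable lborel {l..r} g'"
  shows "ac_on l r g g'"
proof -
  let ?f = "\<lambda>x. indicator {l..r} x *\<^sub>R f' x" and ?g = "\<lambda>x. indicator {l..r} x *\<^sub>R g' x"
  have m: "?f \<in> borel_measurable lborel" "?g \<in> borel_measurable lborel"
    using ac_onD(1)[OF assms(1)] assms(4) by (auto simp: set_integrable_def set_borel_measurable_def)
  have ae: "AE x in lborel. ?f x = ?g x" using assms(3) by eventually_elim auto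
  have "set_integrable lborel {l..r} g'"
    using integrable_cong_AE[OF m ae] ac_onD(1)[OF assms(1)] by (simp add: set_integrable_def)
  moreover have "(LBINT u:{x..y}. f' u) = (LBINT u:{x..y}. g' u)" if "l \<le> x" "x \<le> y" "y \<le> r" for x y
  proof -
    have "(LBINT u:{x..y}. f' u) = (LBINT u:{x..y}. ?f u)"
      by (rule set_lebesgue_integral_cong) (use that in auto)
    also have "\<dots> = (LBINT u:{x..y}. ?g u)"
      by (rule set_lebesgue_integral_cong_AE) (use m ae in auto)
    also have "\<dots> = (LBINT u:{x..y}. g' u)"
      by (rule set_lebesgue_integral_cong) (use that in auto)
    finally show ?thesis .
  qed
  ultimately show ?thesis using ac_onD(2)[OF assms(1)] assms(2) unfolding ac_on_def by auto
qed

lemma ac_on_add: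
  "ac_on l r f f' \<Longrightarrow> ac_on l r g g' \<Longrightarrow> ac_on l r (\<lambda>x. f x + g x) (\<lambda>x. f' x + g' x)"
proof -
  assume F: "ac_on l r f f'" and G: "ac_on l r g g'"
  have "f y + g y - (f x + g x) = (LBINT u:{x..y}. f' u + g' u)" if "l \<le> x" "x \<le> y" "y \<le> r" for x y
    using set_integral_add(2)[OF ac_onD(1)[OF ac_on_subset[OF F that(1,3)]] ac_onD(1)[OF ac_on_subset[OF G that(1,3)]]]
      ac_onD(2)[OF F that] ac_onD(2)[OF G that] by simp
  thus ?thesis using set_integral_add(1)[OF ac_onD(1)[OF F] ac_onD(1)[OF G]] unfolding ac_on_def by blast
qed

lemma ac_on_cmult: "ac_on l r f f' \<Longrightarrow> ac_on l r (\<lambda>x. c * f x) (\<lambda>x. c * f' x)"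
  unfolding ac_on_def by (simp flip: right_diff_distrib)

lemma ac_on_diff:
  "ac_on l r f f' \<Longrightarrow> ac_on l r g g' \<Longrightarrow> ac_on l r (\<lambda>x. f x - g x) (\<lambda>x. f' x - g' x)"
  using ac_on_add[OF _ ac_on_cmult[of l r g g' "-1"]] by simp

lemma ac_on_C1:
  assumes "\<And>x. l \<le> x \<Longrightarrow> x \<le> r \<Longrightarrow> (f has_real_derivative f' x) (at x within {l..r})"
    "continuous_on {l..r} f'"
  shows "ac_on l r f f'"
proof -
  have "(LBINT u:{x..y}. f' u) = f y - f x" if "l \<le> x" "x \<le> y" "y \<le> r" for x y
    unfolding set_lebesgue_integral_def
  proof (rule integral_FTC_atLeastAtMost)
    show "continuous_on {x..y} f'" using assms(2) by (rule continuous_on_subset) (use that in auto)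
    show "(f has_vector_derivative f' u) (at u within {x..y})" if u: "x \<le> u" "u \<le> y" for u
      using DERIV_subset[OF assms(1), of u "{x..y}"] that u \<open>l \<le> x\<close> \<open>y \<le> r\<close>
      by (auto simp: has_real_derivative_iff_has_vector_derivative)
  qed fact
  thus ?thesis unfolding ac_on_def
    using borel_integrable_atLeastAtMost'[OF assms(2)] by auto
qed

text \<open>Continuity is taken over from the indefinite Henstock-Kurzweil integral, with which the
  Lebesgue integral agrees here.\<close>

lemma continuous_on_set_integral:
  fixes f :: "real \<Rightarrow> real"
  assumes "set_integrable lborel {l..r} f"
  shows "continuous_on {l..r} (\<lambda>x. LBINT u:{l..x}. f u)"
proof -
  have i: "f integrable_on {l..r}" by (rule set_borel_integral_eq_integral(1)[OF assms])
  have "(LBINT u:{l..x}. f u) = integral {l..x} f" if "x \<in> {l..r}" for x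
    by (rule set_borel_integral_eq_integral(2), rule set_integrable_subset[OF assms]) (use that in auto)
  thus ?thesis using indefinite_integral_continuous_1[OF i] continuous_on_cong by (metis (no_types, lifting))
qed

lemma ac_on_continuous: "ac_on l r f f' \<Longrightarrow> continuous_on {l..r} f"
proof -
  assume a: "ac_on l r f f'"
  have "continuous_on {l..r} (\<lambda>x. f l + (LBINT u:{l..x}. f' u))"
    by (intro continuous_intros continuous_on_set_integral ac_onD(1)[OF a])
  moreover have "f l + (LBINT u:{l..x}. f' u) = f x" if "x \<in> {l..r}" for x
    using ac_onD(2)[OF a, of l x] that by auto
  ultimately show ?thesis using continuous_on_cong by (metis (no_types, lifting))
qed

lemma (in pair_sigma_finite) integrable_prod_mult:
  fixes f :: "'a \<Rightarrow> real" and g :: "'b \<Rightarrow> real"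
  assumes f: "integrable M1 f" and g: "integrable M2 g"
  shows "integrable (M1 \<Otimes>\<^sub>M M2) (\<lambda>z. f (fst z) * g (snd z))"
proof (rule Fubini_integrable)
  have [measurable]: "f \<in> borel_measurable M1" "g \<in> borel_measurable M2" using f g by auto
  show "(\<lambda>z. f (fst z) * g (snd z)) \<in> borel_measurable (M1 \<Otimes>\<^sub>M M2)" by measurable
  show "integrable M1 (\<lambda>x. LINT y|M2. norm (f (fst (x, y)) * g (snd (x, y))))"
    using f g by (simp add: abs_mult)
  show "AE x in M1. integrable M2 (\<lambda>y. f (fst (x, y)) * g (snd (x, y)))" using g by simp
qed

lemma set_integrable_mult_continuous:
  fixes f g :: "real \<Rightarrow> real"
  assumes "set_integrable lborel {l..r} f" "continuous_on {l..r} g"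
  shows "set_integrable lborel {l..r} (\<lambda>x. f x * g x)"
proof -
  obtain B where B: "\<And>x. x \<in> {l..r} \<Longrightarrow> \<bar>g x\<bar> \<le> B"
    using compact_imp_bounded[OF compact_continuous_image[OF assms(2)]]
    unfolding bounded_iff by fastforce
  have m: "(\<lambda>x. indicator {l..r} x * g x) \<in> borel_measurable lborel"
    using borel_measurable_continuous_on_indicator[OF _ assms(2)] by simp
  have mf: "(\<lambda>x. indicator {l..r} x * f x) \<in> borel_measurable lborel"
    using assms(1) by (auto simp: set_integrable_def)
  show ?thesis unfolding set_integrable_def
  proof (rule Bochner_Integration.integrable_bound)
    show "integrable lborel (\<lambda>x. B * (indicator {l..r} x *\<^sub>R f x))"
      using assms(1) unfolding set_integrable_def by auto
    have "(\<lambda>x. (indicator {l..r} x * f x) * (indicator {l..r} x * g x)) \<in> borel_measurable lborel"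
      using m mf by measurable
    thus "(\<lambda>x. indicator {l..r} x *\<^sub>R (f x * g x)) \<in> borel_measurable lborel"
      by (rule back_subst[of "\<lambda>f. f \<in> borel_measurable lborel"]) (auto simp: indicator_def fun_eq_iff)
    have "\<bar>f x * g x\<bar> \<le> \<bar>B * f x\<bar>" if "x \<in> {l..r}" for x
      using mult_right_mono[OF B[OF that], of "\<bar>f x\<bar>"] abs_ge_self[of "B * f x"] abs_ge_self[of B]
        mult_right_mono[OF abs_ge_self[of B], of "\<bar>f x\<bar>"] by (simp add: abs_mult mult.commute)
    thus "AE x in lborel. norm (indicator {l..r} x *\<^sub>R (f x * g x)) \<le> norm (B * (indicator {l..r} x *\<^sub>R f x))"
      by (auto simp: indicator_def)
  qed
qed

text \<open>Fubini on a square: the product of the two increments is the integral of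
  \<open>f' x * g' y\<close>. Cutting the square along the diagonal, \<open>g'\<close> is integrated
  first on one triangle and \<open>f'\<close> first on the other.\<close>

lemma ac_on_mult_aux:
  assumes F: "ac_on l r f f'" and G: "ac_on l r g g'" and lr: "l \<le> r"
  shows "f r * g r - f l * g l = (LBINT u:{l..r}. f' u * g u + f u * g' u)"
proof -
  let ?f = "\<lambda>x. indicator {l..r} x * f' x" and ?g = "\<lambda>x. indicator {l..r} x * g' x"
  have fi: "integrable lborel ?f" and gi: "integrable lborel ?g"
    using ac_onD(1)[OF F] ac_onD(1)[OF G] by (auto simp: set_integrable_def)
  have I: "integrable (lborel \<Otimes>\<^sub>M lborel) (\<lambda>z. ?f (fst z) * ?g (snd z))"
    by (rule lborel_pair.integrable_prod_mult[OF fi gi])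
  let ?A = "{z :: real \<times> real. snd z \<le> fst z}"
  have A[measurable]: "?A \<in> sets (lborel \<Otimes>\<^sub>M lborel)"
    unfolding lborel_prod sets_lborel by (intro borel_closed closed_Collect_le continuous_intros)
  let ?h1 = "\<lambda>x y. indicator ?A (x,y) * (?f x * ?g y)"
  let ?h2 = "\<lambda>x y. indicator (-?A) (x,y) * (?f x * ?g y)"
  have I1: "integrable (lborel \<Otimes>\<^sub>M lborel) (case_prod ?h1)"
    using integrable_mult_indicator[OF A I] by (simp add: case_prod_unfold)
  have I2: "integrable (lborel \<Otimes>\<^sub>M lborel) (case_prod ?h2)"
    using integrable_mult_indicator[OF sets.compl_sets[OF A] I] 
    by (simp add: case_prod_unfold space_pair_measure Compl_eq_Diff_UNIV)
  have "(f r - f l) * (g r - g l) = (\<integral>x. ?f x \<partial>lborel) * (\<integral>y. ?g y \<partial>lborel)"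
    using ac_onD(2)[OF F, of l r] ac_onD(2)[OF G, of l r] lr by (simp add: set_lebesgue_integral_def)
  also have "\<dots> = (\<integral>x. (\<integral>y. ?f x * ?g y \<partial>lborel) \<partial>lborel)" by simp
  also have "\<dots> = (\<integral>z. ?f (fst z) * ?g (snd z) \<partial>(lborel \<Otimes>\<^sub>M lborel))"
    using lborel_pair.integral_fst'[OF I] by simp
  also have "\<dots> = (\<integral>z. case_prod ?h1 z + case_prod ?h2 z \<partial>(lborel \<Otimes>\<^sub>M lborel))"
    by (rule Bochner_Integration.integral_cong) (auto simp: indicator_def)
  also have "\<dots> = (\<integral>z. case_prod ?h1 z \<partial>(lborel \<Otimes>\<^sub>M lborel)) + (\<integral>z. case_prod ?h2 z \<partial>(lborel \<Otimes>\<^sub>M lborel))"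
    by (rule Bochner_Integration.integral_add[OF I1 I2])
  also have "(\<integral>z. case_prod ?h1 z \<partial>(lborel \<Otimes>\<^sub>M lborel)) = (\<integral>x. (\<integral>y. ?h1 x y \<partial>lborel) \<partial>lborel)"
    using lborel_pair.integral_fst'[OF I1] by simp
  also have "\<dots> = (\<integral>x. ?f x * (g x - g l) \<partial>lborel)"
  proof (rule Bochner_Integration.integral_cong)
    fix x
    show "(\<integral>y. ?h1 x y \<partial>lborel) = ?f x * (g x - g l)"
    proof (cases "x \<in> {l..r}")
      case True
      have "(\<integral>y. ?h1 x y \<partial>lborel) = (\<integral>y. f' x * (indicator {l..x} y * g' y) \<partial>lborel)"
        by (rule Bochner_Integration.integral_cong) (use True in \<open>auto simp: indicator_def\<close>)
      also have "\<dots> = f' x * (g x - g l)"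
        using ac_onD(2)[OF G, of l x] True by (simp add: set_lebesgue_integral_def)
      finally show ?thesis using True by simp
    qed simp
  qed simp
  also have "(\<integral>z. case_prod ?h2 z \<partial>(lborel \<Otimes>\<^sub>M lborel)) = (\<integral>y. (\<integral>x. ?h2 x y \<partial>lborel) \<partial>lborel)"
    using lborel_pair.integral_snd[OF I2] by simp
  also have "\<dots> = (\<integral>y. ?g y * (f y - f l) \<partial>lborel)"
  proof (rule Bochner_Integration.integral_cong)
    fix y
    show "(\<integral>x. ?h2 x y \<partial>lborel) = ?g y * (f y - f l)"
    proof (cases "y \<in> {l..r}")
      case True
      \<comment> \<open>The complement of the closed triangle gives \<open>x < y\<close>; the point
        \<open>x = y\<close> is discarded as a null set.\<close>
      have "(\<integral>x. ?h2 x y \<partial>lborel) = (\<integral>x. g' y * (indicator {l..y} x * f' x) \<partial>lborel)"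
      proof (rule integral_cong_AE)
        show "AE x in lborel. ?h2 x y = g' y * (indicator {l..y} x * f' x)"
          using AE_lborel_singleton[of y]
          by eventually_elim (use True in \<open>auto simp: indicator_def\<close>)
        have fm: "?f \<in> borel_measurable lborel" using fi by auto
        have "(\<lambda>x. g' y * (indicator {l..y} x * ?f x)) \<in> borel_measurable lborel" using fm by measurable
        thus "(\<lambda>x. g' y * (indicator {l..y} x * f' x)) \<in> borel_measurable lborel"
          by (rule back_subst[of "\<lambda>f. f \<in> borel_measurable lborel"]) (use True in \<open>auto simp: indicator_def fun_eq_iff\<close>)
        have "(\<lambda>x. indicator {..<y} x * (?f x * ?g y)) \<in> borel_measurable lborel" using fm by measurable
        thus "(\<lambda>x. ?h2 x y) \<in> borel_measurable lborel"
          by (rule back_subst[of "\<lambda>f. f \<in> borel_measurable lborel"]) (auto simp: indicator_def fun_eq_iff)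
      qed
      also have "\<dots> = g' y * (f y - f l)"
        using ac_onD(2)[OF F, of l y] True by (simp add: set_lebesgue_integral_def)
      finally show ?thesis using True by simp
    qed simp
  qed simp
  also have "(\<integral>x. ?f x * (g x - g l) \<partial>lborel) = (LBINT x:{l..r}. f' x * g x) - g l * (f r - f l)"
  proof -
    have "(\<integral>x. ?f x * (g x - g l) \<partial>lborel) = (LBINT x:{l..r}. f' x * g x - g l * f' x)"
      unfolding set_lebesgue_integral_def by (rule Bochner_Integration.integral_cong) (auto simp: algebra_simps)
    also have "\<dots> = (LBINT x:{l..r}. f' x * g x) - (LBINT x:{l..r}. g l * f' x)"
      by (rule set_integral_diff) (use set_integrable_mult_continuous[OF ac_onD(1)[OF F] ac_on_continuous[OF G]] ac_onD(1)[OF F] in auto)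
    finally show ?thesis using ac_onD(2)[OF F, of l r] lr by simp
  qed
  also have "(\<integral>x. ?g x * (f x - f l) \<partial>lborel) = (LBINT x:{l..r}. g' x * f x) - f l * (g r - g l)"
  proof -
    have "(\<integral>x. ?g x * (f x - f l) \<partial>lborel) = (LBINT x:{l..r}. g' x * f x - f l * g' x)"
      unfolding set_lebesgue_integral_def by (rule Bochner_Integration.integral_cong) (auto simp: algebra_simps)
    also have "\<dots> = (LBINT x:{l..r}. g' x * f x) - (LBINT x:{l..r}. f l * g' x)"
      by (rule set_integral_diff) (use set_integrable_mult_continuous[OF ac_onD(1)[OF G] ac_on_continuous[OF F]] ac_onD(1)[OF G] in auto)
    finally show ?thesis using ac_onD(2)[OF G, of l r] lr by simp
  qed
  finally have "f r * g r - f l * g l = (LBINT x:{l..r}. f' x * g x) + (LBINT x:{l..r}. g' x * f x)"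
    by (simp add: algebra_simps)
  also have "\<dots> = (LBINT u:{l..r}. f' u * g u + f u * g' u)"
    by (subst set_integral_add(2)[symmetric])
       (use set_integrable_mult_continuous[OF ac_onD(1)[OF G] ac_on_continuous[OF F]]
          set_integrable_mult_continuous[OF ac_onD(1)[OF F] ac_on_continuous[OF G]] in \<open>auto simp: mult.commute\<close>)
  finally show ?thesis .
qed

lemma ac_on_mult:
  assumes F: "ac_on l r f f'" and G: "ac_on l r g g'"
  shows "ac_on l r (\<lambda>x. f x * g x) (\<lambda>x. f' x * g x + f x * g' x)"
proof -
  have "set_integrable lborel {l..r} (\<lambda>x. f' x * g x + g' x * f x)"
    by (intro set_integral_add set_integrable_mult_continuous ac_onD(1)[OF F] ac_onD(1)[OF G]
       ac_on_continuous[OF F] ac_on_continuous[OF G])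
  thus ?thesis unfolding ac_on_def
    using ac_on_mult_aux[OF ac_on_subset[OF F] ac_on_subset[OF G]] by (auto simp: mult.commute)
qed

text \<open>For derivatives that are singular at the ends. \<open>F\<close> minus the primitive of
  \<open>F'\<close> is constant inside, and continuity carries the constant to the closed
  interval.\<close>

lemma ac_on_improper:
  fixes F F' :: "real \<Rightarrow> real"
  assumes lr: "l < r" and F: "continuous_on {l..r} F" and i: "set_integrable lborel {l..r} F'"
    and ac: "\<And>\<alpha> \<beta>. l < \<alpha> \<Longrightarrow> \<alpha> \<le> \<beta> \<Longrightarrow> \<beta> < r \<Longrightarrow> ac_on \<alpha> \<beta> F F'"
  shows "ac_on l r F F'"
proof -
  define H where "H = (\<lambda>x. F x - (LBINT u:{l..x}. F' u))"
  have Hc: "continuous_on {l..r} H" unfolding H_def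
    by (intro continuous_intros F continuous_on_set_integral i)
  define m where "m = (l+r)/2"
  have m: "l < m" "m < r" using lr by (auto simp: m_def)
  have HH: "H x = H m" if "x \<in> {l<..<r}" for x
  proof -
    have *: "H y = H x" if "l < x" "x \<le> y" "y < r" for x y
    proof -
      have "F y - F x = (LBINT u:{x..y}. F' u)" using ac_onD(2)[OF ac[of x y]] that by auto
      thus ?thesis using set_integral_Icc_split[OF i, of x y] that by (auto simp: H_def)
    qed
    show ?thesis using *[of x m] *[of m x] that m by (cases "x \<le> m") auto
  qed
  have Hm: "H x = H m" if "x \<in> {l..r}" for x
  proof -
    have "closed {x \<in> {l..r}. H x = H m}"
      by (rule continuous_closed_preimage_constant[OF Hc]) auto
    moreover have "{l<..<r} \<subseteq> {x \<in> {l..r}. H x = H m}" using HH by auto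
    ultimately have "closure {l<..<r} \<subseteq> {x \<in> {l..r}. H x = H m}" by (rule closure_minimal[rotated])
    thus ?thesis using that lr by auto
  qed
  show ?thesis by (rule ac_onI[OF i, where c="H m"]) (use Hm in \<open>force simp: H_def algebra_simps\<close>)
qed

section \<open>Lebesgue measure on open intervals and rectangles\<close>

text \<open>The positive and negative parts of \<open>k\<close> are densities of two measures that
  agree on boxes, an intersection-stable generator of the Borel sets; densities are unique almost
  everywhere.\<close>

lemma AE_zero_if_integral_box_zero:
  fixes k :: "'a::euclidean_space \<Rightarrow> real"
  assumes k: "integrable lborel k" and z: "\<And>a b. (LINT x:box a b|lborel. k x) = 0"
  shows "AE x in lborel. k x = 0"
proof -
  have [measurable]: "k \<in> borel_measurable borel" using k by auto
  let ?p = "\<lambda>x. ennreal (max 0 (k x))" and ?n = "\<lambda>x. ennreal (max 0 (- k x))"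
  let ?E = "range (\<lambda>(a, b). box a b::'a set)"
  let ?A = "\<lambda>n::nat. box (- (real n *\<^sub>R One)) (real n *\<^sub>R One) :: 'a set"
  have ip: "integrable lborel (\<lambda>x. max 0 (k x))" "integrable lborel (\<lambda>x. max 0 (- k x))"
    using k by auto
  have em: "emeasure (density lborel (\<lambda>x. ennreal (max 0 (g x)))) X = ennreal (LINT x:X|lborel. max 0 (g x))"
    if "integrable lborel g" "X \<in> sets borel" for g :: "'a \<Rightarrow> real" and X
  proof -
    have [measurable]: "g \<in> borel_measurable borel" using that by auto
    have "emeasure (density lborel (\<lambda>x. ennreal (max 0 (g x)))) X = (\<integral>\<^sup>+x. ennreal (max 0 (g x)) * indicator X x \<partial>lborel)"
      using that by (subst emeasure_density) auto
    also have "\<dots> = (\<integral>\<^sup>+x. ennreal (indicator X x * max 0 (g x)) \<partial>lborel)"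
      by (intro nn_integral_cong) (auto simp: indicator_def)
    also have "\<dots> = ennreal (\<integral>x. indicator X x * max 0 (g x) \<partial>lborel)"
    proof (rule nn_integral_eq_integral)
      have "integrable lborel (\<lambda>x. max 0 (g x))" using that by auto
      from integrable_mult_indicator[OF _ this, of X] that
      show "integrable lborel (\<lambda>x. indicator X x * max 0 (g x))" by simp
    qed auto
    finally show ?thesis by (simp add: set_lebesgue_integral_def)
  qed
  have "density lborel ?p = density lborel ?n"
  proof (rule measure_eqI_generator_eq)
    show "Int_stable ?E" by (auto simp: Int_stable_def box_Int_box)
    show "?E \<subseteq> Pow UNIV" "sets (density lborel ?p) = sigma_sets UNIV ?E" "sets (density lborel ?n) = sigma_sets UNIV ?E"
      by (simp_all add: borel_eq_box)
    show "range ?A \<subseteq> ?E" "(\<Union>i. ?A i) = UNIV" unfolding UN_box_eq_UNIV by auto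
    show "emeasure (density lborel ?p) (?A i) \<noteq> \<infinity>" for i using em[OF k] by simp
    show "emeasure (density lborel ?p) X = emeasure (density lborel ?n) X" if "X \<in> ?E" for X
    proof -
      from that obtain a b where X: "X = box a b" by auto
      have "(LINT x:X|lborel. max 0 (k x)) - (LINT x:X|lborel. max 0 (- k x)) = (LINT x:X|lborel. max 0 (k x) - max 0 (- k x))"
        unfolding set_lebesgue_integral_def scaleR_right_diff_distrib
        by (rule Bochner_Integration.integral_diff[symmetric]; rule integrable_mult_indicator[OF _ ip(1)] integrable_mult_indicator[OF _ ip(2)])
          (simp_all add: X)

      also have "\<dots> = (LINT x:X|lborel. k x)"
        by (intro set_lebesgue_integral_cong) (auto simp: X max_def)
      also have "\<dots> = 0" using z X by simp
      finally show ?thesis using em[OF k, of X] em[of "\<lambda>x. - k x" X] k X by simp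
    qed
  qed
  hence "AE x in lborel. ?p x = ?n x"
    by (intro sigma_finite_measure.density_unique[OF sigma_finite_lborel]) auto
  thus ?thesis by eventually_elim (auto simp: max_def split: if_splits)
qed

text \<open>Open intervals keep the end points out of the space, so that facts valid only inside,
  such as positivity of \<open>Theta\<close>, hold at every point of it. By
  \<open>integral_IM\<close> and \<open>integrable_IM\<close> the closed interval gives the same
  integrals.\<close>

abbreviation IM :: "real \<Rightarrow> real \<Rightarrow> real measure" where
  "IM l r \<equiv> restrict_space lborel {l<..<r}"

lemma finite_measure_IM: "finite_measure (IM l r)"
  by (rule finite_measureI) (cases "l \<le> r"; simp add: emeasure_restrict_space space_restrict_space)


lemma space_IM [simp]: "space (IM l r) = {l<..<r}"
  by (simp add: space_restrict_space)

lemma AE_IM_iff: "(AE x in IM l r. P x) \<longleftrightarrow> (AE x in lborel. l < x \<longrightarrow> x < r \<longrightarrow> P x)"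
  by (subst AE_restrict_space_iff) (auto simp: imp_conjL)

lemma AE_IM_Icc: "(AE x in IM l r. P x) \<longleftrightarrow> (AE x in lborel. l \<le> x \<longrightarrow> x \<le> r \<longrightarrow> P x)"
proof -
  have "AE x in lborel. x \<noteq> l \<and> x \<noteq> r"
    using AE_lborel_singleton[of l] AE_lborel_singleton[of r] by eventually_elim auto
  hence "AE x in lborel. (l < x \<longrightarrow> x < r \<longrightarrow> P x) = (l \<le> x \<longrightarrow> x \<le> r \<longrightarrow> P x)"
    by eventually_elim auto
  thus ?thesis unfolding AE_IM_iff by (rule eventually_subst)
qed

lemma AE_indicator_Ioo_Icc: "AE x in lborel. (indicator {l<..<r} x :: real) = indicator {l..r} (x::real)"
  using AE_lborel_singleton[of l] AE_lborel_singleton[of r] by eventually_elim (auto simp: indicator_def)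

lemma integral_IM: fixes f :: "real \<Rightarrow> real" shows "integral\<^sup>L (IM l r) f = (LBINT x:{l..r}. f x)"
\<comment> \<open>If neither extension by 0 is integrable, both integrals are 0 by convention.
  Otherwise one of the two is measurable, and then so is the other, since they differ at two points
  only.\<close>
proof (cases "integrable lborel (\<lambda>x. indicator {l<..<r} x *\<^sub>R f x) \<or> integrable lborel (\<lambda>x. indicator {l..r} x *\<^sub>R f x)")
  case False
  thus ?thesis by (simp add: integral_restrict_space set_lebesgue_integral_def not_integrable_integral_eq)
next
  case True
  have *: "(\<lambda>x. indicator {l..r} x * f x) = (\<lambda>x. if x = l \<or> x = r then indicator {l..r} x * f x else indicator {l<..<r} x * f x)"
    "(\<lambda>x. indicator {l<..<r} x * f x) = (\<lambda>x. if x = l \<or> x = r then 0 else indicator {l..r} x * f x)"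
    by (auto simp: indicator_def fun_eq_iff)
  have "(\<lambda>x. indicator {l<..<r} x * f x) \<in> borel_measurable lborel \<longleftrightarrow> (\<lambda>x. indicator {l..r} x * f x) \<in> borel_measurable lborel"
  proof
    assume a: "(\<lambda>x. indicator {l<..<r} x * f x) \<in> borel_measurable lborel"
    have "(\<lambda>x. (if x = l then indicator {l..r} l * f l else if x = r then indicator {l..r} r * f r else indicator {l<..<r} x * f x)) \<in> borel_measurable lborel"
      using a by measurable
    thus "(\<lambda>x. indicator {l..r} x * f x) \<in> borel_measurable lborel"
      by (rule back_subst[of "\<lambda>f. f \<in> borel_measurable lborel"]) (auto simp: indicator_def fun_eq_iff)
  next
    assume a: "(\<lambda>x. indicator {l..r} x * f x) \<in> borel_measurable lborel"
    have "(\<lambda>x. if x = l \<or> x = r then 0 else indicator {l..r} x * f x) \<in> borel_measurable lborel"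
      using a by measurable
    thus "(\<lambda>x. indicator {l<..<r} x * f x) \<in> borel_measurable lborel"
      by (rule back_subst[of "\<lambda>f. f \<in> borel_measurable lborel"]) (auto simp: indicator_def fun_eq_iff)
  qed
  hence m: "(\<lambda>x. indicator {l<..<r} x * f x) \<in> borel_measurable lborel" "(\<lambda>x. indicator {l..r} x * f x) \<in> borel_measurable lborel"
    using True by auto
  have "(\<integral>x. indicator {l<..<r} x * f x \<partial>lborel) = (\<integral>x. indicator {l..r} x * f x \<partial>lborel)"
    using AE_indicator_Ioo_Icc[of l r] by (intro integral_cong_AE m) auto
  thus ?thesis by (simp add: integral_restrict_space set_lebesgue_integral_def)
qed

lemma integrable_IM: fixes f :: "real \<Rightarrow> real" shows "integrable (IM l r) f \<longleftrightarrow> set_integrable lborel {l..r} f"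
proof -
  have "integrable (IM l r) f \<longleftrightarrow> integrable lborel (\<lambda>x. indicator {l<..<r} x * f x)"
    by (simp add: integrable_restrict_space)
  also have "\<dots> \<longleftrightarrow> integrable lborel (\<lambda>x. indicator {l..r} x * f x)"
  proof
    assume a: "integrable lborel (\<lambda>x. indicator {l<..<r} x * f x)"
    have "(\<lambda>x. indicator {l<..<r} x * f x) \<in> borel_measurable lborel" using a by auto
    hence "(\<lambda>x. (if x = l then indicator {l..r} l * f l else if x = r then indicator {l..r} r * f r else indicator {l<..<r} x * f x)) \<in> borel_measurable lborel"
      by measurable
    hence m: "(\<lambda>x. indicator {l..r} x * f x) \<in> borel_measurable lborel"
      by (rule back_subst[of "\<lambda>f. f \<in> borel_measurable lborel"]) (auto simp: indicator_def fun_eq_iff)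
    show "integrable lborel (\<lambda>x. indicator {l..r} x * f x)"
      by (rule integrable_cong_AE_imp[OF a m]) (use AE_indicator_Ioo_Icc[of l r] in auto)
  next
    assume a: "integrable lborel (\<lambda>x. indicator {l..r} x * f x)"
    have "(\<lambda>x. indicator {l..r} x * f x) \<in> borel_measurable lborel" using a by auto
    hence "(\<lambda>x. if x = l \<or> x = r then 0 else indicator {l..r} x * f x) \<in> borel_measurable lborel"
      by measurable
    hence m: "(\<lambda>x. indicator {l<..<r} x * f x) \<in> borel_measurable lborel"
      by (rule back_subst[of "\<lambda>f. f \<in> borel_measurable lborel"]) (auto simp: indicator_def fun_eq_iff)
    show "integrable lborel (\<lambda>x. indicator {l<..<r} x * f x)"
      by (rule integrable_cong_AE_imp[OF a m]) (use AE_indicator_Ioo_Icc[of l r] in auto)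
  qed
  finally show ?thesis by (simp add: set_integrable_def)
qed

text \<open>The point is equality of the sigma-algebras: a measurable subset of
  \<open>A \<times> B\<close> is its own preimage under the inclusion, which is measurable from the
  product of the restricted spaces. The measures are compared on rectangles.\<close>

lemma restrict_space_pair_measure:
  assumes "sigma_finite_measure M1" "sigma_finite_measure M2" and A: "A \<in> sets M1" and B: "B \<in> sets M2"
  shows "restrict_space M1 A \<Otimes>\<^sub>M restrict_space M2 B = restrict_space (M1 \<Otimes>\<^sub>M M2) (A \<times> B)"
proof (rule pair_measure_eqI)
  interpret M2: sigma_finite_measure M2 by fact
  show "sigma_finite_measure (restrict_space M1 A)" "sigma_finite_measure (restrict_space M2 B)"
    using assms by (auto intro: sigma_finite_measure_restrict_space)
  have AB: "A \<times> B \<in> sets (M1 \<Otimes>\<^sub>M M2)" using A B by auto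
  have sub: "A \<subseteq> space M1" "B \<subseteq> space M2" using A B sets.sets_into_space by auto
  show "sets (restrict_space M1 A \<Otimes>\<^sub>M restrict_space M2 B) = sets (restrict_space (M1 \<Otimes>\<^sub>M M2) (A \<times> B))"
  proof
    show "sets (restrict_space M1 A \<Otimes>\<^sub>M restrict_space M2 B) \<subseteq> sets (restrict_space (M1 \<Otimes>\<^sub>M M2) (A \<times> B))"
    proof (rule sets_pair_in_sets)
      fix a b assume "a \<in> sets (restrict_space M1 A)" "b \<in> sets (restrict_space M2 B)"
      hence "a \<in> sets M1" "a \<subseteq> A" "b \<in> sets M2" "b \<subseteq> B"
        using A B by (auto simp: sets_restrict_space_iff)
      thus "a \<times> b \<in> sets (restrict_space (M1 \<Otimes>\<^sub>M M2) (A \<times> B))"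
        using AB by (auto simp: sets_restrict_space_iff)
    qed
    show "sets (restrict_space (M1 \<Otimes>\<^sub>M M2) (A \<times> B)) \<subseteq> sets (restrict_space M1 A \<Otimes>\<^sub>M restrict_space M2 B)"
    proof
      fix S assume "S \<in> sets (restrict_space (M1 \<Otimes>\<^sub>M M2) (A \<times> B))"
      hence S: "S \<in> sets (M1 \<Otimes>\<^sub>M M2)" "S \<subseteq> A \<times> B" using AB by (auto simp: sets_restrict_space_iff)
      have 1: "(\<lambda>x. x) \<in> measurable (restrict_space M1 A) M1" "(\<lambda>x. x) \<in> measurable (restrict_space M2 B) M2"
        by (auto intro: measurable_restrict_space1)
      have "(\<lambda>z. (fst z, snd z)) \<in> measurable (restrict_space M1 A \<Otimes>\<^sub>M restrict_space M2 B) (M1 \<Otimes>\<^sub>M M2)"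
        by (intro measurable_Pair measurable_compose[OF measurable_fst 1(1)] measurable_compose[OF measurable_snd 1(2)])
      from measurable_sets[OF this S(1)] show "S \<in> sets (restrict_space M1 A \<Otimes>\<^sub>M restrict_space M2 B)"
        by (rule back_subst) (use S(2) sub in \<open>auto simp: space_pair_measure space_restrict_space\<close>)
    qed
  qed
  fix X Y assume "X \<in> sets (restrict_space M1 A)" "Y \<in> sets (restrict_space M2 B)"
  hence "X \<in> sets M1" "X \<subseteq> A" "Y \<in> sets M2" "Y \<subseteq> B"
    using A B by (auto simp: sets_restrict_space_iff)
  thus "emeasure (restrict_space M1 A) X * emeasure (restrict_space M2 B) Y = emeasure (restrict_space (M1 \<Otimes>\<^sub>M M2) (A \<times> B)) (X \<times> Y)"
    using A B AB by (simp add: emeasure_restrict_space M2.emeasure_pair_measure_Times Sigma_mono)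
qed

lemma restrict_space_Qset: "restrict_space lborel (Qset T) = IM 0 T \<Otimes>\<^sub>M IM 0 1"
  unfolding Qset_def lborel_prod[symmetric]
  by (rule restrict_space_pair_measure[symmetric]) (auto intro: sigma_finite_lborel)

lemma (in pair_sigma_finite) AE_pair_snd:
  assumes "AE y in M2. P y" shows "AE z in M1 \<Otimes>\<^sub>M M2. P (snd z)"
proof -
  obtain N where N: "N \<in> null_sets M2" "{x \<in> space M2. \<not> P x} \<subseteq> N"
    using assms by (auto simp: eventually_ae_filter)
  have "space M1 \<times> N \<in> null_sets (M1 \<Otimes>\<^sub>M M2)" using N by auto
  moreover have "{z \<in> space (M1 \<Otimes>\<^sub>M M2). \<not> P (snd z)} \<subseteq> space M1 \<times> N"
    using N by (auto simp: space_pair_measure)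
  ultimately show ?thesis by (rule AE_I')
qed

section \<open>Continuously differentiable bumps and test functions\<close>

lemma has_real_derivative_max0_square:
  "((\<lambda>y::real. (max 0 y)\<^sup>2) has_real_derivative 2 * max 0 y) (at y)"
proof -
  consider "y > 0" | "y < 0" | "y = 0" by linarith
  thus ?thesis
  proof cases
    case 1
    have "((\<lambda>y::real. y\<^sup>2) has_real_derivative 2 * max 0 y) (at y)"
      using 1 by (auto intro!: derivative_eq_intros)
    thus ?thesis by (rule has_field_derivative_transform_within_open[where S="{0<..}"]) (use 1 in auto)
  next
    case 2
    have "((\<lambda>y::real. 0) has_real_derivative 2 * max 0 y) (at y)"
      using 2 by (auto intro!: derivative_eq_intros)
    thus ?thesis by (rule has_field_derivative_transform_within_open[where S="{..<0}"]) (use 2 in auto)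
  next
    case 3
    have "((\<lambda>h::real. (max 0 h)\<^sup>2 / h) \<longlongrightarrow> 0) (at 0)"
    proof (rule Lim_null_comparison)
      show "\<forall>\<^sub>F h in at (0::real). norm ((max 0 h)\<^sup>2 / h) \<le> \<bar>h\<bar>"
        by (rule always_eventually) (auto simp: max_def power2_eq_square)
      show "((\<lambda>h::real. \<bar>h\<bar>) \<longlongrightarrow> 0) (at 0)" by (rule tendsto_eq_intros refl | simp)+
    qed
    thus ?thesis using 3 by (simp add: DERIV_def)
  qed
qed

text \<open>With \<open>m\<close> the positive part of \<open>(x - p) * (q - x)\<close>, the
  quotient \<open>m^2 / (m^2 + e)\<close> lies in [0,1] and tends to the indicator of the open
  interval as \<open>e\<close> tends to 0. Squaring makes the derivative continuous where the
  positive part has a kink, and \<open>e\<close> keeps the denominator positive.\<close>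

definition bump :: "real \<Rightarrow> real \<Rightarrow> real \<Rightarrow> real \<Rightarrow> real" where
  "bump p q e x = (max 0 ((x - p) * (q - x)))\<^sup>2 / ((max 0 ((x - p) * (q - x)))\<^sup>2 + e)"

definition bump' :: "real \<Rightarrow> real \<Rightarrow> real \<Rightarrow> real \<Rightarrow> real" where
  "bump' p q e x = 2 * max 0 ((x - p) * (q - x)) * (p + q - 2 * x) * e / ((max 0 ((x - p) * (q - x)))\<^sup>2 + e)\<^sup>2"

lemma max0_square_pos: "e > 0 \<Longrightarrow> (max 0 x)\<^sup>2 + e > (0::real)"
  by (simp add: add_nonneg_pos)

lemma bump_bounds: "e > 0 \<Longrightarrow> 0 \<le> bump p q e x" "e > 0 \<Longrightarrow> bump p q e x \<le> 1"
  using max0_square_pos[of e "(x - p) * (q - x)"] by (auto simp: bump_def)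

lemma bump_outside: "p < q \<Longrightarrow> x \<notin> {p<..<q} \<Longrightarrow> bump p q e x = 0"
  by (auto simp: bump_def max_def not_less zero_le_mult_iff)

lemma bump_pos: "e > 0 \<Longrightarrow> p < x \<Longrightarrow> x < q \<Longrightarrow> bump p q e x > 0"
  using max0_square_pos[of e "(x - p) * (q - x)"] by (auto simp: bump_def max_def)

lemma bump_deriv: "e > 0 \<Longrightarrow> (bump p q e has_real_derivative bump' p q e x) (at x)"
proof -
  assume e: "e > 0"
  let ?m = "\<lambda>x. (x - p) * (q - x)"
  have 1: "((\<lambda>x. (max 0 (?m x))\<^sup>2) has_real_derivative 2 * max 0 (?m x) * (p + q - 2 * x)) (at x)"
    by (rule DERIV_chain2[OF has_real_derivative_max0_square])
       (auto intro!: derivative_eq_intros simp: algebra_simps)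
  show ?thesis unfolding bump_def[abs_def] bump'_def
    by (rule derivative_eq_intros 1 refl)+
       (use max0_square_pos[OF e, of "?m x"] in \<open>auto simp: power2_eq_square algebra_simps\<close>)
qed

lemma bump'_continuous: "e > 0 \<Longrightarrow> continuous_on S (bump' p q e)"
  unfolding bump'_def[abs_def]
  by (intro continuous_intros ballI) (metis max0_square_pos less_irrefl power_eq_0_iff)

lemma test_fun_bump:
  assumes "e > 0" "l < p" "p < q" "q < r"
  shows "test_fun l r (bump p q e) (bump' p q e)"
proof -
  have "bump p q e x = 0" if "x \<notin> {p..q}" for x
    by (rule bump_outside[OF assms(3)]) (use that in auto)
  thus ?thesis unfolding test_fun_def using assms bump_deriv bump'_continuous
    by (intro conjI allI exI[of _ p] exI[of _ q]) auto
qed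

lemma bump_tendsto: "p < q \<Longrightarrow> (\<lambda>n. bump p q (inverse (real (Suc n))) x) \<longlonglongrightarrow> indicator {p<..<q} x"
proof -
  assume pq: "p < q"
  show ?thesis
  proof (cases "x \<in> {p<..<q}")
    case True
    let ?m = "(max 0 ((x - p) * (q - x)))\<^sup>2"
    have "?m > 0" using True by auto
    hence "(\<lambda>n. ?m / (?m + inverse (real (Suc n)))) \<longlonglongrightarrow> ?m / (?m + 0)"
      by (intro tendsto_intros LIMSEQ_inverse_real_of_nat) auto
    thus ?thesis using True \<open>?m > 0\<close> by (simp add: bump_def)
  qed (use bump_outside[OF pq] in auto)
qed

interpretation IM: finite_measure "IM l r" for l r
  by (rule finite_measure_IM)

interpretation Q: pair_sigma_finite "IM l r" "IM l' r'" for l r l' r' ..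

abbreviation cyl :: "real \<Rightarrow> (real \<times> real) measure" where
  "cyl T \<equiv> IM 0 T \<Otimes>\<^sub>M IM 0 1"

lemma sets_IM_borel: "sets (IM l r) = sets (restrict_space borel {l<..<r})"
  by (simp add: sets_restrict_space)

lemma measurable_IM: "f \<in> borel_measurable borel \<Longrightarrow> f \<in> borel_measurable (IM l r)"
  by (intro measurable_restrict_space1) simp

lemma measurable_ident_IM [measurable]: "(\<lambda>x. x) \<in> borel_measurable (IM l r)"
  by (intro measurable_restrict_space1) simp

lemma measurable_fst_IM [measurable]: "fst \<in> borel_measurable (IM l r \<Otimes>\<^sub>M N)"
  using measurable_compose[OF measurable_fst measurable_ident_IM] by (simp add: id_def[symmetric] comp_def)

lemma measurable_snd_IM [measurable]: "snd \<in> borel_measurable (N \<Otimes>\<^sub>M IM l r)"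
  using measurable_compose[OF measurable_snd measurable_ident_IM] by (simp add: id_def[symmetric] comp_def)

lemma measurable_pair_IM:
  assumes "case_prod f \<in> borel_measurable (borel \<Otimes>\<^sub>M borel)"
  shows "case_prod f \<in> borel_measurable (IM l r \<Otimes>\<^sub>M IM l' r')"
proof -
  have "(\<lambda>z. (fst z, snd z)) \<in> (IM l r \<Otimes>\<^sub>M IM l' r') \<rightarrow>\<^sub>M (borel \<Otimes>\<^sub>M borel)" by measurable
  from measurable_compose[OF this assms] show ?thesis by simp
qed

lemma bump_measurable [measurable]: "bump p q e \<in> borel_measurable borel"
  unfolding bump_def[abs_def] by measurable

lemma bump'_measurable [measurable]: "bump' p q e \<in> borel_measurable borel"
  unfolding bump'_def[abs_def] by measurable

lemma integrable_IM_bounded: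
  assumes "f \<in> borel_measurable (IM l r)" "\<And>x. l < x \<Longrightarrow> x < r \<Longrightarrow> \<bar>f x\<bar> \<le> (B::real)"
  shows "integrable (IM l r) f"
  by (rule IM.integrable_const_bound[where B=B])
     (use assms in \<open>auto simp: AE_IM_iff\<close>)

lemma integrable_mult_bounded:
  fixes f g :: "'a \<Rightarrow> real"
  assumes "integrable M f" "g \<in> borel_measurable M" "AE x in M. \<bar>g x\<bar> \<le> B"
  shows "integrable M (\<lambda>x. f x * g x)"
proof (rule Bochner_Integration.integrable_bound)
  show "integrable M (\<lambda>x. f x * B)" using assms by simp
  show "(\<lambda>x. f x * g x) \<in> borel_measurable M" using assms by measurable
  show "AE x in M. norm (f x * g x) \<le> norm (f x * B)"
    using assms(3) by eventually_elim (auto simp: abs_mult intro!: mult_left_mono)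
qed

text \<open>The test functions only need to separate functions modulo functions of \<open>x\<close> alone:
  \<open>\<theta> - (\<integral>\<theta>) \<eta>\<close> has a compactly supported antiderivative whenever \<open>\<integral>\<eta> = 1\<close>.\<close>
lemma test_fun_antiderivative:
  assumes th: "test_fun l r th th'" and z: "(LBINT u:{l..r}. th u) = 0" and lr: "l < r"
  obtains al where "test_fun l r al th" "continuous_on UNIV th"
proof -
  obtain c d where cd: "l < c" "c \<le> d" "d < r" "\<And>x. x \<notin> {c..d} \<Longrightarrow> th x = 0"
    using th by (auto simp: test_fun_def)
  have cont: "continuous_on UNIV th" using th 
    by (auto simp: test_fun_def intro!: continuous_at_imp_continuous_on DERIV_isCont)
  define al where "al x = (LBINT y=ereal l..ereal x. th y)" for x
  have der: "(al has_real_derivative th x) (at x)" for x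
  proof -
    let ?a = "min l x - 1" and ?b = "max l x + 1"
    have "(al has_vector_derivative th x) (at x within {?a..?b})"
      unfolding al_def
      by (rule interval_integral_FTC2) (auto intro: continuous_on_subset[OF cont])
    moreover have "at x within {?a..?b} = at x"
      by (rule at_within_interior) (auto simp: interior_atLeastAtMost_real)
    ultimately show ?thesis by (simp add: has_real_derivative_iff_has_vector_derivative)
  qed
  \<comment> \<open>To the left of the support nothing has been integrated yet; to the right of it
    the whole integral has, and that is 0 by \<open>z\<close>.\<close>
  have out: "al x = 0" if "x \<notin> {c..d}" for x
  proof (cases "x < c")
    case True
    have "al x = (LBINT y=ereal l..ereal x. 0)" unfolding al_def
    proof (rule interval_integral_cong)
      fix y assume "y \<in> einterval (min (ereal l) (ereal x)) (max (ereal l) (ereal x))"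
      hence "y < max l x" by (auto simp: einterval_iff max_def split: if_splits)
      hence "y < c" using True cd(1) by linarith
      thus "th y = 0" using cd(4)[of y] by auto
    qed
    thus ?thesis by simp
  next
    case False
    hence x: "x > d" using that by auto
    have "al x = al r"
    proof -
      have i: "interval_lebesgue_integrable lborel (ereal p) (ereal q) th" if "p \<le> q" for p q
        using that by (intro interval_integrable_continuous_on) (auto intro: continuous_on_subset[OF cont])
      have "al r = al x + (LBINT y=ereal x..ereal r. th y)"
        unfolding al_def by (rule interval_integral_sum[symmetric]) (use i lr x cd in \<open>auto simp: min_def max_def\<close>)

      also have "(LBINT y=ereal x..ereal r. th y) = (LBINT y=ereal x..ereal r. 0)"
      proof (rule interval_integral_cong)
        fix y assume "y \<in> einterval (min (ereal x) (ereal r)) (max (ereal x) (ereal r))"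
        hence "min x r < y" by (auto simp: einterval_iff min_def split: if_splits)
        hence "y > d" using x cd(3) by linarith
        thus "th y = 0" using cd(4)[of y] by auto

      qed
      finally show ?thesis by simp
    qed
    thus ?thesis using z lr by (simp add: al_def interval_integral_Icc)
  qed
  have "test_fun l r al th" unfolding test_fun_def using der cont cd out
    by (intro conjI allI exI[of _ c] exI[of _ d]) auto
  thus ?thesis using that cont by blast
qed

lemma test_fun_diff_cmult:
  assumes "test_fun l r f f'" "test_fun l r g g'"
  shows "test_fun l r (\<lambda>x. f x - k * g x) (\<lambda>x. f' x - k * g' x)"
proof -
  obtain c d where 1: "l < c" "c \<le> d" "d < r" "\<And>x. x \<notin> {c..d} \<Longrightarrow> f x = 0"
    using assms(1) by (auto simp: test_fun_def)
  obtain c' d' where 2: "l < c'" "c' \<le> d'" "d' < r" "\<And>x. x \<notin> {c'..d'} \<Longrightarrow> g x = 0"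
    using assms(2) by (auto simp: test_fun_def)
  have "f x - k * g x = 0" if "x \<notin> {min c c'..max d d'}" for x
  proof -
    have "x \<notin> {c..d}" "x \<notin> {c'..d'}" using that by auto
    thus "f x - k * g x = 0" using 1(4) 2(4) by simp
  qed
  moreover have "\<forall>x. ((\<lambda>x. f x - k * g x) has_real_derivative f' x - k * g' x) (at x)"
    using assms by (auto simp: test_fun_def intro!: derivative_eq_intros)
  moreover have "continuous_on UNIV (\<lambda>x. f' x - k * g' x)"
    using assms by (auto simp: test_fun_def intro!: continuous_intros)
  moreover have "l < min c c'" "min c c' \<le> max d d'" "max d d' < r" using 1 2 by auto
  ultimately show ?thesis unfolding test_fun_def by blast

qed

lemma test_fun_bounded:
  assumes "test_fun l r f f'"
  obtains B where "\<And>x. \<bar>f x\<bar> \<le> B" "B > 0"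
proof -
  obtain c d where cd: "l < c" "c \<le> d" "d < r" "\<And>x. x \<notin> {c..d} \<Longrightarrow> f x = 0"
    using assms by (auto simp: test_fun_def)
  have "continuous_on {c..d} f" using assms 
    by (auto simp: test_fun_def intro!: continuous_at_imp_continuous_on DERIV_isCont)
  then obtain B where "\<forall>x\<in>{c..d}. norm (f x) \<le> B"
    using compact_imp_bounded[OF compact_continuous_image] by (fastforce simp: bounded_iff)
  hence "\<bar>f x\<bar> \<le> \<bar>B\<bar> + 1" for x using cd(4)[of x] by (cases "x \<in> {c..d}") force+
  thus ?thesis using that[of "\<bar>B\<bar> + 1"] by auto
qed

lemma test_fun_measurable:
  assumes "test_fun l r f f'" shows "f \<in> borel_measurable borel" "f' \<in> borel_measurable borel"
proof -
  have "continuous_on UNIV f" "continuous_on UNIV f'" using assms unfolding test_fun_def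
    by (auto intro!: continuous_at_imp_continuous_on DERIV_isCont)
  thus "f \<in> borel_measurable borel" "f' \<in> borel_measurable borel"
    by (auto intro: borel_measurable_continuous_onI)
qed


text \<open>Two limits by dominated convergence: bumps tend to indicators of rectangles compactly
  inside the cylinder, and these exhaust arbitrary rectangles. All box integrals of
  \<open>k\<close>, extended by 0, therefore vanish.\<close>

lemma AE_zero_if_test_integrals_zero:
  fixes k :: "real \<times> real \<Rightarrow> real"
  assumes k: "integrable (cyl T) k"
    and z: "\<And>th th' be be'. test_fun 0 T th th' \<Longrightarrow> test_fun 0 1 be be' \<Longrightarrow>
       (\<integral>z. k z * th (fst z) * be (snd z) \<partial>(cyl T)) = 0"
  shows "AE z in cyl T. k z = 0"
proof -
  let ?Q = "cyl T"
  have [measurable]: "k \<in> borel_measurable ?Q" using k by auto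
  have 1: "(\<integral>z. k z * indicator {p<..<q} (fst z) * indicator {p'<..<q'} (snd z) \<partial>?Q) = 0"
    if "0 < p" "p < q" "q < T" "0 < p'" "p' < q'" "q' < 1" for p q p' q'
  proof -
    let ?e = "\<lambda>n. inverse (real (Suc n))"
    have e: "?e n > 0" for n by simp
    have "(\<lambda>n. \<integral>z. k z * bump p q (?e n) (fst z) * bump p' q' (?e n) (snd z) \<partial>?Q) \<longlonglongrightarrow>
       (\<integral>z. k z * indicator {p<..<q} (fst z) * indicator {p'<..<q'} (snd z) \<partial>?Q)"
    proof (rule integral_dominated_convergence)
      show "integrable ?Q (\<lambda>z. \<bar>k z\<bar>)" using k by simp
      show "AE z in ?Q. (\<lambda>n. k z * bump p q (?e n) (fst z) * bump p' q' (?e n) (snd z)) \<longlonglongrightarrow>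
          k z * indicator {p<..<q} (fst z) * indicator {p'<..<q'} (snd z)"
        by (intro AE_I2 tendsto_intros bump_tendsto that)
      show "AE z in ?Q. norm (k z * bump p q (?e n) (fst z) * bump p' q' (?e n) (snd z)) \<le> \<bar>k z\<bar>" for n
      proof (rule AE_I2)
        fix z
        have "\<bar>k z\<bar> * (bump p q (?e n) (fst z) * bump p' q' (?e n) (snd z)) \<le> \<bar>k z\<bar> * 1"
          by (intro mult_left_mono mult_le_one bump_bounds e) auto
        thus "norm (k z * bump p q (?e n) (fst z) * bump p' q' (?e n) (snd z)) \<le> \<bar>k z\<bar>"
          using bump_bounds(1)[OF e] by (simp add: abs_mult mult.assoc)
      qed
    qed measurable
    moreover have "(\<integral>z. k z * bump p q (?e n) (fst z) * bump p' q' (?e n) (snd z) \<partial>?Q) = 0" for n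
      by (rule z[OF test_fun_bump test_fun_bump]) (use e that in auto)
    ultimately show ?thesis by (simp add: LIMSEQ_const_iff)
  qed
  have 2: "(\<integral>z. k z * indicator {p<..<q} (fst z) * indicator {p'<..<q'} (snd z) \<partial>?Q) = 0"
    if "0 < p" "q < T" "0 < p'" "q' < 1" for p q p' q'
    using 1[of p q p' q'] that by (cases "p < q \<and> p' < q'") auto
  \<comment> \<open>Clipping at distance \<open>1/(n+1)\<close> from the boundary reduces any
    rectangle to those covered by \<open>2\<close>.\<close>
  have 3: "(\<integral>z. k z * indicator {p<..<q} (fst z) * indicator {p'<..<q'} (snd z) \<partial>?Q) = 0" for p q p' q'
  proof -
    let ?e = "\<lambda>n. inverse (real (Suc n))"
    let ?A = "\<lambda>n. {max p (?e n)<..<min q (T - ?e n)}" and ?B = "\<lambda>n. {max p' (?e n)<..<min q' (1 - ?e n)}"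
    have lim: "(\<lambda>n. indicator {max p (?e n)<..<min q (r - ?e n)} x :: real) \<longlonglongrightarrow> indicator {p<..<q} x"
      if "0 < x" "x < r" for p q r x
    proof (rule tendsto_eventually)
      have "\<forall>\<^sub>F n in sequentially. ?e n < min x (r - x)"
        using order_tendstoD(2)[OF LIMSEQ_inverse_real_of_nat, of "min x (r - x)"] that by auto
      thus "\<forall>\<^sub>F n in sequentially. (indicator {max p (?e n)<..<min q (r - ?e n)} x :: real) = indicator {p<..<q} x"
        by eventually_elim (auto simp: indicator_def)
    qed
    have "(\<lambda>n. \<integral>z. k z * indicator (?A n) (fst z) * indicator (?B n) (snd z) \<partial>?Q) \<longlonglongrightarrow>
       (\<integral>z. k z * indicator {p<..<q} (fst z) * indicator {p'<..<q'} (snd z) \<partial>?Q)"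
    proof (rule integral_dominated_convergence)
      show "integrable ?Q (\<lambda>z. \<bar>k z\<bar>)" using k by simp
      show "AE z in ?Q. (\<lambda>n. k z * indicator (?A n) (fst z) * indicator (?B n) (snd z)) \<longlonglongrightarrow>
          k z * indicator {p<..<q} (fst z) * indicator {p'<..<q'} (snd z)"
        by (intro AE_I2 tendsto_intros lim) (auto simp: space_pair_measure)
      show "AE z in ?Q. norm (k z * indicator (?A n) (fst z) * indicator (?B n) (snd z)) \<le> \<bar>k z\<bar>" for n
        by (intro AE_I2) (auto simp: indicator_def)
    qed measurable
    moreover have "(\<integral>z. k z * indicator (?A n) (fst z) * indicator (?B n) (snd z) \<partial>?Q) = 0" for n
    proof -
      have "0 < ?e n" by simp
      thus ?thesis by (intro 2) (auto simp: less_max_iff_disj min_less_iff_disj simp del: inverse_positive_iff_positive)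
    qed
    ultimately show ?thesis by (simp add: LIMSEQ_const_iff)
  qed
  have Qm: "Qset T \<inter> space lborel \<in> sets lborel" unfolding Qset_def by (auto intro!: borel_open open_Times)
  have ki: "integrable lborel (\<lambda>z. indicator (Qset T) z * k z)"
    using k integrable_restrict_space[OF Qm, of k] by (simp add: restrict_space_Qset)
  have "AE z in lborel. indicator (Qset T) z * k z = 0"
  proof (rule AE_zero_if_integral_box_zero[OF ki])
    fix a b :: "real \<times> real"
    obtain p p' where a: "a = (p, p')" by force
    obtain q q' where b: "b = (q, q')" by force
    have "(LINT z:box a b|lborel. indicator (Qset T) z * k z) = (\<integral>z. indicator (Qset T) z *\<^sub>R (indicator (box a b) z * k z) \<partial>lborel)"
      unfolding set_lebesgue_integral_def by (intro Bochner_Integration.integral_cong) auto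
    also have "\<dots> = (\<integral>z. indicator (box a b) z * k z \<partial>?Q)"
      using integral_restrict_space[OF Qm, of "\<lambda>z. indicator (box a b) z * k z"] by (simp add: restrict_space_Qset)
    also have "\<dots> = (\<integral>z. k z * indicator {p<..<q} (fst z) * indicator {p'<..<q'} (snd z) \<partial>?Q)"
      by (intro Bochner_Integration.integral_cong)
         (auto simp: a b indicator_def box_def Basis_prod_def split: if_splits)
    finally show "(LINT z:box a b|lborel. indicator (Qset T) z * k z) = 0" using 3 by simp
  qed
  hence "AE z in lborel. z \<in> Qset T \<longrightarrow> k z = 0" by eventually_elim (auto simp: indicator_def)
  thus ?thesis unfolding restrict_space_Qset[symmetric] AE_restrict_space_iff[OF Qm] .

qed

section \<open>Weak time derivatives\<close>

lemma primitive_measurable [measurable]: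
  fixes w :: "real \<Rightarrow> real \<Rightarrow> real"
  assumes [measurable]: "case_prod w \<in> borel_measurable (borel \<Otimes>\<^sub>M borel)"
  shows "(\<lambda>(t, x). LBINT u:{0..t}. w u x) \<in> borel_measurable (borel \<Otimes>\<^sub>M borel)"
proof -
  \<comment> \<open>Moving the variable end point into the integrand leaves a parametrised integral
    over a fixed domain.\<close>
  have "(\<lambda>z. \<integral>u. (if 0 \<le> u \<and> u \<le> fst z then w u (snd z) else 0) \<partial>lborel) \<in> borel_measurable (borel \<Otimes>\<^sub>M borel)"
    by measurable
  moreover have "(\<integral>u. (if 0 \<le> u \<and> u \<le> t then w u x else 0) \<partial>lborel) = (LBINT u:{0..t}. w u x)" for t x
    unfolding set_lebesgue_integral_def by (rule Bochner_Integration.integral_cong) (auto simp: indicator_def)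
  ultimately show ?thesis by (simp add: case_prod_unfold)
qed

lemma primitive_bound:
  fixes f :: "real \<Rightarrow> real"
  assumes "integrable (IM 0 T) f" "0 < t" "t < T"
  shows "\<bar>LBINT u:{0..t}. f u\<bar> \<le> (\<integral>u. \<bar>f u\<bar> \<partial>IM 0 T)"
proof -
  have i: "set_integrable lborel {0..T} f" using assms by (simp add: integrable_IM)
  hence it: "set_integrable lborel {0..t} f" by (rule set_integrable_subset) (use assms in auto)
  have "\<bar>LBINT u:{0..t}. f u\<bar> \<le> (LBINT u:{0..t}. \<bar>f u\<bar>)"
    using integral_abs_bound[of lborel "\<lambda>x. indicator {0..t} x * f x"]
    by (simp add: set_lebesgue_integral_def abs_mult)
  also have "\<dots> \<le> (LBINT u:{0..T}. \<bar>f u\<bar>)"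
  proof -
    have a: "set_integrable lborel {0..T} (\<lambda>u. \<bar>f u\<bar>)" using i by (rule set_integrable_abs)
    have "(LBINT u:{t..T}. \<bar>f u\<bar>) \<ge> 0"
      unfolding set_lebesgue_integral_def by (rule integral_nonneg_AE) auto
    thus ?thesis using set_integral_Icc_split[OF a, of t T] assms by simp
  qed
  finally show ?thesis by (simp add: integral_IM)
qed

text \<open>The primitive is dominated by the full time integral of the absolute value of
  \<open>w\<close>, a function of \<open>x\<close> alone.\<close>

lemma primitive_integrable:
  fixes w :: "real \<Rightarrow> real \<Rightarrow> real"
  assumes wm: "case_prod w \<in> borel_measurable (borel \<Otimes>\<^sub>M borel)"
    and w: "integrable (cyl T) (case_prod w)"
  shows "integrable (cyl T) (\<lambda>(t, x). LBINT u:{0..t}. w u x)"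
proof -
  have w': "integrable (cyl T) (\<lambda>(t,x). \<bar>w t x\<bar>)"
    using integrable_abs[OF w] by (simp add: case_prod_unfold)
  show ?thesis
  proof (rule Bochner_Integration.integrable_bound)
    show "integrable (cyl T) (\<lambda>z. 1 * (\<integral>u. \<bar>w u (snd z)\<bar> \<partial>IM 0 T))"
      by (rule Q.integrable_prod_mult) (use Q.integrable_snd[OF w'] in auto)
    show "(\<lambda>(t, x). LBINT u:{0..t}. w u x) \<in> borel_measurable (cyl T)"
      by (rule measurable_pair_IM primitive_measurable wm)+
    have "AE z in cyl T. integrable (IM 0 T) (\<lambda>t. w t (snd z))"
      by (rule Q.AE_pair_snd) (rule Q.AE_integrable_snd[OF w])
    with AE_space show "AE z in cyl T. norm (case z of (t, x) \<Rightarrow> LBINT u:{0..t}. w u x)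
          \<le> norm (1 * (\<integral>u. \<bar>w u (snd z)\<bar> \<partial>IM 0 T))"
    proof eventually_elim
      case (elim z)
      have "(\<integral>u. \<bar>w u (snd z)\<bar> \<partial>IM 0 T) \<ge> 0" by (rule integral_nonneg_AE) auto
      thus ?case using primitive_bound[OF elim(2), of "fst z"] elim(1)
        by (auto simp: space_pair_measure case_prod_unfold)
    qed
  qed
qed

lemma ac_on_primitive:
  "set_integrable lborel {0..T} f \<Longrightarrow> ac_on 0 T (\<lambda>t. c + (LBINT u:{0..t}. f u)) f"
  by (rule ac_onI) auto

lemma test_fun_divide:
  assumes "test_fun l r f f'" shows "test_fun l r (\<lambda>x. f x / k) (\<lambda>x. f' x / k)"
proof -
  have "((\<lambda>x. f x / k) has_real_derivative f' x / k) (at x)" for x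
    using assms by (intro DERIV_cdivide) (auto simp: test_fun_def)
  moreover have "continuous_on UNIV (\<lambda>x. f' x / k)"
    using assms by (cases "k = 0") (auto simp: test_fun_def intro!: continuous_intros)
  ultimately show ?thesis using assms unfolding test_fun_def by fastforce
qed

lemma ac_on_test_fun:

  assumes "test_fun l r al al'" shows "ac_on l r al al'"
  using assms by (intro ac_on_C1) (auto simp: test_fun_def intro: has_field_derivative_at_within continuous_on_subset)

text \<open>Integration by parts in \<open>t\<close> for almost every \<open>x\<close>. The test
  function vanishes at \<open>0\<close> and \<open>T\<close>, so there are no boundary terms, and
  Fubini returns to the cylinder.\<close>

lemma primitive_weak_dt:
  fixes w :: "real \<Rightarrow> real \<Rightarrow> real"
  assumes T: "0 < T" and wm: "case_prod w \<in> borel_measurable (borel \<Otimes>\<^sub>M borel)"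
    and w: "integrable (cyl T) (case_prod w)"
    and al: "test_fun 0 T al al'" and be: "test_fun 0 1 be be'"
    and al'b: "\<And>t. \<bar>al' t\<bar> \<le> B"
  shows "(\<integral>z. (LBINT u:{0..fst z}. w u (snd z)) * al' (fst z) * be (snd z) \<partial>(cyl T))
    = - (\<integral>z. w (fst z) (snd z) * al (fst z) * be (snd z) \<partial>(cyl T))"
proof -
  let ?Q = "cyl T"
  let ?V = "\<lambda>t x. LBINT u:{0..t}. w u x"
  note [measurable] = test_fun_measurable[OF al] test_fun_measurable[OF be]
  obtain Ba where Ba: "\<And>t. \<bar>al t\<bar> \<le> Ba" "Ba > 0" using test_fun_bounded[OF al] by blast
  obtain Bb where Bb: "\<And>t. \<bar>be t\<bar> \<le> Bb" "Bb > 0" using test_fun_bounded[OF be] by blast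
  have iV: "integrable ?Q (\<lambda>(t,x). ?V t x * al' t * be x)"
  proof -
    have "integrable ?Q (\<lambda>z. (case_prod ?V z * al' (fst z)) * be (snd z))"
      by (intro integrable_mult_bounded[where B=B] integrable_mult_bounded[where B=Bb] primitive_integrable[OF wm w])
         (use al'b Bb in auto)
    thus ?thesis by (simp add: case_prod_unfold)
  qed
  have iw: "integrable ?Q (\<lambda>(t,x). w t x * al t * be x)"
  proof -
    have "integrable ?Q (\<lambda>z. (case_prod w z * al (fst z)) * be (snd z))"
      by (intro integrable_mult_bounded[where B=Ba] integrable_mult_bounded[where B=Bb] w)
         (use Ba Bb in auto)
    thus ?thesis by (simp add: case_prod_unfold)
  qed
  have al0: "al 0 = 0" "al T = 0" using al by (auto simp: test_fun_def)
  have "AE x in IM 0 1. (\<integral>t. ?V t x * al' t * be x \<partial>IM 0 T) = - (\<integral>t. w t x * al t * be x \<partial>IM 0 T)"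
    using Q.AE_integrable_snd[OF w]
  proof eventually_elim
    case (elim x)
    hence i: "set_integrable lborel {0..T} (\<lambda>t. w t x)" by (simp add: integrable_IM)
    have ac: "ac_on 0 T (\<lambda>t. ?V t x) (\<lambda>t. w t x)" using ac_on_primitive[OF i, of 0] by simp
    have "ac_on 0 T (\<lambda>t. ?V t x * al t) (\<lambda>t. w t x * al t + ?V t x * al' t)"
      by (rule ac_on_mult[OF ac ac_on_test_fun[OF al]])
    from ac_onD(2)[OF this, of 0 T] T
    have "(LBINT t:{0..T}. w t x * al t + ?V t x * al' t) = 0" using al0 by simp
    also have "(LBINT t:{0..T}. w t x * al t + ?V t x * al' t) = (LBINT t:{0..T}. w t x * al t) + (LBINT t:{0..T}. ?V t x * al' t)"
    proof (rule set_integral_add(2))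
      show "set_integrable lborel {0..T} (\<lambda>t. w t x * al t)"
        by (rule set_integrable_mult_continuous[OF i ac_on_continuous[OF ac_on_test_fun[OF al]]])
      have "set_integrable lborel {0..T} (\<lambda>t. al' t * ?V t x)"
        by (rule set_integrable_mult_continuous[OF ac_onD(1)[OF ac_on_test_fun[OF al]] ac_on_continuous[OF ac]])
      thus "set_integrable lborel {0..T} (\<lambda>t. ?V t x * al' t)" by (simp add: mult.commute)
    qed
    finally have "(LBINT t:{0..T}. ?V t x * al' t) = - (LBINT t:{0..T}. w t x * al t)" by linarith
    thus ?case by (simp add: integral_IM)
  qed
  hence "(\<integral>x. (\<integral>t. ?V t x * al' t * be x \<partial>IM 0 T) \<partial>IM 0 1) = (\<integral>x. - (\<integral>t. w t x * al t * be x \<partial>IM 0 T) \<partial>IM 0 1)"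
    using Q.integrable_snd[OF iV] Q.integrable_snd[OF iw] by (intro integral_cong_AE) auto
  thus ?thesis using Q.integral_snd[OF iV] Q.integral_snd[OF iw] by (simp add: case_prod_unfold)
qed

text \<open>The lemma of du Bois-Reymond with \<open>x\<close> as a parameter. The difference
  \<open>h\<close> of \<open>f\<close> and the primitive of \<open>w\<close> is orthogonal to all
  products \<open>al' * be\<close>. Since \<open>th - (\<integral>th) eta\<close> is such an
  \<open>al'\<close>, orthogonality extends to every \<open>th\<close> once the average
  \<open>c\<close> of \<open>h\<close> against \<open>eta\<close> has been subtracted.\<close>

lemma weak_dt_repr:
  fixes f w :: "real \<Rightarrow> real \<Rightarrow> real"
  assumes T: "0 < T" and fm: "case_prod f \<in> borel_measurable (borel \<Otimes>\<^sub>M borel)"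
    and wm: "case_prod w \<in> borel_measurable (borel \<Otimes>\<^sub>M borel)"
    and f: "integrable (cyl T) (case_prod f)"
    and w: "integrable (cyl T) (case_prod w)"
    and wd: "weak_dt T f w"
  obtains c where "integrable (IM 0 1) c"
    "AE z in cyl T. f (fst z) (snd z) = c (snd z) + (LBINT u:{0..fst z}. w u (snd z))"
proof -
  let ?Q = "cyl T"
  let ?V = "\<lambda>t x. LBINT u:{0..t}. w u x"
  have Qm: "Qset T \<inter> space lborel \<in> sets lborel" unfolding Qset_def by (auto intro!: borel_open open_Times)
  define h where "h = (\<lambda>z. f (fst z) (snd z) - ?V (fst z) (snd z))"
  have V: "integrable ?Q (\<lambda>z. ?V (fst z) (snd z))"
    using primitive_integrable[OF wm w] by (simp add: case_prod_unfold)
  have f': "integrable ?Q (\<lambda>z. f (fst z) (snd z))" and w': "integrable ?Q (\<lambda>z. w (fst z) (snd z))"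
    using f w by (simp_all add: case_prod_unfold)
  have h: "integrable ?Q h" unfolding h_def using f' V by simp
  have [measurable]: "h \<in> borel_measurable ?Q" using h by auto
  have h0: "(\<integral>z. h z * al' (fst z) * be (snd z) \<partial>?Q) = 0"
    if al: "test_fun 0 T al al'" and be: "test_fun 0 1 be be'" and B: "\<And>t. \<bar>al' t\<bar> \<le> B" for al al' be be' B
  proof -
    note [measurable] = test_fun_measurable[OF al] test_fun_measurable[OF be]
    obtain Bb where Bb: "\<And>t. \<bar>be t\<bar> \<le> Bb" "Bb > 0" using test_fun_bounded[OF be] by blast
    have "(\<integral>z. f (fst z) (snd z) * al' (fst z) * be (snd z) \<partial>?Q) = - (\<integral>z. w (fst z) (snd z) * al (fst z) * be (snd z) \<partial>?Q)"
      using wd al be unfolding weak_dt_def set_lebesgue_integral_def integral_restrict_space[OF Qm, symmetric] restrict_space_Qset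
      by blast
    moreover have "integrable ?Q (\<lambda>z. f (fst z) (snd z) * al' (fst z) * be (snd z))"
      by (intro integrable_mult_bounded[where B=B] integrable_mult_bounded[where B=Bb] f') (use B Bb in auto)
    moreover have "integrable ?Q (\<lambda>z. ?V (fst z) (snd z) * al' (fst z) * be (snd z))"
      by (intro integrable_mult_bounded[where B=B] integrable_mult_bounded[where B=Bb] V) (use B Bb in auto)
    ultimately show ?thesis using primitive_weak_dt[OF T wm w al be B]
      by (simp add: h_def left_diff_distrib)
  qed
  \<comment> \<open>Any fixed test function of integral 1 would serve; this one is a normalised bump
    on the middle half of the interval.\<close>
  define eta where "eta = (\<lambda>t. bump (T/4) (3*T/4) 1 t / (LBINT u:{0..T}. bump (T/4) (3*T/4) 1 u))"
  have b: "test_fun 0 T (bump (T/4) (3*T/4) 1) (bump' (T/4) (3*T/4) 1)"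
    by (rule test_fun_bump) (use T in auto)
  have bi: "set_integrable lborel {0..T} (bump (T/4) (3*T/4) 1)"
    unfolding integrable_IM[symmetric] by (rule integrable_IM_bounded[where B=1]) (auto intro!: measurable_IM simp: abs_le_iff bump_bounds order_trans[OF _ bump_bounds(1)])
  have pos: "(LBINT u:{0..T}. bump (T/4) (3*T/4) 1 u) > 0"
  proof -
    have "(LBINT u:{0..T}. bump (T/4) (3*T/4) 1 u) \<noteq> 0"
    proof
      assume "(LBINT u:{0..T}. bump (T/4) (3*T/4) 1 u) = 0"
      hence "(\<integral>u. bump (T/4) (3*T/4) 1 u \<partial>IM 0 T) = 0" by (simp add: integral_IM)
      hence "AE u in IM 0 T. bump (T/4) (3*T/4) 1 u = 0"
        using bi by (subst (asm) integral_nonneg_eq_0_iff_AE) (auto simp: integrable_IM bump_bounds)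
      hence "AE u in lborel. u \<notin> {T/4<..<3*T/4}"
        unfolding AE_IM_iff by eventually_elim (use T bump_pos[of 1 "T/4" _ "3*T/4"] in force)
      hence "emeasure lborel {T/4<..<3*T/4} = 0" by (subst (asm) AE_iff_null_sets[symmetric]) auto

      thus False using T by simp
    qed
    moreover have "(LBINT u:{0..T}. bump (T/4) (3*T/4) 1 u) \<ge> 0"
      unfolding set_lebesgue_integral_def by (rule integral_nonneg_AE) (auto simp: bump_bounds)
    ultimately show ?thesis by simp
  qed
  have eta: "test_fun 0 T eta (\<lambda>t. bump' (T/4) (3*T/4) 1 t / (LBINT u:{0..T}. bump (T/4) (3*T/4) 1 u))"
    unfolding eta_def by (rule test_fun_divide[OF b])
  have eta1: "(LBINT u:{0..T}. eta u) = 1" using pos by (simp add: eta_def)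
  note [measurable] = test_fun_measurable(1)[OF eta]
  obtain Be where Be: "\<And>t. \<bar>eta t\<bar> \<le> Be" "Be > 0" using test_fun_bounded[OF eta] by blast
  define c where "c = (\<lambda>x. \<integral>t. h (t, x) * eta t \<partial>IM 0 T)"
  have heta: "integrable ?Q (\<lambda>(t, x). h (t, x) * eta t)"
    using integrable_mult_bounded[OF h, of "\<lambda>z. eta (fst z)" Be] Be by (simp add: case_prod_unfold)
  have c: "integrable (IM 0 1) c" unfolding c_def by (rule Q.integrable_snd[OF heta])
  have [measurable]: "c \<in> borel_measurable (IM 0 1)" using c by auto
  have csnd: "integrable ?Q (\<lambda>z. c (snd z))"
    using Q.integrable_prod_mult[of 0 T "\<lambda>_. 1", OF _ c] by simp
  have k: "integrable ?Q (\<lambda>z. h z - c (snd z))" using h csnd by simp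
  have "AE z in ?Q. h z - c (snd z) = 0"
  proof (rule AE_zero_if_test_integrals_zero[OF k])
    fix th th' be be' assume th: "test_fun 0 T th th'" and be: "test_fun 0 1 be be'"
    note [measurable] = test_fun_measurable[OF th] test_fun_measurable[OF be]
    obtain Bb where Bb: "\<And>t. \<bar>be t\<bar> \<le> Bb" "Bb > 0" using test_fun_bounded[OF be] by blast
    obtain Bt where Bt: "\<And>t. \<bar>th t\<bar> \<le> Bt" "Bt > 0" using test_fun_bounded[OF th] by blast
    let ?I = "LBINT u:{0..T}. th u"
    have thi: "integrable (IM 0 T) th" "integrable (IM 0 T) eta"
      by (rule integrable_IM_bounded[OF _ Bt(1)], measurable)
         (rule integrable_IM_bounded[OF _ Be(1)], measurable)

    have tf: "test_fun 0 T (\<lambda>t. th t - ?I * eta t) (\<lambda>t. th' t - ?I * (bump' (T/4) (3*T/4) 1 t / (LBINT u:{0..T}. bump (T/4) (3*T/4) 1 u)))"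
      by (rule test_fun_diff_cmult[OF th eta])
    \<comment> \<open>Integral 0 is the condition under which a compactly supported antiderivative
      exists.\<close>
    have tz: "(LBINT u:{0..T}. th u - ?I * eta u) = 0"
      using thi eta1 by (subst set_integral_diff) (auto simp: integrable_IM)
    obtain al where al: "test_fun 0 T al (\<lambda>t. th t - ?I * eta t)"
      by (rule test_fun_antiderivative[OF tf tz T])

    have "\<bar>th t - ?I * eta t\<bar> \<le> Bt + \<bar>?I\<bar> * Be" for t
    proof -
      have "\<bar>th t - ?I * eta t\<bar> \<le> \<bar>th t\<bar> + \<bar>?I\<bar> * \<bar>eta t\<bar>" unfolding abs_mult[symmetric] by simp
      also have "\<dots> \<le> Bt + \<bar>?I\<bar> * Be" by (intro add_mono mult_left_mono Bt Be) auto
      finally show ?thesis .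
    qed
    from h0[OF al be this]
    have 1: "(\<integral>z. h z * (th (fst z) - ?I * eta (fst z)) * be (snd z) \<partial>?Q) = 0" .
    have i1: "integrable ?Q (\<lambda>z. h z * th (fst z) * be (snd z))"
      by (intro integrable_mult_bounded[where B=Bt] integrable_mult_bounded[where B=Bb] h) (use Bt Bb in auto)
    have i2: "integrable ?Q (\<lambda>z. h z * eta (fst z) * be (snd z))"
      by (intro integrable_mult_bounded[where B=Be] integrable_mult_bounded[where B=Bb] h) (use Be Bb in auto)
    have i3: "integrable ?Q (\<lambda>z. c (snd z) * th (fst z) * be (snd z))"
      by (intro integrable_mult_bounded[where B=Bt] integrable_mult_bounded[where B=Bb] csnd) (use Bt Bb in auto)
    have "(\<integral>z. h z * th (fst z) * be (snd z) \<partial>?Q) - ?I * (\<integral>z. h z * eta (fst z) * be (snd z) \<partial>?Q) =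
      (\<integral>z. h z * th (fst z) * be (snd z) - ?I * (h z * eta (fst z) * be (snd z)) \<partial>?Q)"
      using i1 i2 by simp
    also have "\<dots> = 0" using 1 by (simp add: algebra_simps)
    finally have 2: "(\<integral>z. h z * th (fst z) * be (snd z) \<partial>?Q) = ?I * (\<integral>z. h z * eta (fst z) * be (snd z) \<partial>?Q)" by simp
    have i2': "integrable ?Q (\<lambda>(t,x). h (t,x) * eta t * be x)" using i2 by (simp add: case_prod_unfold)
    have "(\<integral>z. h z * eta (fst z) * be (snd z) \<partial>?Q) = (\<integral>x. \<integral>t. h (t,x) * eta t * be x \<partial>IM 0 T \<partial>IM 0 1)"
      using Q.integral_snd[OF i2'] by (simp add: case_prod_unfold)
    also have "\<dots> = (\<integral>x. c x * be x \<partial>IM 0 1)" unfolding c_def by simp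
    finally have 3: "(\<integral>z. h z * eta (fst z) * be (snd z) \<partial>?Q) = (\<integral>x. c x * be x \<partial>IM 0 1)" .
    have i3': "integrable ?Q (\<lambda>(t,x). c x * th t * be x)" using i3 by (simp add: case_prod_unfold)
    have "(\<integral>z. c (snd z) * th (fst z) * be (snd z) \<partial>?Q) = (\<integral>x. \<integral>t. c x * th t * be x \<partial>IM 0 T \<partial>IM 0 1)"
      using Q.integral_snd[OF i3'] by (simp add: case_prod_unfold)
    also have "\<dots> = (\<integral>x. ?I * (c x * be x) \<partial>IM 0 1)"
      by (intro Bochner_Integration.integral_cong) (auto simp: integral_IM)
    also have "\<dots> = ?I * (\<integral>x. c x * be x \<partial>IM 0 1)" by simp
    finally show "(\<integral>z. (h z - c (snd z)) * th (fst z) * be (snd z) \<partial>?Q) = 0"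
      using 2 3 i1 i3 by (simp add: left_diff_distrib)
  qed
  hence "AE z in ?Q. f (fst z) (snd z) = c (snd z) + ?V (fst z) (snd z)"
    by eventually_elim (auto simp: h_def)
  thus ?thesis using that c by blast
qed

text \<open>\<open>AE_commute\<close> asks for a measurable set, so \<open>P\<close> is first
  replaced by avoidance of a measurable null set that contains its exceptions.\<close>

lemma (in pair_sigma_finite) AE_pair_swapped:
  assumes "AE z in M1 \<Otimes>\<^sub>M M2. P z"
  shows "AE y in M2. AE x in M1. P (x, y)"
proof -
  obtain N where N: "N \<in> null_sets (M1 \<Otimes>\<^sub>M M2)" "{z \<in> space (M1 \<Otimes>\<^sub>M M2). \<not> P z} \<subseteq> N"
    using assms by (auto simp: eventually_ae_filter)
  have Ns: "N \<in> sets (M1 \<Otimes>\<^sub>M M2)" using N by auto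
  have "AE x in M1. AE y in M2. (x, y) \<notin> N"
    using AE_pair[OF AE_not_in[OF N(1)]] by simp
  moreover have "{x \<in> space (M1 \<Otimes>\<^sub>M M2). (fst x, snd x) \<notin> N} \<in> sets (M1 \<Otimes>\<^sub>M M2)"
    using sets.compl_sets[OF Ns] by (rule back_subst) auto
  ultimately have "AE y in M2. AE x in M1. (x, y) \<notin> N"
    using AE_commute[of "\<lambda>x y. (x, y) \<notin> N"] by simp
  with AE_space show ?thesis
  proof eventually_elim
    case (elim y)
    from AE_space elim(2) show ?case
      by eventually_elim (use N(2) elim(1) in \<open>auto simp: space_pair_measure\<close>)
  qed
qed

lemma measurable_section_snd:
  assumes "case_prod f \<in> borel_measurable (borel \<Otimes>\<^sub>M borel)"
  shows "(\<lambda>t. f t x) \<in> borel_measurable borel"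
  using measurable_compose[OF measurable_Pair2' assms, of x] by (simp add: comp_def)

lemma measurable_section_fst:
  assumes "case_prod f \<in> borel_measurable (borel \<Otimes>\<^sub>M borel)"
  shows "f t \<in> borel_measurable borel"
  using measurable_compose[OF measurable_Pair1' assms, of t] by (simp add: comp_def)

lemma measurable_IM_continuous:
  fixes f :: "real \<Rightarrow> real"
  assumes "continuous_on {l<..<r} f" shows "f \<in> borel_measurable (IM l r)"
proof -
  have "f \<in> borel_measurable (restrict_space borel {l<..<r})"
    by (rule borel_measurable_continuous_on_restrict[OF assms])
  thus ?thesis by (simp cong: measurable_cong_sets add: sets_IM_borel)
qed

text \<open>For almost every \<open>x\<close> the integrand is the time derivative of the product of
  \<open>c\<close>, \<open>u1\<close> and \<open>u2\<close>. The primitives of \<open>w1\<close> and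
  \<open>w2\<close> stay bounded up to the ends, so the limits \<open>l0\<close> and
  \<open>lT\<close> alone kill the boundary values, while \<open>ct\<close> may be singular
  there.\<close>

lemma integral_time_derivative_zero:
  fixes u1 w1 u2 w2 c ct :: "real \<Rightarrow> real \<Rightarrow> real"
  assumes T: "0 < T"
    and w1m: "case_prod w1 \<in> borel_measurable (borel \<Otimes>\<^sub>M borel)" and w2m: "case_prod w2 \<in> borel_measurable (borel \<Otimes>\<^sub>M borel)"
    and w1: "integrable (cyl T) (case_prod w1)" and w2: "integrable (cyl T) (case_prod w2)"
    and r1: "AE z in cyl T. u1 (fst z) (snd z) = c1 (snd z) + (LBINT u:{0..fst z}. w1 u (snd z))"
    and r2: "AE z in cyl T. u2 (fst z) (snd z) = c2 (snd z) + (LBINT u:{0..fst z}. w2 u (snd z))"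
    and d: "\<And>t x. 0 < t \<Longrightarrow> t < T \<Longrightarrow> 0 < x \<Longrightarrow> x < 1 \<Longrightarrow> ((\<lambda>t. c t x) has_real_derivative ct t x) (at t)"
    and ctc: "\<And>x. 0 < x \<Longrightarrow> x < 1 \<Longrightarrow> continuous_on {0<..<T} (\<lambda>t. ct t x)"
    and l0: "\<And>x. 0 < x \<Longrightarrow> x < 1 \<Longrightarrow> ((\<lambda>t. c t x) \<longlongrightarrow> 0) (at_right 0)"
    and lT: "\<And>x. 0 < x \<Longrightarrow> x < 1 \<Longrightarrow> ((\<lambda>t. c t x) \<longlongrightarrow> 0) (at_left T)"
    and I: "integrable (cyl T) (\<lambda>(t, x). ct t x * (u1 t x * u2 t x) + c t x * (w1 t x * u2 t x + u1 t x * w2 t x))"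
  shows "(\<integral>z. ct (fst z) (snd z) * (u1 (fst z) (snd z) * u2 (fst z) (snd z)) + c (fst z) (snd z) *
     (w1 (fst z) (snd z) * u2 (fst z) (snd z) + u1 (fst z) (snd z) * w2 (fst z) (snd z)) \<partial>(cyl T)) = 0"
proof -
  let ?I = "\<lambda>t x. ct t x * (u1 t x * u2 t x) + c t x * (w1 t x * u2 t x + u1 t x * w2 t x)"
  have "AE x in IM 0 1. (\<integral>t. ?I t x \<partial>IM 0 T) = 0"
    using Q.AE_pair_swapped[OF r1] Q.AE_pair_swapped[OF r2] Q.AE_integrable_snd[OF w1] Q.AE_integrable_snd[OF w2]
      Q.AE_integrable_snd[OF I] AE_space
  proof eventually_elim
    case (elim x)
    have x: "0 < x" "x < 1" using elim(6) by auto
    define U1 where "U1 t = c1 x + (LBINT u:{0..t}. w1 u x)" for t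
    define U2 where "U2 t = c2 x + (LBINT u:{0..t}. w2 u x)" for t
    have a1: "ac_on 0 T U1 (\<lambda>t. w1 t x)" unfolding U1_def
      by (rule ac_on_primitive) (use elim(3) in \<open>simp add: integrable_IM\<close>)
    have a2: "ac_on 0 T U2 (\<lambda>t. w2 t x)" unfolding U2_def
      by (rule ac_on_primitive) (use elim(4) in \<open>simp add: integrable_IM\<close>)
    note a12 = ac_on_mult[OF a1 a2]
    \<comment> \<open>In the application \<open>c\<close> does not take its limit as value at the
      end points: \<open>Theta T 0 = 0\<close> by division by zero, so the exponential weight equals
      1 there. Hence the extension by 0.\<close>
    define C where "C t = (if t \<le> 0 \<or> T \<le> t then 0 else c t x)" for t
    define F' where "F' t = ct t x * (U1 t * U2 t) + C t * (w1 t x * U2 t + U1 t * w2 t x)" for t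
    have Cd: "(C has_real_derivative ct t x) (at t)" if "0 < t" "t < T" for t
      by (rule has_field_derivative_transform_within_open[OF d[OF that x], of "{0<..<T}"])
         (use that in \<open>auto simp: C_def\<close>)
    have Cc: "continuous_on {0..T} C"
    proof (rule continuous_on_IccI[OF _ _ _ T])
      have "\<forall>\<^sub>F t in at_right 0. c t x = C t"
        unfolding eventually_at_right_field using T by (auto simp: C_def intro!: exI[of _ T])
      from tendsto_cong[OF this, of 0] show "(C \<longlongrightarrow> C 0) (at_right 0)"
        using l0[OF x] by (simp add: C_def[of 0])
      have "\<forall>\<^sub>F t in at_left T. c t x = C t"
        unfolding eventually_at_left_field using T by (auto simp: C_def intro!: exI[of _ 0])
      from tendsto_cong[OF this, of 0] show "(C \<longlongrightarrow> C T) (at_left T)"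
        using lT[OF x] by (simp add: C_def[of T])
      show "C \<midarrow>t\<rightarrow> C t" if "0 < t" "t < T" for t
        using DERIV_isCont[OF Cd[OF that]] by (simp add: isCont_def)
    qed
    have aeF: "AE t in IM 0 T. ?I t x = F' t"
      using elim(1,2) AE_space
      by eventually_elim (auto simp: F'_def C_def U1_def U2_def)
    have F'm: "F' \<in> borel_measurable (IM 0 T)"
    proof -
      have [measurable]: "(\<lambda>t. ct t x) \<in> borel_measurable (IM 0 T)" using ctc[OF x] by (rule measurable_IM_continuous)
      have [measurable]: "C \<in> borel_measurable (IM 0 T)" "U1 \<in> borel_measurable (IM 0 T)" "U2 \<in> borel_measurable (IM 0 T)"
        by (rule measurable_IM_continuous, rule continuous_on_subset[OF Cc] continuous_on_subset[OF ac_on_continuous[OF a1]]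
             continuous_on_subset[OF ac_on_continuous[OF a2]], force)+
      have [measurable]: "(\<lambda>t. w1 t x) \<in> borel_measurable (IM 0 T)" "(\<lambda>t. w2 t x) \<in> borel_measurable (IM 0 T)"
        using elim(3,4) by auto
      show ?thesis unfolding F'_def[abs_def] by measurable
    qed
    have F'i: "integrable (IM 0 T) F'"
      using integrable_cong_AE_imp[OF elim(5) F'm aeF] .
    have "ac_on 0 T (\<lambda>t. C t * (U1 t * U2 t)) F'"
    proof (rule ac_on_improper[OF T])
      show "continuous_on {0..T} (\<lambda>t. C t * (U1 t * U2 t))"
        by (intro continuous_intros Cc ac_on_continuous[OF a1] ac_on_continuous[OF a2])
      show "set_integrable lborel {0..T} F'" using F'i by (simp add: integrable_IM)
      fix \<alpha> \<beta> assume ab: "0 < \<alpha>" "\<alpha> \<le> \<beta>" "\<beta> < T"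
      have "ac_on \<alpha> \<beta> C (\<lambda>t. ct t x)"
      proof (rule ac_on_C1)
        show "continuous_on {\<alpha>..\<beta>} (\<lambda>t. ct t x)" by (rule continuous_on_subset[OF ctc[OF x]]) (use ab in auto)
        show "(C has_real_derivative ct t x) (at t within {\<alpha>..\<beta>})" if "\<alpha> \<le> t" "t \<le> \<beta>" for t
          by (rule has_field_derivative_at_within[OF Cd]) (use that ab in auto)
      qed
      from ac_on_mult[OF this ac_on_subset[OF a12]] ab
      show "ac_on \<alpha> \<beta> (\<lambda>t. C t * (U1 t * U2 t)) F'" by (simp add: F'_def[abs_def])
    qed
    from ac_onD(2)[OF this, of 0 T] T have "(LBINT u:{0..T}. F' u) = 0" by (simp add: C_def)
    hence "(\<integral>t. F' t \<partial>IM 0 T) = 0" by (simp add: integral_IM)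
    moreover have "(\<integral>t. ?I t x \<partial>IM 0 T) = (\<integral>t. F' t \<partial>IM 0 T)"
      using aeF F'm elim(5) by (intro integral_cong_AE) auto
    ultimately show ?case by simp
  qed
  hence "(\<integral>x. (\<integral>t. ?I t x \<partial>IM 0 T) \<partial>IM 0 1) = (\<integral>x. 0 \<partial>IM 0 1)"
    using Q.integrable_snd[OF I] by (intro integral_cong_AE) auto
  thus ?thesis using Q.integral_snd[OF I] by (simp add: case_prod_unfold)
qed

section \<open>Exchange of the weak derivatives in time and space\<close>

lemma AE_zero_if_primitive_const:
  fixes g :: "real \<Rightarrow> real"
  assumes T: "0 < T" and g: "integrable (IM 0 T) g" and c: "AE t in IM 0 T. (LBINT u:{0..t}. g u) = k"
  shows "AE t in IM 0 T. g t = 0"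
proof -
  have i: "set_integrable lborel {0..T} g" using g by (simp add: integrable_IM)
  let ?G = "\<lambda>t. LBINT u:{0..t}. g u"
  have Gc: "continuous_on {0..T} ?G" by (rule continuous_on_set_integral[OF i])
  have G: "?G t = k" if "0 < t" "t < T" for t
  proof -
    \<comment> \<open>The set where the continuous primitive differs from \<open>k\<close> is open
      and null, hence empty.\<close>
    have o: "open ({0<..<T} \<inter> ?G -` (-{k}))"
      by (rule continuous_open_preimage) (auto intro: continuous_on_subset[OF Gc])
    have "AE t in lborel. t \<notin> {0<..<T} \<inter> ?G -` (-{k})"
      using c unfolding AE_IM_iff by eventually_elim auto
    hence "{0<..<T} \<inter> ?G -` (-{k}) \<in> null_sets lborel"
      using o by (subst (asm) AE_iff_null_sets[symmetric]) auto
    hence "negligible ({0<..<T} \<inter> ?G -` (-{k}))"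
      by (simp add: negligible_iff_null_sets null_sets_completionI)
    hence "{0<..<T} \<inter> ?G -` (-{k}) = {}" using o open_not_negligible by blast
    thus ?thesis using that by auto
  qed
  have Gk: "?G t = k" if "t \<in> {0..T}" for t
  proof -
    have "closed {x \<in> {0..T}. ?G x = k}"
      by (rule continuous_closed_preimage_constant[OF Gc]) auto
    moreover have "{0<..<T} \<subseteq> {x \<in> {0..T}. ?G x = k}" using G by auto
    ultimately have "closure {0<..<T} \<subseteq> {x \<in> {0..T}. ?G x = k}" by (rule closure_minimal[rotated])
    thus ?thesis using that T by auto
  qed
  have int0: "(LBINT u:{p..q}. g u) = 0" if "0 \<le> p" "p \<le> q" "q \<le> T" for p q
    using set_integral_Icc_split[OF i that] Gk[of p] Gk[of q] that by auto
  have "AE t in lborel. indicator {0..T} t * g t = 0"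
  proof (rule AE_zero_if_integral_box_zero)
    show "integrable lborel (\<lambda>t. indicator {0..T} t * g t)" using i by (simp add: set_integrable_def)
    fix a b :: real
    let ?p = "max a 0" and ?q = "min b T"
    have "(LINT x:box a b|lborel. indicator {0..T} x * g x) = (\<integral>x. indicator {0..T} x * g x \<partial>IM a b)"
      by (simp add: integral_restrict_space set_lebesgue_integral_def)
    also have "\<dots> = (LBINT x:{a..b}. indicator {0..T} x * g x)" by (rule integral_IM)
    also have "\<dots> = (LBINT x:{?p..?q}. g x)"
      unfolding set_lebesgue_integral_def by (intro Bochner_Integration.integral_cong) (auto simp: indicator_def)
    also have "\<dots> = 0" using int0[of ?p ?q] by (cases "?p \<le> ?q") (auto simp: set_lebesgue_integral_def)
    finally show "(LINT x:box a b|lborel. indicator {0..T} x * g x) = 0" .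
  qed
  thus ?thesis unfolding AE_IM_iff by eventually_elim (auto simp: indicator_def)
qed

lemma primitive_measurable_snd:
  fixes w :: "real \<Rightarrow> real \<Rightarrow> real"
  assumes [measurable]: "case_prod w \<in> borel_measurable (borel \<Otimes>\<^sub>M borel)"
  shows "(\<lambda>(t, x). LBINT y:{0..x}. w t y) \<in> borel_measurable (borel \<Otimes>\<^sub>M borel)"
proof -
  have "(\<lambda>z. \<integral>y. (if 0 \<le> y \<and> y \<le> snd z then w (fst z) y else 0) \<partial>lborel) \<in> borel_measurable (borel \<Otimes>\<^sub>M borel)"
    by measurable
  moreover have "(\<integral>y. (if 0 \<le> y \<and> y \<le> x then w t y else 0) \<partial>lborel) = (LBINT y:{0..x}. w t y)" for t x
    unfolding set_lebesgue_integral_def by (rule Bochner_Integration.integral_cong) (auto simp: indicator_def)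
  ultimately show ?thesis by (simp add: case_prod_unfold)
qed

text \<open>Writing \<open>v\<close> as the \<open>x\<close>-integral of \<open>vx\<close> and
  inserting the time representation of \<open>vx\<close> gives, after Fubini, a second time
  representation of \<open>v\<close>, whose density is the \<open>x\<close>-primitive of
  \<open>vtx\<close>. Comparison with the representation by \<open>vt\<close> identifies the
  densities; at \<open>x = 1\<close>, where \<open>v = 0\<close>, it gives the second claim.\<close>

lemma mixed_derivative:
  fixes v vx vt vtx :: "real \<Rightarrow> real \<Rightarrow> real"
  assumes T: "0 < T"
    and m: "case_prod v \<in> borel_measurable (borel \<Otimes>\<^sub>M borel)" "case_prod vt \<in> borel_measurable (borel \<Otimes>\<^sub>M borel)"
      "case_prod vx \<in> borel_measurable (borel \<Otimes>\<^sub>M borel)" "case_prod vtx \<in> borel_measurable (borel \<Otimes>\<^sub>M borel)"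
    and ivt: "integrable (cyl T) (case_prod vt)" and ivtx: "integrable (cyl T) (case_prod vtx)"
    and rv: "AE z in cyl T. v (fst z) (snd z) = c (snd z) + (LBINT u:{0..fst z}. vt u (snd z))"
    and rx: "AE z in cyl T. vx (fst z) (snd z) = c1 (snd z) + (LBINT u:{0..fst z}. vtx u (snd z))"
    and c1: "integrable (IM 0 1) c1"
    and prim: "AE t in IM 0 T. \<forall>x\<in>{0..1}. v t x = (LBINT y:{0..x}. vx t y)"
    and v1: "AE t in IM 0 T. v t 1 = 0"
  shows "AE z in cyl T. vt (fst z) (snd z) = (LBINT y:{0..snd z}. vtx (fst z) y)"
    and "AE t in IM 0 T. (LBINT y:{0..1}. vtx t y) = 0"
proof -
  let ?Q = "cyl T"
  let ?W = "\<lambda>t x. LBINT y:{0..x}. vtx t y"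
  note [measurable] = m
  have Wm: "case_prod ?W \<in> borel_measurable (borel \<Otimes>\<^sub>M borel)"
    by (rule primitive_measurable_snd[OF m(4)])
  define C1 where "C1 x = (LBINT y:{0..x}. c1 y)" for x
  have ic1: "set_integrable lborel {0..1} c1" using c1 by (simp add: integrable_IM)
  \<comment> \<open>Integrals over a subinterval are written over the full factor, so that Fubini on
    the cylinder applies.\<close>
  have ind: "(\<integral>y. indicator {0..p} y * g y \<partial>IM 0 r) = (LBINT y:{0..p}. g y)" if "0 \<le> p" "p \<le> r" for p r and g :: "real \<Rightarrow> real"
    unfolding integral_IM unfolding set_lebesgue_integral_def using that
    by (intro Bochner_Integration.integral_cong) (auto simp: indicator_def)
  have iW: "integrable (IM 0 T) (\<lambda>u. ?W u x)" if "x \<in> {0..1}" for x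
  proof -
    have "integrable ?Q (\<lambda>z. case_prod vtx z * indicator {0..x} (snd z))"
      by (rule integrable_mult_bounded[OF ivtx, where B=1]) (auto simp: indicator_def)
    hence "integrable ?Q (\<lambda>(u,y). indicator {0..x} y * vtx u y)" by (simp add: case_prod_unfold mult.commute)
    from Q.integrable_fst[OF this] show ?thesis using ind[of x 1] that by simp
  qed
  have swap: "(LBINT y:{0..x}. LBINT u:{0..t}. vtx u y) = (LBINT u:{0..t}. ?W u x)"
    if "0 < t" "t < T" "x \<in> {0..1}" for t x
  proof -
    have "integrable ?Q (\<lambda>z. case_prod vtx z * indicator {0..t} (fst z) * indicator {0..x} (snd z))"
      by (intro integrable_mult_bounded[where B=1] ivtx) (auto simp: indicator_def)
    hence J: "integrable ?Q (\<lambda>(u,y). indicator {0..t} u * (indicator {0..x} y * vtx u y))"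
      by (simp add: case_prod_unfold mult_ac)
    have "(\<integral>u. (\<integral>y. indicator {0..t} u * (indicator {0..x} y * vtx u y) \<partial>IM 0 1) \<partial>IM 0 T) =
          (\<integral>y. (\<integral>u. indicator {0..t} u * (indicator {0..x} y * vtx u y) \<partial>IM 0 T) \<partial>IM 0 1)"
      using Q.integral_fst[OF J] Q.integral_snd[OF J] by simp
    also have "(\<integral>u. (\<integral>y. indicator {0..t} u * (indicator {0..x} y * vtx u y) \<partial>IM 0 1) \<partial>IM 0 T) = (LBINT u:{0..t}. ?W u x)"
      using ind[of x 1] ind[of t T] that by simp
    also have "(\<integral>y. (\<integral>u. indicator {0..t} u * (indicator {0..x} y * vtx u y) \<partial>IM 0 T) \<partial>IM 0 1)
       = (\<integral>y. indicator {0..x} y * (\<integral>u. indicator {0..t} u * vtx u y \<partial>IM 0 T) \<partial>IM 0 1)"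
      unfolding integral_mult_right_zero[symmetric]
      by (intro Bochner_Integration.integral_cong refl) (simp only: mult.left_commute)
    also have "\<dots> = (LBINT y:
{0..x}. LBINT u:{0..t}. vtx u y)"
      using ind[of x 1] ind[of t T] that by simp
    finally show ?thesis by simp
  qed
  \<comment> \<open>The exceptional set of times depends on \<open>x\<close>, but no
    \<open>x\<close> is excluded; this is what permits \<open>x = 1\<close> at the end.\<close>
  have repr: "AE t in IM 0 T. v t x = C1 x + (LBINT u:{0..t}. ?W u x)" if x: "x \<in> {0..1}" for x
    using Q.AE_pair[OF rx] prim AE_space Q.AE_integrable_fst[OF primitive_integrable[OF m(4) ivtx]]
  proof eventually_elim
    case (elim t)
    let ?V = "\<lambda>y. LBINT u:{0..t}. vtx u y"
    have iV: "set_integrable lborel {0..1} ?V" using elim(4) by (simp add: integrable_IM)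
    have "v t x = (LBINT y:{0..x}. vx t y)" using elim(2) x by auto
    also have "\<dots> = (\<integral>y. indicator {0..x} y * vx t y \<partial>IM 0 1)" using ind[of x 1] x by simp
    also have "\<dots> = (\<integral>y. indicator {0..x} y * (c1 y + ?V y) \<partial>IM 0 1)"
    proof (rule integral_cong_AE)
      have [measurable]: "vx t \<in> borel_measurable (IM 0 1)" by (rule measurable_IM[OF measurable_section_fst[OF m(3)]])
      show "(\<lambda>y. indicator {0..x} y * vx t y) \<in> borel_measurable (IM 0 1)" by measurable
      have [measurable]: "?V \<in> borel_measurable (IM 0 1)" "c1 \<in> borel_measurable (IM 0 1)" using elim(4) c1 by auto
      show "(\<lambda>y. indicator {0..x} y * (c1 y + ?V y)) \<in> borel_measurable (IM 0 1)" by measurable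
      show "AE y in IM 0 1. indicator {0..x} y * vx t y = indicator {0..x} y * (c1 y + ?V y)"
        using elim(1) by eventually_elim auto
    qed
    also have "\<dots> = (LBINT y:{0..x}. c1 y + ?V y)" using ind[of x 1] x by simp
    also have "\<dots> = C1 x + (LBINT y:{0..x}. ?V y)"
      unfolding C1_def by (rule set_integral_add(2)) (use ic1 iV x in \<open>auto intro: set_integrable_subset\<close>)
    also have "(LBINT y:{0..x}. ?V y) = (LBINT u:{0..t}. ?W u x)" using swap x elim(3) by auto
    finally show ?case .
  qed
  have "AE x in IM 0 1. AE t in IM 0 T. vt t x = ?W t x"
    using Q.AE_pair_swapped[OF rv] Q.AE_integrable_snd[OF ivt] AE_space
  proof eventually_elim
    case (elim x)
    have x: "x \<in> {0..1}" using elim(3) by auto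
    have "AE t in IM 0 T. vt t x - ?W t x = 0"
    proof (rule AE_zero_if_primitive_const[OF T])
      show "integrable (IM 0 T) (\<lambda>t. vt t x - ?W t x)" using elim(2) iW[OF x] by simp
      show "AE t in IM 0 T. (LBINT u:{0..t}. vt u x - ?W u x) = C1 x - c x"
        using elim(1) repr[OF x] AE_space
      proof eventually_elim
        case (elim t)
        have s: "{0..t} \<subseteq> {0..T}" using elim(3) by auto
        have "(LBINT u:{0..t}. vt u x - ?W u x) = (LBINT u:{0..t}. vt u x) - (LBINT u:{0..t}. ?W u x)"
          by (rule set_integral_diff(2); rule set_integrable_subset[OF _ _ s])
             (use \<open>integrable (IM 0 T) (\<lambda>t. vt t x)\<close> iW[OF x] in \<open>auto simp: integrable_IM\<close>)
        thus ?case using elim(1,2) by simp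
      qed
    qed
    thus ?case by simp
  qed
  moreover have meas: "{z \<in> space ?Q. vt (fst z) (snd z) = ?W (fst z) (snd z)} \<in> sets ?Q"
  proof -
    have [measurable]: "(\<lambda>z. vt (fst z) (snd z)) \<in> borel_measurable ?Q" "(\<lambda>z. ?W (fst z) (snd z)) \<in> borel_measurable ?Q"
      using measurable_pair_IM[OF m(2), of 0 T 0 1] measurable_pair_IM[OF Wm, of 0 T 0 1] by (simp_all add: case_prod_unfold)
    show ?thesis by measurable
  qed
  ultimately have "AE t in IM 0 T. AE x in IM 0 1. vt t x = ?W t x"
    using Q.AE_commute[of 0 T 0 1 "\<lambda>t x. vt t x = ?W t x"] by simp
  thus "AE z in ?Q. vt (fst z) (snd z) = ?W (fst z) (snd z)"
    by (intro Q.AE_pair_measure meas) simp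
  show "AE t in IM 0 T. ?W t 1 = 0"
  proof (rule AE_zero_if_primitive_const[OF T iW])
    show "AE t in IM 0 T. (LBINT u:{0..t}. ?W u 1) = - C1 1"
      using repr[of 1, simplified] v1 by eventually_elim auto
  qed simp
qed

section \<open>The degenerate weight\<close>

lemma ac_on_DERIV:
  assumes "ac_on l r f f'" "l < x" "x < r" "continuous_on {l..r} f'"
  shows "(f has_real_derivative f' x) (at x)"
proof -
  have "((\<lambda>u. LBINT y=l..u. f' y) has_vector_derivative f' x) (at x within {l..r})"
    by (rule interval_integral_FTC2) (use assms in auto)
  hence "((\<lambda>u. LBINT y=l..u. f' y) has_real_derivative f' x) (at x)"
    using at_within_interior[of x "{l..r}"] assms(2,3)
    by (simp add: has_real_derivative_iff_has_vector_derivative interior_atLeastAtMost_real)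
  hence "((\<lambda>u. f l + (LBINT y=l..u. f' y)) has_real_derivative f' x) (at x)"
    by (auto intro!: derivative_eq_intros)
  thus ?thesis
  proof (rule has_field_derivative_transform_within_open[where S="{l<..<r}"])
    fix u assume "u \<in> {l<..<r}"
    thus "f l + (LBINT y=l..u. f' y) = f u"
      using ac_onD(2)[OF assms(1), of l u] by (simp add: interval_integral_Icc)
  qed (use assms in auto)
qed

text \<open>\<open>A y * y powr (-K)\<close> is nonincreasing, because the logarithmic derivative of
  \<open>A\<close> is \<open>B y / y \<le> K / y\<close>. With \<open>y\<close> the distance to
  \<open>x0\<close>, this turns the bound on \<open>(x - x0) a'\<close> into control of
  \<open>1/a\<close>.\<close>

lemma lower_powr_bound:
  fixes A B :: "real \<Rightarrow> real"
  assumes c: "continuous_on {0<..l} A"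
    and d: "\<And>y. 0 < y \<Longrightarrow> y < l \<Longrightarrow> (A has_real_derivative A y * B y / y) (at y)"
    and p: "\<And>y. 0 < y \<Longrightarrow> y < l \<Longrightarrow> A y > 0" and B: "\<And>y. 0 < y \<Longrightarrow> y < l \<Longrightarrow> B y \<le> K"
    and y: "0 < y" "y \<le> l"
  shows "A l / l powr K * y powr K \<le> A y"
proof -
  have "A l * l powr (-K) \<le> A y * y powr (-K)"
  proof (rule DERIV_nonpos_imp_decreasing_open[OF y(2), where f="\<lambda>y. A y * y powr (-K)"])
    fix x assume x: "y < x" "x < l"
    hence x0: "0 < x" using y by simp
    have "((\<lambda>y. A y * y powr (-K)) has_real_derivative
        A x * B x / x * x powr (-K) + A x * ((-K) * x powr (-K - 1))) (at x)"
      using x0 by (auto intro!: derivative_eq_intros d x simp: powr_diff)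
    moreover have "A x * B x / x * x powr (-K) + A x * ((-K) * x powr (-K - 1)) = (A x * x powr (-K) / x) * (B x - K)"
      using x0 by (simp add: powr_diff field_simps)
    moreover have "\<dots> \<le> 0"
      by (rule mult_nonneg_nonpos) (use p[of x] B[of x] x x0 in auto)
    ultimately show "\<exists>d. ((\<lambda>y. A y * y powr (-K)) has_real_derivative d) (at x) \<and> d \<le> 0" by metis
  next
    show "continuous_on {y..l} (\<lambda>y. A y * y powr - K)"
      by (intro continuous_intros continuous_on_subset[OF c]) (use y in auto)
  qed
  thus ?thesis using y by (simp add: powr_minus field_simps)
qed

text \<open>On each side of \<open>x0\<close> the nonnegative integrand has an explicit
  antiderivative, continuous up to \<open>x0\<close> because \<open>\<beta> + 1 > 0\<close>; on the
  left it carries a minus sign.\<close>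

lemma set_integrable_abs_powr:
  fixes x0 \<beta> :: real
  assumes x0: "0 < x0" "x0 < 1" and b: "\<beta> > -1"
  shows "set_integrable lborel {0..1} (\<lambda>x. \<bar>x - x0\<bar> powr \<beta>)"
proof -
  let ?F = "\<lambda>x. \<bar>x - x0\<bar> powr (\<beta> + 1) / (\<beta> + 1)"
  have Fc: "continuous_on S ?F" for S
    using b by (intro continuous_intros continuous_on_powr') auto
  have "set_integrable lborel (einterval (ereal x0) (ereal 1)) (\<lambda>x. \<bar>x - x0\<bar> powr \<beta>)"
  proof (rule interval_integral_FTC_nonneg(1))
    fix x assume "ereal x0 < ereal x" "ereal x < ereal 1"
    hence x: "x0 < x" by simp
    have "((\<lambda>x. (x - x0) powr (\<beta> + 1) / (\<beta> + 1)) has_real_derivative \<bar>x - x0\<bar> powr \<beta>) (at x)"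
      using x b by (auto intro!: derivative_eq_intros simp: powr_diff)
    thus "(?F has_real_derivative \<bar>x - x0\<bar> powr \<beta>) (at x)"
      by (rule has_field_derivative_transform_within_open[where S="{x0<..}"]) (use x in auto)
    show "isCont (\<lambda>x. \<bar>x - x0\<bar> powr \<beta>) x" using x by (intro continuous_intros) auto
  next
    show "((?F \<circ> real_of_ereal) \<longlongrightarrow> ?F x0) (at_right (ereal x0))"
      using continuous_on_Icc_at_rightD[OF Fc x0(2)] by (simp add: ereal_tendsto_simps1)
    show "((?F \<circ> real_of_ereal) \<longlongrightarrow> ?F 1) (at_left (ereal 1))"
      using continuous_on_Icc_at_leftD[OF Fc x0(2)] by (simp add: ereal_tendsto_simps1)
  qed (use x0 in auto)
  hence 1: "set_integrable lborel {x0..1} (\<lambda>x. \<bar>x - x0\<bar> powr \<beta>)"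
    unfolding integrable_IM[symmetric] by (simp add: integrable_restrict_space set_integrable_def)
  have "set_integrable lborel (einterval (ereal 0) (ereal x0)) (\<lambda>x. \<bar>x - x0\<bar> powr \<beta>)"
  proof (rule interval_integral_FTC_nonneg(1))
    fix x assume "ereal 0 < ereal x" "ereal x < ereal x0"
    hence x: "x < x0" by simp
    have "((\<lambda>x. - ((x0 - x) powr (\<beta> + 1)) / (\<beta> + 1)) has_real_derivative \<bar>x - x0\<bar> powr \<beta>) (at x)"
      using x b by (auto intro!: derivative_eq_intros simp: powr_diff)
    thus "((\<lambda>x. - ?F x) has_real_derivative \<bar>x - x0\<bar> powr \<beta>) (at x)"
      by (rule has_field_derivative_transform_within_open[where S="{..<x0}"]) (use x in auto)

    show "isCont (\<lambda>x. \<bar>x - x0\<bar> powr \<beta>) x" using x by (intro continuous_intros) auto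
  next
    show "(((\<lambda>x. - ?F x) \<circ> real_of_ereal) \<longlongrightarrow> - ?F 0) (at_right (ereal 0))"
      using tendsto_minus[OF continuous_on_Icc_at_rightD[OF Fc x0(1)]] by (simp add: ereal_tendsto_simps1)
    show "(((\<lambda>x. - ?F x) \<circ> real_of_ereal) \<longlongrightarrow> - ?F x0) (at_left (ereal x0))"
      using tendsto_minus[OF continuous_on_Icc_at_leftD[OF Fc x0(1)]] by (simp add: ereal_tendsto_simps1)
  qed (use x0 in auto)
  hence 2: "set_integrable lborel {0..x0} (\<lambda>x. \<bar>x - x0\<bar> powr \<beta>)"
    unfolding integrable_IM[symmetric] by (simp add: integrable_restrict_space set_integrable_def)
  have "{0..1} = {0..x0} \<union> {x0..1}" using x0 by auto
  thus ?thesis using set_integrable_Un[OF 2 1] by simp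
qed

lemma ac_on_join:
  assumes "ac_on l m f f'" "ac_on m r f f'" "l \<le> m" "m \<le> r"
  shows "ac_on l r f f'"
proof -
  have U: "{l..r} = {l..m} \<union> {m..r}" using assms by auto
  have i: "set_integrable lborel {l..r} f'"
    unfolding U by (rule set_integrable_Un) (use assms ac_onD(1) in auto)
  show ?thesis
  proof (rule ac_onI[OF i, where c="f l"])
    fix x assume x: "l \<le> x" "x \<le> r"
    show "f x = f l + (LBINT u:{l..x}. f' u)"
    proof (cases "x \<le> m")
      case True thus ?thesis using ac_onD(2)[OF assms(1), of l x] x by simp
    next
      case False
      thus ?thesis using ac_onD(2)[OF assms(1), of l m] ac_onD(2)[OF assms(2), of m x] x assms(3)
          set_integral_Icc_split[OF i, of m x] by simp
    qed
  qed
qed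

text \<open>The form in which identities are integrated across \<open>x0\<close>: continuity of
  \<open>F\<close> excludes a jump there, so the formula off \<open>x0\<close> and integrability of
  \<open>F'\<close> suffice.\<close>

lemma ac_on_punctured:
  fixes F F' :: "real \<Rightarrow> real"
  assumes "0 < x0" "x0 < 1" and F: "continuous_on {0..1} F" and i: "set_integrable lborel {0..1} F'"
    and ac: "\<And>\<alpha> \<beta>. 0 < \<alpha> \<Longrightarrow> \<alpha> \<le> \<beta> \<Longrightarrow> \<beta> < 1 \<Longrightarrow> x0 \<notin> {\<alpha>..\<beta>} \<Longrightarrow> ac_on \<alpha> \<beta> F F'"
  shows "ac_on 0 1 F F'"
proof (rule ac_on_join[where m=x0])
  show "ac_on 0 x0 F F'"
    by (rule ac_on_improper) (use assms in \<open>auto intro: continuous_on_subset[OF F] set_integrable_subset[OF i]\<close>)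
  show "ac_on x0 1 F F'"
    by (rule ac_on_improper) (use assms in \<open>auto intro: continuous_on_subset[OF F] set_integrable_subset[OF i]\<close>)
qed (use assms in auto)

text \<open>\<open>b\<close> is the Lipschitz representative of \<open>(x - x0) a'/a\<close>, and
  \<open>bp\<close> is a version of its derivative that is bounded at every point.
  \<open>deg\<close> retains what separates the two kinds of degeneracy: either
  \<open>K < 1\<close>, or \<open>a\<close> is at most linear at \<open>x0\<close>.\<close>

locale carleman_weight =
  fixes a b bp :: "real \<Rightarrow> real" and x0 K M R d1 d2 :: real
  assumes x0: "0 < x0" "x0 < 1"
    and a_x0: "a x0 = 0" and a_pos: "\<And>x. 0 \<le> x \<Longrightarrow> x \<le> 1 \<Longrightarrow> x \<noteq> x0 \<Longrightarrow> a x > 0"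
    and a_cont: "continuous_on {0..1} a"
    and a_deriv: "\<And>x. 0 < x \<Longrightarrow> x < 1 \<Longrightarrow> x \<noteq> x0 \<Longrightarrow> (a has_real_derivative a x * b x / (x - x0)) (at x)"
    and b_ac: "ac_on 0 1 b bp" and bp_meas [measurable]: "bp \<in> borel_measurable borel"
    and bp_bound: "\<And>x. \<bar>bp x\<bar> \<le> M"
    and b_le: "\<And>x. 0 \<le> x \<Longrightarrow> x \<le> 1 \<Longrightarrow> b x \<le> K" and K: "0 < K" "K < 2"
    and deg: "K < 1 \<or> (\<exists>L. \<forall>x\<in>{0..1}. a x \<le> L * \<bar>x - x0\<bar>)"
    and R: "R > 0" and d1: "d1 > 0"
    and d2: "d2 > max ((1 - x0)\<^sup>2 * exp (R * (1 - x0)\<^sup>2) / ((2 - K) * a 1))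
                      (x0\<^sup>2 * exp (R * x0\<^sup>2) / ((2 - K) * a 0))"
begin

text \<open>Since \<open>a x0 = 0\<close>, division by zero makes \<open>r x0 = 0\<close>, and this is the value for which \<open>r V\<close> becomes
  continuous at \<open>x0\<close>.\<close>

definition E where "E x = exp (R * (x - x0)\<^sup>2)"
definition p where "p x = (x - x0) * E x"
definition r where "r x = p x / a x"
definition pd where "pd x = E x * (1 + 2 * R * (x - x0)\<^sup>2)"
text \<open>This is \<open>a r'\<close>, hence \<open>a \<psi>'' = d1 q\<close> off
  \<open>x0\<close>. It is absolutely continuous although \<open>r'\<close> itself may be singular
  at \<open>x0\<close>.\<close>

definition q where "q x = pd x - E x * b x"
definition qd where "qd x = E x * (6 * R * (x - x0) + 4 * R\<^sup>2 * (x - x0) ^ 3) - (2 * R * (x - x0) * E x * b x + E x * bp x)"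
abbreviation \<psi> where "\<psi> \<equiv> psi a x0 R d1 d2"

lemma E_pos: "E x > 0" and E_ge_1: "E x \<ge> 1"
  using R by (auto simp: E_def)

lemma E_le: "x \<in> {0..1} \<Longrightarrow> E x \<le> exp R"
proof -
  assume "x \<in> {0..1}"
  hence "\<bar>x - x0\<bar> \<le> 1" using x0 by auto
  hence "(x - x0)\<^sup>2 \<le> 1" using abs_le_square_iff[of "x - x0" 1] by simp
  thus ?thesis using R by (simp add: E_def mult_left_le)
qed

lemma E_deriv: "(E has_real_derivative 2 * R * (x - x0) * E x) (at x)"
  unfolding E_def[abs_def] by (auto intro!: derivative_eq_intros)

lemma p_deriv: "(p has_real_derivative pd x) (at x)"
  unfolding p_def[abs_def]
  by (auto intro!: derivative_eq_intros E_deriv simp: pd_def algebra_simps power2_eq_square)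

lemma pd_deriv: "(pd has_real_derivative E x * (6 * R * (x - x0) + 4 * R\<^sup>2 * (x - x0) ^ 3)) (at x)"
  unfolding pd_def[abs_def]
  by (auto intro!: derivative_eq_intros E_deriv simp: algebra_simps power2_eq_square power3_eq_cube)

lemma E_cont: "continuous_on S E" and p_cont: "continuous_on S p" and pd_cont: "continuous_on S pd"
  unfolding E_def[abs_def] p_def[abs_def] pd_def[abs_def] by (intro continuous_intros)+

lemma b_cont: "continuous_on {0..1} b" by (rule ac_on_continuous[OF b_ac])

lemma q_cont: "continuous_on {0..1} q"
  unfolding q_def[abs_def] by (intro continuous_intros pd_cont E_cont b_cont)

lemma q_ac: "ac_on 0 1 q qd"
proof -
  have E: "ac_on 0 1 E (\<lambda>x. 2 * R * (x - x0) * E x)"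
    by (rule ac_on_C1) (auto intro!: has_field_derivative_at_within E_deriv continuous_intros E_cont)
  have pd: "ac_on 0 1 pd (\<lambda>x. E x * (6 * R * (x - x0) + 4 * R\<^sup>2 * (x - x0) ^ 3))"
    by (rule ac_on_C1) (auto intro!: has_field_derivative_at_within pd_deriv continuous_intros E_cont)
  show ?thesis
    using ac_on_diff[OF pd ac_on_mult[OF E b_ac]] unfolding q_def[abs_def] qd_def[abs_def] .
qed

lemma a_lower: obtains c where "c > 0" "\<And>x. 0 \<le> x \<Longrightarrow> x \<le> 1 \<Longrightarrow> c * \<bar>x - x0\<bar> powr K \<le> a x"
proof -
  \<comment> \<open>\<open>lower_powr_bound\<close> compares with the far end of each side of
    \<open>x0\<close>, hence these two values.\<close>
  let ?c1 = "a 1 / (1 - x0) powr K" and ?c0 = "a 0 / x0 powr K"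
  have c: "?c1 > 0" "?c0 > 0" using a_pos[of 0] a_pos[of 1] x0 by auto
  have right: "?c1 * (x - x0) powr K \<le> a x" if "x0 < x" "x \<le> 1" for x
  proof -
    have "a (x0 + (1 - x0)) / (1 - x0) powr K * (x - x0) powr K \<le> a (x0 + (x - x0))"
    proof (rule lower_powr_bound[where A="\<lambda>y. a (x0 + y)" and B="\<lambda>y. b (x0 + y)" and l="1 - x0"])
      show "continuous_on {0<..1 - x0} (\<lambda>y. a (x0 + y))"
        by (rule continuous_on_compose2[OF a_cont]) (use x0 in \<open>auto intro!: continuous_intros\<close>)
      fix y assume y: "0 < y" "y < 1 - x0"
      have "((\<lambda>y. a (x0 + y)) has_real_derivative (a (x0 + y) * b (x0 + y) / (x0 + y - x0)) * 1) (at y)"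
        by (rule DERIV_chain2[OF a_deriv]) (use x0 y in \<open>auto intro!: derivative_eq_intros\<close>)
      thus "((\<lambda>y. a (x0 + y)) has_real_derivative a (x0 + y) * b (x0 + y) / y) (at y)" by simp
      show "a (x0 + y) > 0" "b (x0 + y) \<le> K" using a_pos[of "x0 + y"] b_le[of "x0 + y"] x0 y by auto
    qed (use that in auto)
    thus ?thesis by simp
  qed
  have left: "?c0 * (x0 - x) powr K \<le> a x" if "x < x0" "0 \<le> x" for x
  proof -
    have "a (x0 - x0) / x0 powr K * (x0 - x) powr K \<le> a (x0 - (x0 - x))"
    proof (rule lower_powr_bound[where A="\<lambda>y. a (x0 - y)" and B="\<lambda>y. b (x0 - y)" and l="x0"])
      show "continuous_on {0<..x0} (\<lambda>y. a (x0 - y))"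
        by (rule continuous_on_compose2[OF a_cont]) (use x0 in \<open>auto intro!: continuous_intros\<close>)
      fix y assume y: "0 < y" "y < x0"
      have "((\<lambda>y. a (x0 - y)) has_real_derivative (a (x0 - y) * b (x0 - y) / (x0 - y - x0)) * (-1)) (at y)"
        by (rule DERIV_chain2[OF a_deriv]) (use x0 y in \<open>auto intro!: derivative_eq_intros\<close>)
      thus "((\<lambda>y. a (x0 - y)) has_real_derivative a (x0 - y) * b (x0 - y) / y) (at y)" by simp
      show "a (x0 - y) > 0" "b (x0 - y) \<le> K" using a_pos[of "x0 - y"] b_le[of "x0 - y"] x0 y by auto
    qed (use that in auto)
    thus ?thesis by simp
  qed
  show ?thesis
  proof (rule that[of "min ?c1 ?c0"])
    show "min ?c1 ?c0 > 0" using c by simp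
    fix x :: real assume x: "0 \<le> x" "x \<le> 1"
    consider "x < x0" | "x = x0" | "x0 < x" by linarith
    thus "min ?c1 ?c0 * \<bar>x - x0\<bar> powr K \<le> a x"
    proof cases
      case 1
      have "min ?c1 ?c0 * \<bar>x - x0\<bar> powr K \<le> ?c0 * \<bar>x - x0\<bar> powr K" by (intro mult_right_mono) auto
      thus ?thesis using left[of x] 1 x by auto
    next
      case 3
      have "min ?c1 ?c0 * \<bar>x - x0\<bar> powr K \<le> ?c1 * \<bar>x - x0\<bar> powr K" by (intro mult_right_mono) auto
      thus ?thesis using right[of x] 3 x by auto
    qed (simp add: a_x0)
  qed
qed

end

text \<open>Meant for quotients whose value at \<open>x0\<close> is 0 by division by zero; the
  majorant \<open>g\<close> shows that this value is the limit.\<close>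

lemma continuous_on_punctured:
  fixes f g :: "real \<Rightarrow> real"
  assumes f: "continuous_on ({0..1} - {x0}) f" and f0: "f x0 = 0"
    and le: "\<And>x. x \<in> {0..1} \<Longrightarrow> \<bar>f x\<bar> \<le> g x" and g: "continuous_on {0..1} g" and g0: "g x0 = 0"
  shows "continuous_on {0..1} f"
  unfolding continuous_on_eq_continuous_within
proof
  fix x :: real assume x: "x \<in> {0..1}"
  show "continuous (at x within {0..1}) f"
  proof (cases "x = x0")
    case False
    have "continuous (at x within {0..1} - {x0}) f"
      using f x False by (auto simp: continuous_on_eq_continuous_within)
    moreover have "at x within {0..1} - {x0} = at x within {0..1}"
      by (rule at_within_nhd[where S="-{x0}"]) (use False in auto)
    ultimately show ?thesis by simp
  next
    case True
    have "(f \<longlongrightarrow> 0) (at x0 within {0..1})"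
    proof (rule Lim_null_comparison)
      show "\<forall>\<^sub>F x in at x0 within {0..1}. norm (f x) \<le> g x"
        using le by (auto simp: eventually_at_filter)
      show "(g \<longlongrightarrow> 0) (at x0 within {0..1})"
        using g x True unfolding continuous_on_def g0[symmetric] by blast
    qed
    thus ?thesis using True f0 by (simp add: continuous_within)
  qed
qed

text \<open>Cauchy-Schwarz, in the form that the variance of \<open>f'\<close> over
  \<open>{x..y}\<close> is nonnegative; \<open>?m\<close> is the mean.\<close>

lemma ac_on_holder:
  assumes ac: "ac_on l r f f'" and i: "set_integrable lborel {l..r} (\<lambda>u. (f' u)\<^sup>2)"
    and xy: "l \<le> x" "x \<le> y" "y \<le> r"
  shows "(f y - f x)\<^sup>2 \<le> (y - x) * (LBINT u:{l..r}. (f' u)\<^sup>2)"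
proof (cases "x = y")
  case True thus ?thesis by simp
next
  case False
  let ?I = "f y - f x" and ?m = "(f y - f x) / (y - x)"
  have sub: "{x..y} \<subseteq> {l..r}" using xy by auto
  have i1: "set_integrable lborel {x..y} f'" using ac_onD(1)[OF ac] by (rule set_integrable_subset) (use sub in auto)
  have i2: "set_integrable lborel {x..y} (\<lambda>u. (f' u)\<^sup>2)" using i by (rule set_integrable_subset) (use sub in auto)
  have i3: "set_integrable lborel {x..y} (\<lambda>u. ?m\<^sup>2)" by (rule borel_integrable_atLeastAtMost') auto
  have "0 \<le> (LBINT u:{x..y}. (f' u - ?m)\<^sup>2)"
    unfolding set_lebesgue_integral_def by (rule integral_nonneg_AE) auto
  also have "\<dots> = (LBINT u:{x..y}. ((f' u)\<^sup>2 - 2 * ?m * f' u) + ?m\<^sup>2)"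
    by (intro set_lebesgue_integral_cong) (auto simp: power2_eq_square algebra_simps)
  also have "\<dots> = (LBINT u:{x..y}. (f' u)\<^sup>2) - 2 * ?m * ?I + ?m\<^sup>2 * (y - x)"
  proof -
    have "(LBINT u:{x..y}. ((f' u)\<^sup>2 - 2 * ?m * f' u) + ?m\<^sup>2) =
       (LBINT u:{x..y}. (f' u)\<^sup>2 - 2 * ?m * f' u) + (LBINT u:{x..y}. ?m\<^sup>2)"
      by (rule set_integral_add(2)) (use i1 i2 i3 in \<open>auto intro!: set_integral_diff(1)\<close>)
    also have "(LBINT u:{x..y}. (f' u)\<^sup>2 - 2 * ?m * f' u) = (LBINT u:{x..y}. (f' u)\<^sup>2) - (LBINT u:{x..y}. 2 * ?m * f' u)"
      by (rule set_integral_diff(2)) (use i1 i2 in auto)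
    also have "(LBINT u:{x..y}. 2 * ?m * f' u) = 2 * ?m * ?I" using ac_onD(2)[OF ac xy] by simp
    also have "(LBINT u:{x..y}. ?m\<^sup>2) = ?m\<^sup>2 * (y - x)" using xy by (simp add: set_integral_const mult.commute)
    finally show ?thesis .
  qed
  finally have 0: "0 \<le> (LBINT u:{x..y}. (f' u)\<^sup>2) - 2 * ?m * ?I + ?m\<^sup>2 * (y - x)" .
  have "2 * (I / D) * I - (I / D)\<^sup>2 * D = I\<^sup>2 / D" if "D \<noteq> 0" for I D :: real
    using that by (simp add: power2_eq_square)
  from this[of "y - x" ?I] 0 have "?I\<^sup>2 / (y - x) \<le> (LBINT u:{x..y}. (f' u)\<^sup>2)" using False by simp
  hence "?I\<^sup>2 \<le> (y - x) * (LBINT u:{x..y}. (f' u)\<^sup>2)" using False xy by (simp add: field_simps)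
  also have "\<dots> \<le> (y - x) * (LBINT u:{l..r}. (f' u)\<^sup>2)"
  proof (rule mult_left_mono)
    have "(LBINT u:{p..q}. (f' u)\<^sup>2) \<ge> 0" for p q
      unfolding set_lebesgue_integral_def by (rule integral_nonneg_AE) auto
    from this[of l x] this[of y r]
    show "(LBINT u:{x..y}. (f' u)\<^sup>2) \<le> (LBINT u:{l..r}. (f' u)\<^sup>2)"
      using set_integral_Icc_split[OF i, of x y] set_integral_Icc_split[OF i, of y r] xy by simp
  qed (use xy in auto)
  finally show ?thesis .
qed

lemma ac_on_lipschitz:
  assumes ac: "ac_on l r f f'" and B: "\<And>u. l \<le> u \<Longrightarrow> u \<le> r \<Longrightarrow> \<bar>f' u\<bar> \<le> B"
    and xy: "l \<le> x" "x \<le> y" "y \<le> r"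
  shows "\<bar>f y - f x\<bar> \<le> B * (y - x)"
proof -
  have i: "set_integrable lborel {x..y} f'" using ac_onD(1)[OF ac] by (rule set_integrable_subset) (use xy in auto)
  have c: "set_integrable lborel {x..y} (\<lambda>u. k)" for k :: real by (rule borel_integrable_atLeastAtMost') auto
  have k: "(LBINT u:{x..y}. k) = k * (y - x)" for k :: real using xy by (simp add: set_integral_const mult.commute)
  have "(LBINT u:{x..y}. f' u) \<le> (LBINT u:{x..y}. B)"
    by (rule set_integral_mono[OF i c]) (use B xy in \<open>auto simp: abs_le_iff\<close>)
  moreover have "(LBINT u:{x..y}. -B) \<le> (LBINT u:{x..y}. f' u)"
  proof (rule set_integral_mono[OF c i])
    fix u assume "u \<in> {x..y}"
    thus "- B \<le> f' u" using B[of u] xy by (auto simp: abs_le_iff)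
  qed
  ultimately show ?thesis using ac_onD(2)[OF ac xy] by (simp add: k abs_le_iff)
qed

context carleman_weight begin

text \<open>Continuous for every \<open>K < 2\<close>, whereas \<open>r\<close> need not be, and
  with derivative \<open>(x - x0)/a * (2 - b)\<close>, which is comparable with \<open>r\<close>. It
  serves to bound \<open>\<psi>\<close> from above and to bound \<open>r\<close> times the distance
  to \<open>x0\<close>.\<close>

definition m where "m x = (x - x0)\<^sup>2 / a x"

lemma a_nonneg: "0 \<le> x \<Longrightarrow> x \<le> 1 \<Longrightarrow> a x \<ge> 0"
  using a_pos[of x] a_x0 by (cases "x = x0") auto

lemma a_cont_punctured: "continuous_on ({0..1} - {x0}) a"
  by (rule continuous_on_subset[OF a_cont]) auto

lemma div_a_cont: "continuous_on ({0..1} - {x0}) f \<Longrightarrow> continuous_on ({0..1} - {x0}) (\<lambda>x. f x / a x)"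
  by (intro continuous_intros a_cont_punctured) (use a_pos in force)+

lemma m_nonneg: "0 \<le> x \<Longrightarrow> x \<le> 1 \<Longrightarrow> m x \<ge> 0"
  by (simp add: m_def a_nonneg)

lemma m_cont: "continuous_on {0..1} m"
proof -
  obtain c where c: "c > 0" "\<And>x. 0 \<le> x \<Longrightarrow> x \<le> 1 \<Longrightarrow> c * \<bar>x - x0\<bar> powr K \<le> a x"
    using a_lower by blast
  show ?thesis
  proof (rule continuous_on_punctured[where g="\<lambda>x. \<bar>x - x0\<bar> powr (2 - K) / c"])
    show "continuous_on ({0..1} - {x0}) m" unfolding m_def[abs_def]
      by (intro div_a_cont continuous_intros)
    show "continuous_on {0..1} (\<lambda>x. \<bar>x - x0\<bar> powr (2 - K) / c)"
      using c K by (intro continuous_intros continuous_on_powr') auto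
    fix x :: real assume x: "x \<in> {0..1}"
    show "\<bar>m x\<bar> \<le> \<bar>x - x0\<bar> powr (2 - K) / c"
    proof (cases "x = x0")
      case False
      have "m x \<le> (x - x0)\<^sup>2 / (c * \<bar>x - x0\<bar> powr K)"
        unfolding m_def by (rule divide_left_mono) (use c(2)[of x] x False c(1) a_pos[of x] in auto)
      also have "\<dots> = \<bar>x - x0\<bar> powr (2 - K) / c"
        using False c by (simp add: powr_diff field_simps)
      finally show ?thesis using m_nonneg x by auto
    qed (simp add: m_def)
  qed (auto simp: m_def)
qed

lemma r_cont_punctured: "continuous_on ({0..1} - {x0}) r"
  unfolding r_def[abs_def] by (intro div_a_cont p_cont)

lemma r_x0: "r x0 = 0" by (simp add: r_def p_def)

lemma r_bound: obtains c where "c > 0" "\<And>x. 0 \<le> x \<Longrightarrow> x \<le> 1 \<Longrightarrow> \<bar>r x\<bar> \<le> c * \<bar>x - x0\<bar> powr (1 - K)"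
proof -
  obtain c where c: "c > 0" "\<And>x. 0 \<le> x \<Longrightarrow> x \<le> 1 \<Longrightarrow> c * \<bar>x - x0\<bar> powr K \<le> a x"
    using a_lower by blast
  show ?thesis
  proof (rule that[of "exp R / c"])
    fix x :: real assume x: "0 \<le> x" "x \<le> 1"

    show "\<bar>r x\<bar> \<le> exp R / c * \<bar>x - x0\<bar> powr (1 - K)"
    proof (cases "x = x0")
      case False
      have "\<bar>r x\<bar> = \<bar>x - x0\<bar> * E x / a x"
        using a_pos[of x] x False E_pos[of x] by (simp add: r_def p_def abs_mult)
      also have "\<dots> \<le> \<bar>x - x0\<bar> * exp R / (c * \<bar>x - x0\<bar> powr K)"
        using x c False E_le[of x] E_pos[of x] by (intro frac_le mult_left_mono) auto
      also have "\<dots> = exp R / c * \<bar>x - x0\<bar> powr (1 - K)"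
        using False c by (simp add: powr_diff field_simps)
      finally show ?thesis .
    qed (simp add: r_x0)
  qed (use c in auto)
qed

lemma r_cont_WD: assumes "K < 1" shows "continuous_on {0..1} r"
proof -
  obtain c where c: "c > 0" "\<And>x. 0 \<le> x \<Longrightarrow> x \<le> 1 \<Longrightarrow> \<bar>r x\<bar> \<le> c * \<bar>x - x0\<bar> powr (1 - K)"
    using r_bound by blast
  show ?thesis
    by (rule continuous_on_punctured[OF r_cont_punctured r_x0, where g="\<lambda>x. c * \<bar>x - x0\<bar> powr (1 - K)"])
       (use c assms in \<open>auto intro!: continuous_intros continuous_on_powr'\<close>)
qed

lemma r_deriv: "0 < x \<Longrightarrow> x < 1 \<Longrightarrow> x \<noteq> x0 \<Longrightarrow> (r has_real_derivative q x / a x) (at x)"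
proof -
  assume x: "0 < x" "x < 1" "x \<noteq> x0"
  have ax: "a x > 0" using a_pos x by auto
  have "(r has_real_derivative (pd x * a x - p x * (a x * b x / (x - x0))) / (a x * a x)) (at x)"
    unfolding r_def[abs_def] using ax by (intro DERIV_divide p_deriv a_deriv x) auto
  also have "(pd x * a x - p x * (a x * b x / (x - x0))) / (a x * a x) = q x / a x"
    using ax x by (simp add: q_def p_def field_simps)
  finally show ?thesis .
qed

lemma a_meas [measurable]: "a \<in> borel_measurable (IM 0 1)"
  by (rule measurable_IM_continuous) (rule continuous_on_subset[OF a_cont], auto)
lemma E_meas [measurable]: "E \<in> borel_measurable borel" and p_meas [measurable]: "p \<in> borel_measurable borel"
  and pd_meas [measurable]: "pd \<in> borel_measurable borel"
  by (auto intro: borel_measurable_continuous_onI E_cont p_cont pd_cont)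
lemma b_meas [measurable]: "b \<in> borel_measurable (IM 0 1)"
  by (rule measurable_IM_continuous) (rule continuous_on_subset[OF b_cont], auto)
lemma r_meas [measurable]: "r \<in> borel_measurable (IM 0 1)"
  unfolding r_def[abs_def] by measurable
lemma q_meas [measurable]: "q \<in> borel_measurable (IM 0 1)"
  unfolding q_def[abs_def] by measurable
lemma qd_meas [measurable]: "qd \<in> borel_measurable (IM 0 1)"
  unfolding qd_def[abs_def] by measurable

text \<open>The exponent \<open>1 - K\<close> exceeds -1, so the integral in \<open>psi\<close>
  converges for every \<open>K < 2\<close>.\<close>

lemma r_integrable: "set_integrable lborel {0..1} r"
proof -
  obtain c where c: "c > 0" "\<And>x. 0 \<le> x \<Longrightarrow> x \<le> 1 \<Longrightarrow> \<bar>r x\<bar> \<le> c * \<bar>x - x0\<bar> powr (1 - K)"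
    using r_bound by blast
  have "integrable (IM 0 1) r"
  proof (rule Bochner_Integration.integrable_bound)
    show "integrable (IM 0 1) (\<lambda>x. c * \<bar>x - x0\<bar> powr (1 - K))"
      using set_integrable_abs_powr[OF x0, of "1 - K"] K by (simp add: integrable_IM)
    have "\<bar>r x\<bar> \<le> \<bar>c * \<bar>x - x0\<bar> powr (1 - K)\<bar>" if "0 < x" "x < 1" for x
      using c(2)[of x] that by (auto intro: order_trans[OF _ abs_ge_self])
    thus "AE x in IM 0 1. norm (r x) \<le> norm (c * \<bar>x - x0\<bar> powr (1 - K))"
      by (intro AE_I2) auto
  qed simp
  thus ?thesis by (simp add: integrable_IM)
qed

lemma psi_ac: "ac_on 0 1 \<psi> (\<lambda>x. d1 * r x)"
  unfolding ac_on_def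
proof (intro conjI allI impI)
  show "set_integrable lborel {0..1} (\<lambda>x. d1 * r x)" using r_integrable by simp
  have eq: "(y - x0) / a y * exp (R * (y - x0)\<^sup>2) = r y" for y by (simp add: r_def p_def E_def)
  have psi_r: "\<psi> x = d1 * ((LBINT u=ereal x0..ereal x. r u) - d2)" for x
    by (simp only: psi_def eq)
  have il: "interval_lebesgue_integrable lborel (ereal l) (ereal u) r" if "l \<in> {0..1}" "u \<in> {0..1}" for l u
    unfolding interval_lebesgue_integrable_def
    using that by (auto intro!: set_integrable_subset[OF r_integrable])
  fix x y :: real assume xy: "0 \<le> x \<and> x \<le> y \<and> y \<le> 1"
  have "(LBINT u=ereal x0..ereal x. r u) + (LBINT u=ereal x..ereal y. r u) = (LBINT u=ereal x0..ereal y. r u)"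
    by (rule interval_integral_sum) (use il xy x0 in \<open>auto simp: min_def max_def\<close>)
  thus "\<psi> y - \<psi> x = (LBINT u:{x..y}. d1 * r u)"
    using xy unfolding psi_r by (simp add: interval_integral_Icc flip: right_diff_distrib)
qed

lemma psi_cont: "continuous_on {0..1} \<psi>"
  by (rule ac_on_continuous[OF psi_ac])

lemma psi_meas [measurable]: "\<psi> \<in> borel_measurable (IM 0 1)"
  by (rule measurable_IM_continuous) (rule continuous_on_subset[OF psi_cont], auto)

lemma psi_deriv: "0 < x \<Longrightarrow> x < 1 \<Longrightarrow> x \<noteq> x0 \<Longrightarrow> (\<psi> has_real_derivative d1 * r x) (at x)"
proof -
  assume x: "0 < x" "x < 1" "x \<noteq> x0"
  \<comment> \<open>An interval around \<open>x\<close> that avoids \<open>x0\<close>, on which the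
    derivative is continuous.\<close>
  define l u where "l = (if x < x0 then 0 else (x0 + x) / 2)" and "u = (if x < x0 then (x0 + x) / 2 else 1)"
  have lu: "0 \<le> l" "l < x" "x < u" "u \<le> 1" "x0 \<notin> {l..u}" using x x0 by (auto simp: l_def u_def)
  show ?thesis
  proof (rule ac_on_DERIV[OF ac_on_subset[OF psi_ac lu(1,4)] lu(2,3)])
    show "continuous_on {l..u} (\<lambda>x. d1 * r x)"
      by (intro continuous_intros continuous_on_subset[OF r_cont_punctured]) (use lu in auto)
  qed
qed

section \<open>Strict negativity of \<open>\<psi>\<close>\<close>

lemma psi_x0: "\<psi> x0 = - (d1 * d2)" by (simp add: psi_def)

lemma m_deriv: "0 < x \<Longrightarrow> x < 1 \<Longrightarrow> x \<noteq> x0 \<Longrightarrow> (m has_real_derivative (x - x0) / a x * (2 - b x)) (at x)"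
proof -
  assume x: "0 < x" "x < 1" "x \<noteq> x0"
  have ax: "a x > 0" using a_pos x by auto
  have "(m has_real_derivative (2 * (x - x0) * a x - (x - x0)\<^sup>2 * (a x * b x / (x - x0))) / (a x * a x)) (at x)"
    unfolding m_def[abs_def] using ax by (auto intro!: DERIV_divide derivative_eq_intros a_deriv x)
  also have "(2 * (x - x0) * a x - (x - x0)\<^sup>2 * (a x * b x / (x - x0))) / (a x * a x) = (x - x0) / a x * (2 - b x)"
    using ax x by (simp add: power2_eq_square field_simps)
  finally show ?thesis .
qed

text \<open>To the right of \<open>x0\<close> the function \<open>E 1 / (2 - K) * m\<close> grows at
  least as fast as \<open>\<psi> / d1\<close>: the derivatives are \<open>(x - x0)/a\<close> times
  \<open>E 1 * (2 - b)/(2 - K) \<ge> E 1\<close> and times \<open>E x\<close>, respectively. Both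
  functions are known at \<open>x0\<close>, which bounds \<open>\<psi> 1\<close>, the largest value
  on this side.\<close>

lemma psi_upper_right: "x0 \<le> x \<Longrightarrow> x \<le> 1 \<Longrightarrow> \<psi> x \<le> d1 * (E 1 / (2 - K) * m 1 - d2)"
proof -
  assume x: "x0 \<le> x" "x \<le> 1"
  have mono: "\<psi> x \<le> \<psi> 1"
  proof (rule DERIV_nonneg_imp_increasing_open[OF x(2)])
    fix y assume y: "x < y" "y < 1"
    have "d1 * r y \<ge> 0" using d1 E_pos[of y] a_pos[of y] y x x0 by (simp add: r_def p_def)
    thus "\<exists>d. (\<psi> has_real_derivative d) (at y) \<and> d \<ge> 0" using psi_deriv[of y] x y x0 by auto
  qed (rule continuous_on_subset[OF psi_cont], use x x0 in auto)
  have "E 1 / (2 - K) * m x0 - (\<psi> x0 / d1) \<le> E 1 / (2 - K) * m 1 - (\<psi> 1 / d1)"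
  proof (rule DERIV_nonneg_imp_increasing_open[where f="\<lambda>x. E 1 / (2 - K) * m x - (\<psi> x / d1)"])
    fix y assume y: "x0 < y" "y < 1"
    have der: "((\<lambda>x. E 1 / (2 - K) * m x - (\<psi> x / d1)) has_real_derivative E 1 / (2 - K) * ((y - x0) / a y * (2 - b y)) - (d1 * r y) / d1) (at y)"
      using y x0 by (intro DERIV_diff DERIV_cmult DERIV_cdivide m_deriv psi_deriv) auto
    have eq: "E 1 / (2 - K) * ((y - x0) / a y * (2 - b y)) - (d1 * r y) / d1 = (y - x0) / a y * (E 1 * ((2 - b y) / (2 - K)) - E y)"
    proof -
      have "d1 * r y / d1 = (y - x0) / a y * E y" using d1 by (simp add: r_def p_def)
      moreover have "e / k * (t * u) - t * f = t * (e * (u / k) - f)" for e k t u f :: real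
        by (simp add: algebra_simps)
      ultimately show ?thesis by (simp only:)
    qed
    have sgn: "(y - x0) / a y * (E 1 * ((2 - b y) / (2 - K)) - E y) \<ge> 0"
    proof -
      have "1 \<le> (2 - b y) / (2 - K)" using b_le[of y] y x0 K by simp
      hence "E 1 * 1 \<le> E 1 * ((2 - b y) / (2 - K))" using E_pos[of 1] by (intro mult_left_mono) auto
      moreover have "(y - x0)\<^sup>2 \<le> (1 - x0)\<^sup>2" using y by (intro power_mono) auto
      hence "E y \<le> E 1" using R by (simp add: E_def)
      ultimately show ?thesis using y a_pos[of y] x0 by (intro mult_nonneg_nonneg divide_nonneg_nonneg) auto
    qed
    show "\<exists>d. ((\<lambda>x. E 1 / (2 - K) * m x - (\<psi> x / d1)) has_real_derivative d) (at y) \<and> d \<ge> 0"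
      by (intro exI conjI, rule der, subst eq, rule sgn)
  next
    show "continuous_on {x0..1} (\<lambda>x. E 1 / (2 - K) * m x - \<psi> x / d1)"
      using d1 K x0 by (intro continuous_intros continuous_on_subset[OF psi_cont] continuous_on_subset[OF m_cont]) auto
  qed (use x0 in auto)
  moreover have "m x0 = 0" "\<psi> x0 / d1 = - d2" using d1 by (auto simp: m_def psi_x0)
  ultimately have "\<psi> 1 / d1 \<le> E 1 / (2 - K) * m 1 - d2" by simp
  hence "\<psi> 1 \<le> d1 * (E 1 / (2 - K) * m 1 - d2)"
    using d1 by (simp only: pos_divide_le_eq mult.commute)
  thus ?thesis using mono by simp
qed

text \<open>Mirror image: now the functions decrease and the largest value is at 0.\<close>

lemma psi_upper_left: "0 \<le> x \<Longrightarrow> x \<le> x0 \<Longrightarrow> \<psi> x \<le> d1 * (E 0 / (2 - K) * m 0 - d2)"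
proof -
  assume x: "0 \<le> x" "x \<le> x0"
  have mono: "\<psi> x \<le> \<psi> 0"
  proof (rule DERIV_nonpos_imp_decreasing_open[OF x(1)])
    fix y assume y: "0 < y" "y < x"
    have "(y - x0) * E y \<le> 0" using y x E_pos[of y] by (intro mult_nonpos_nonneg) auto
    hence "r y \<le> 0" unfolding r_def p_def using a_nonneg[of y] y x x0 by (intro divide_nonpos_nonneg) auto
    hence "d1 * r y \<le> 0" using d1 by (intro mult_nonneg_nonpos) auto
    thus "\<exists>d. (\<psi> has_real_derivative d) (at y) \<and> d \<le> 0" using psi_deriv[of y] x y x0 by auto
  qed (rule continuous_on_subset[OF psi_cont], use x x0 in auto)
  have "E 0 / (2 - K) * m x0 - (\<psi> x0 / d1) \<le> E 0 / (2 - K) * m 0 - (\<psi> 0 / d1)"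
  proof (rule DERIV_nonpos_imp_decreasing_open[where f="\<lambda>x. E 0 / (2 - K) * m x - (\<psi> x / d1)"])
    fix y assume y: "0 < y" "y < x0"
    have der: "((\<lambda>x. E 0 / (2 - K) * m x - (\<psi> x / d1)) has_real_derivative E 0 / (2 - K) * ((y - x0) / a y * (2 - b y)) - (d1 * r y) / d1) (at y)"
      using y x0 by (intro DERIV_diff DERIV_cmult DERIV_cdivide m_deriv psi_deriv) auto
    have eq: "E 0 / (2 - K) * ((y - x0) / a y * (2 - b y)) - (d1 * r y) / d1 = (y - x0) / a y * (E 0 * ((2 - b y) / (2 - K)) - E y)"
    proof -
      have "d1 * r y / d1 = (y - x0) / a y * E y" using d1 by (simp add: r_def p_def)
      moreover have "e / k * (t * u) - t * f = t * (e * (u / k) - f)" for e k t u f :: real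
        by (simp add: algebra_simps)
      ultimately show ?thesis by (simp only:)
    qed
    have sgn: "(y - x0) / a y * (E 0 * ((2 - b y) / (2 - K)) - E y) \<le> 0"
    proof -
      have "1 \<le> (2 - b y) / (2 - K)" using b_le[of y] y x0 K by simp
      hence "E 0 * 1 \<le> E 0 * ((2 - b y) / (2 - K))" using E_pos[of 0] by (intro mult_left_mono) auto
      moreover have "(y - x0)\<^sup>2 \<le> (0 - x0)\<^sup>2" using y by (subst abs_le_square_iff[symmetric]) auto
      hence "E y \<le> E 0" using R by (simp add: E_def)
      ultimately show ?thesis using y a_pos[of y] x0 by (intro mult_nonpos_nonneg divide_nonpos_nonneg) auto
    qed
    show "\<exists>d. ((\<lambda>x. E 0 / (2 - K) * m x - (\<psi> x / d1)) has_real_derivative d) (at y) \<and> d \<le> 0"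
      by (intro exI conjI, rule der, subst eq, rule sgn)
  next
    show "continuous_on {0..x0} (\<lambda>x. E 0 / (2 - K) * m x - \<psi> x / d1)"
      using d1 K x0 by (intro continuous_intros continuous_on_subset[OF psi_cont] continuous_on_subset[OF m_cont]) auto
  qed (use x0 in auto)
  moreover have "m x0 = 0" "\<psi> x0 / d1 = - d2" using d1 by (auto simp: m_def psi_x0)
  ultimately have "\<psi> 0 / d1 \<le> E 0 / (2 - K) * m 0 - d2" by simp
  hence "\<psi> 0 \<le> d1 * (E 0 / (2 - K) * m 0 - d2)"
    using d1 by (simp only: pos_divide_le_eq mult.commute)
  thus ?thesis using mono by simp
qed

text \<open>The hypothesis on \<open>d2\<close> acts here: the two quantities in its maximum are
  \<open>E 1 / (2 - K) * m 1\<close> and \<open>E 0 / (2 - K) * m 0\<close>.\<close>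

lemma psi_neg: obtains \<kappa> where "\<kappa> > 0" "\<And>x. 0 \<le> x \<Longrightarrow> x \<le> 1 \<Longrightarrow> \<psi> x \<le> - \<kappa>"
proof -
  have 1: "E 1 / (2 - K) * m 1 < d2" "E 0 / (2 - K) * m 0 < d2"
    using d2 by (auto simp: E_def m_def mult.commute)
  let ?k = "min (d1 * (d2 - E 1 / (2 - K) * m 1)) (d1 * (d2 - E 0 / (2 - K) * m 0))"
  show ?thesis
  proof (rule that[of ?k])
    show "?k > 0" using d1 1 by simp
    fix x :: real assume "0 \<le> x" "x \<le> 1"
    thus "\<psi> x \<le> - ?k" using psi_upper_right[of x] psi_upper_left[of x]
      by (cases "x \<le> x0") (auto simp: min_def algebra_simps)
  qed
qed

section \<open>Behaviour at the degenerate point and Hardy-type inequalities\<close>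

text \<open>Otherwise \<open>u^2/a\<close> is at least \<open>k / (L (x - x0))\<close> on a right
  neighbourhood of \<open>x0\<close>, which is not integrable; the logarithm makes the divergence
  explicit.\<close>

lemma vanish_at_x0:
  assumes L: "\<And>x. x \<in> {0..1} \<Longrightarrow> a x \<le> L * \<bar>x - x0\<bar>"
    and u: "continuous_on {0..1} u" and i: "integrable (IM 0 1) (\<lambda>x. (u x)\<^sup>2 / a x)"
  shows "u x0 = 0"
proof (rule ccontr)
  assume "u x0 \<noteq> 0"
  define k where "k = (u x0)\<^sup>2 / 2"
  have k: "k > 0" using \<open>u x0 \<noteq> 0\<close> by (simp add: k_def)
  have L0: "L > 0"
  proof -
    have "0 < L * \<bar>1 - x0\<bar>" using L[of 1] a_pos[of 1] x0 by auto
    thus ?thesis using x0 by (simp add: zero_less_mult_iff)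
  qed
  have uc: "((\<lambda>x. (u x)\<^sup>2) \<longlongrightarrow> (u x0)\<^sup>2) (at_right x0)"
  proof -
    have "continuous_on {x0..1} (\<lambda>x. (u x)\<^sup>2)"
      by (intro continuous_intros continuous_on_subset[OF u]) (use x0 in auto)
    thus ?thesis using x0 by (auto dest: continuous_on_Icc_at_rightD)
  qed
  have "\<forall>\<^sub>F x in at_right x0. (u x)\<^sup>2 > k"
    by (rule order_tendstoD(1)[OF uc]) (use k in \<open>simp add: k_def\<close>)
  then obtain \<delta> where \<delta>: "\<delta> > x0" "\<And>x. x0 < x \<Longrightarrow> x < \<delta> \<Longrightarrow> (u x)\<^sup>2 > k"
    unfolding eventually_at_right_field by auto
  define e where "e = (min \<delta> 1 + x0) / 2"
  have e: "x0 < e" "e < \<delta>" "e < 1" using \<delta> x0 by (auto simp: e_def)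
  let ?S = "LBINT x:{0..1}. (u x)\<^sup>2 / a x"
  have iS: "set_integrable lborel {0..1} (\<lambda>x. (u x)\<^sup>2 / a x)" using i by (simp add: integrable_IM)
  have nn: "(u x)\<^sup>2 / a x \<ge> 0" if "0 \<le> x" "x \<le> 1" for x using a_nonneg[OF that] by simp
  have S0: "(LBINT x:{l..r}. (u x)\<^sup>2 / a x) \<ge> 0" if "0 \<le> l" "r \<le> 1" for l r
    unfolding set_lebesgue_integral_def
    by (rule integral_nonneg_AE) (use nn that in \<open>auto simp: indicator_def\<close>)
  have key: "k / L * (ln (e - x0) - ln (y - x0)) \<le> ?S" if y: "x0 < y" "y \<le> e" for y
  proof -
    have ac: "ac_on y e (\<lambda>x. k / L * ln (x - x0)) (\<lambda>x. k / L * (1 / (x - x0)))"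
    proof (rule ac_on_C1)
      show "((\<lambda>x. k / L * ln (x - x0)) has_real_derivative k / L * (1 / (x - x0))) (at x within {y..e})"
        if "y \<le> x" "x \<le> e" for x using that y L0 by (auto intro!: derivative_eq_intros)
      show "continuous_on {y..e} (\<lambda>x. k / L * (1 / (x - x0)))" using y by (intro continuous_intros) auto
    qed
    have "k / L * ln (e - x0) - k / L * ln (y - x0) = (LBINT x:{y..e}. k / L * (1 / (x - x0)))"
      by (rule ac_onD(2)[OF ac]) (use y in auto)
    also have "\<dots> \<le> (LBINT x:{y..e}. (u x)\<^sup>2 / a x)"
    proof (rule set_integral_mono[OF ac_onD(1)[OF ac]])
      show "set_integrable lborel {y..e} (\<lambda>x. (u x)\<^sup>2 / a x)"
        by (rule set_integrable_subset[OF iS]) (use y e x0 in auto)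
      fix x :: real assume x: "x \<in> {y..e}"
      have ax: "0 < a x" "a x \<le> L * (x - x0)" using a_pos[of x] L[of x] x y e x0 by auto
      have "k / (L * (x - x0)) \<le> (u x)\<^sup>2 / a x"
        by (rule frac_le) (use \<delta>(2)[of x] x y e ax k in auto)
      thus "k / L * (1 / (x - x0)) \<le> (u x)\<^sup>2 / a x" by simp
    qed
    also have "\<dots> \<le> ?S"
      using set_integral_Icc_split[OF iS, of y e] set_integral_Icc_split[OF iS, of e 1] S0[of 0 y] S0[of e 1] y e x0 by simp
    finally show ?thesis by (simp add: right_diff_distrib)
  qed
  \<comment> \<open>Chosen so that the logarithmic lower bound equals \<open>?S + 1\<close>, which
    contradicts \<open>key\<close>.\<close>
  define y where "y = x0 + (e - x0) * exp (- ((?S + 1) * L / k))"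
  have S1: "?S \<ge> 0" using S0[of 0 1] by simp
  have le1: "exp (- ((?S + 1) * L / k)) \<le> 1" using S1 L0 k by simp
  have "y \<le> x0 + (e - x0) * 1" unfolding y_def using e le1 by (intro add_left_mono mult_left_mono) auto
  hence y: "x0 < y" "y \<le> e" using e by (auto simp: y_def)
  have "ln (y - x0) = ln (e - x0) - (?S + 1) * L / k"
    using e by (simp add: y_def ln_mult)
  hence "k / L * (ln (e - x0) - ln (y - x0)) = ?S + 1"
    using k L0 by simp
  thus False using key[OF y] by simp
qed

lemma m_bounded: obtains B where "B > 0" "\<And>x. x \<in> {0..1} \<Longrightarrow> m x \<le> B"
proof -
  obtain B where "\<And>x. x \<in> {0..1} \<Longrightarrow> norm (m x) \<le> B"
    using compact_imp_bounded[OF compact_continuous_image[OF m_cont]] by (fastforce simp: bounded_iff)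
  thus ?thesis using that[of "\<bar>B\<bar> + 1"] by fastforce
qed

lemma continuous_bounded01:
  fixes f :: "real \<Rightarrow> real"
  assumes "continuous_on {0..1} f" obtains B where "B > 0" "\<And>x. x \<in> {0..1} \<Longrightarrow> \<bar>f x\<bar> \<le> B"
proof -
  obtain B where "\<And>x. x \<in> {0..1} \<Longrightarrow> norm (f x) \<le> B"
    using compact_imp_bounded[OF compact_continuous_image[OF assms]] by (fastforce simp: bounded_iff)
  thus ?thesis using that[of "\<bar>B\<bar> + 1"] by fastforce
qed

lemma lipschitz_at_x0:
  assumes ac: "ac_on 0 1 V Vx" and c: "continuous_on {0..1} Vx" and V0: "V x0 = 0"
  obtains B where "B > 0" "\<And>x. x \<in> {0..1} \<Longrightarrow> \<bar>V x\<bar> \<le> B * \<bar>x - x0\<bar>"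
proof -
  obtain B where B: "B > 0" "\<And>x. x \<in> {0..1} \<Longrightarrow> \<bar>Vx x\<bar> \<le> B" using continuous_bounded01[OF c] by blast
  have "\<bar>V x\<bar> \<le> B * \<bar>x - x0\<bar>" if "x \<in> {0..1}" for x
    using ac_on_lipschitz[OF ac, of B x x0] ac_on_lipschitz[OF ac, of B x0 x] B that x0 V0
    by (cases "x \<le> x0") auto
  thus ?thesis using that B by blast
qed

lemma r_rho: "x \<in> {0..1} \<Longrightarrow> \<bar>r x\<bar> * \<bar>x - x0\<bar> \<le> exp R * m x"
proof -
  assume x: "x \<in> {0..1}"
  have "\<bar>r x\<bar> * \<bar>x - x0\<bar> = E x * m x"
    using a_nonneg[of x] x E_pos[of x] by (simp add: r_def p_def m_def abs_mult power2_eq_square mult_ac)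
  thus ?thesis using mult_right_mono[OF E_le[OF x] m_nonneg[of x]] x by simp
qed

text \<open>Where \<open>r\<close> may be unbounded, \<open>V\<close> vanishes at \<open>x0\<close>
  and is Lipschitz, so \<open>r V\<close> is of the order of \<open>m\<close>, which tends to
  0.\<close>

lemma rV_cont:
  assumes ac: "ac_on 0 1 V Vx" and c: "continuous_on {0..1} Vx" and i: "integrable (IM 0 1) (\<lambda>x. (V x)\<^sup>2 / a x)"
  shows "continuous_on {0..1} (\<lambda>x. r x * V x)"
proof (cases "K < 1")
  case True
  show ?thesis by (intro continuous_intros r_cont_WD True ac_on_continuous[OF ac])
next
  case False
  then obtain L where L: "\<And>x. x \<in> {0..1} \<Longrightarrow> a x \<le> L * \<bar>x - x0\<bar>" using deg by blast
  have V0: "V x0 = 0" by (rule vanish_at_x0[OF L ac_on_continuous[OF ac] i])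
  obtain B where B: "B > 0" "\<And>x. x \<in> {0..1} \<Longrightarrow> \<bar>V x\<bar> \<le> B * \<bar>x - x0\<bar>"
    using lipschitz_at_x0[OF ac c V0] by blast
  show ?thesis
  proof (rule continuous_on_punctured[where g="\<lambda>x. exp R * B * m x"])
    show "continuous_on ({0..1} - {x0}) (\<lambda>x. r x * V x)"
      by (intro continuous_intros r_cont_punctured continuous_on_subset[OF ac_on_continuous[OF ac]]) auto
    show "continuous_on {0..1} (\<lambda>x. exp R * B * m x)" by (intro continuous_intros m_cont)
    fix x :: real assume x: "x \<in> {0..1}"
    have "\<bar>r x * V x\<bar> \<le> \<bar>r x\<bar> * (B * \<bar>x - x0\<bar>)" unfolding abs_mult by (intro mult_left_mono B x) auto
    also have "\<dots> \<le> B * (exp R * m x)" using mult_left_mono[OF r_rho[OF x], of B] B by (simp add: mult_ac)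
    finally show "\<bar>r x * V x\<bar> \<le> exp R * B * m x" by (simp add: mult_ac)
  qed (auto simp: r_x0 m_def)
qed

lemma u_sq_bound:
  assumes ac: "ac_on 0 1 u u'" and i: "integrable (IM 0 1) (\<lambda>x. (u' x)\<^sup>2)" and y: "y \<in> {0..1}" "u y = 0" and x: "x \<in> {0..1}"
  shows "(u x)\<^sup>2 \<le> \<bar>x - y\<bar> * (\<integral>x. (u' x)\<^sup>2 \<partial>IM 0 1)"
proof -
  have i': "set_integrable lborel {0..1} (\<lambda>x. (u' x)\<^sup>2)" using i by (simp add: integrable_IM)
  show ?thesis using ac_on_holder[OF ac i', of x y] ac_on_holder[OF ac i', of y x] x y
    by (cases "x \<le> y") (auto simp: integral_IM)
qed

text \<open>A Hardy inequality: in both cases \<open>(r u)^2\<close> is pointwise at most an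
  integrable \<open>g\<close> times \<open>\<integral>u'^2\<close>. Of \<open>u'\<close> only square
  integrability is asked, so that the slices of \<open>v_t\<close> are covered as well.\<close>

lemma ru_square_integral:
  obtains C where "C > 0" "\<And>u u'. ac_on 0 1 u u' \<Longrightarrow> u 0 = 0 \<Longrightarrow> integrable (IM 0 1) (\<lambda>x. (u' x)\<^sup>2) \<Longrightarrow>
      integrable (IM 0 1) (\<lambda>x. (u x)\<^sup>2 / a x) \<Longrightarrow>
      integrable (IM 0 1) (\<lambda>x. (r x * u x)\<^sup>2) \<and> (\<integral>x. (r x * u x)\<^sup>2 \<partial>IM 0 1) \<le> C * (\<integral>x. (u' x)\<^sup>2 \<partial>IM 0 1)"
proof -
  have gen: "\<exists>C>0. \<forall>u u'. ac_on 0 1 u u' \<longrightarrow> u 0 = 0 \<longrightarrow> integrable (IM 0 1) (\<lambda>x. (u' x)\<^sup>2) \<longrightarrow>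
      integrable (IM 0 1) (\<lambda>x. (u x)\<^sup>2 / a x) \<longrightarrow>
      integrable (IM 0 1) (\<lambda>x. (r x * u x)\<^sup>2) \<and> (\<integral>x. (r x * u x)\<^sup>2 \<partial>IM 0 1) \<le> C * (\<integral>x. (u' x)\<^sup>2 \<partial>IM 0 1)"
    if g: "integrable (IM 0 1) g" "\<And>x. g x \<ge> 0" and le: "\<And>u u' x. ac_on 0 1 u u' \<Longrightarrow> u 0 = 0 \<Longrightarrow> integrable (IM 0 1) (\<lambda>x. (u' x)\<^sup>2) \<Longrightarrow>
      integrable (IM 0 1) (\<lambda>x. (u x)\<^sup>2 / a x) \<Longrightarrow> x \<in> {0..1} \<Longrightarrow> (r x * u x)\<^sup>2 \<le> g x * (\<integral>x. (u' x)\<^sup>2 \<partial>IM 0 1)"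
    for g :: "real \<Rightarrow> real"
  proof (intro exI[of _ "(\<integral>x. g x \<partial>IM 0 1) + 1"] conjI allI impI)
    have gn: "(\<integral>x. g x \<partial>IM 0 1) \<ge> 0" by (rule integral_nonneg_AE) (use g in auto)
    thus "(\<integral>x. g x \<partial>IM 0 1) + 1 > 0" by simp
    fix u u' :: "real \<Rightarrow> real" assume a: "ac_on 0 1 u u'" "u 0 = 0" "integrable (IM 0 1) (\<lambda>x. (u' x)\<^sup>2)" "integrable (IM 0 1) (\<lambda>x. (u x)\<^sup>2 / a x)"
    let ?S = "\<integral>x. (u' x)\<^sup>2 \<partial>IM 0 1"
    have S: "?S \<ge> 0" by (rule integral_nonneg_AE) auto
    have [measurable]: "u \<in> borel_measurable (IM 0 1)"
      by (rule measurable_IM_continuous, rule continuous_on_subset[OF ac_on_continuous[OF a(1)]]) auto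
    have gi: "integrable (IM 0 1) (\<lambda>x. g x * ?S)" using g by simp
    show ri: "integrable (IM 0 1) (\<lambda>x. (r x * u x)\<^sup>2)"
    proof (rule Bochner_Integration.integrable_bound[OF gi])
      show "AE x in IM 0 1. norm ((r x * u x)\<^sup>2) \<le> norm (g x * ?S)"
      proof (rule AE_I2)
        fix x :: real assume "x \<in> space (IM 0 1)"
        hence "(r x * u x)\<^sup>2 \<le> g x * ?S" using le[OF a, of x] by auto
        thus "norm ((r x * u x)\<^sup>2) \<le> norm (g x * ?S)" by simp
      qed
    qed measurable
    have "(\<integral>x. (r x * u x)\<^sup>2 \<partial>IM 0 1) \<le> (\<integral>x. g x * ?S \<partial>IM 0 1)"
      by (rule integral_mono[OF ri gi]) (use le[OF a] in auto)
    also have "\<dots> = (\<integral>x. g x \<partial>IM 0 1) * ?S" by simp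
    also have "\<dots> \<le> ((\<integral>x. g x \<partial>IM 0 1) + 1) * ?S" using S by (intro mult_right_mono) auto
    finally show "(\<integral>x. (r x * u x)\<^sup>2 \<partial>IM 0 1) \<le> ((\<integral>x. g x \<partial>IM 0 1) + 1) * ?S" .
  qed
  have "\<exists>C>0. \<forall>u u'. ac_on 0 1 u u' \<longrightarrow> u 0 = 0 \<longrightarrow> integrable (IM 0 1) (\<lambda>x. (u' x)\<^sup>2) \<longrightarrow>
      integrable (IM 0 1) (\<lambda>x. (u x)\<^sup>2 / a x) \<longrightarrow>
      integrable (IM 0 1) (\<lambda>x. (r x * u x)\<^sup>2) \<and> (\<integral>x. (r x * u x)\<^sup>2 \<partial>IM 0 1) \<le> C * (\<integral>x. (u' x)\<^sup>2 \<partial>IM 0 1)"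
  proof (cases "K < 1")
    case True
    obtain B where B: "B > 0" "\<And>x. x \<in> {0..1} \<Longrightarrow> \<bar>r x\<bar> \<le> B" using continuous_bounded01[OF r_cont_WD[OF True]] by blast
    show ?thesis
    proof (rule gen[of "\<lambda>_. B\<^sup>2"])
      fix u u' :: "real \<Rightarrow> real" and x :: real assume a: "ac_on 0 1 u u'" "u 0 = 0" "integrable (IM 0 1) (\<lambda>x. (u' x)\<^sup>2)" and x: "x \<in> {0..1}"
      have S: "(\<integral>x. (u' x)\<^sup>2 \<partial>IM 0 1) \<ge> 0" by (rule integral_nonneg_AE) auto
      have "(u x)\<^sup>2 \<le> \<bar>x - 0\<bar> * (\<integral>x. (u' x)\<^sup>2 \<partial>IM 0 1)" by (rule u_sq_bound[OF a(1,3)]) (use a x in auto)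
      also have "\<dots> \<le> 1 * (\<integral>x. (u' x)\<^sup>2 \<partial>IM 0 1)" using x S by (intro mult_right_mono) auto
      finally have "(u x)\<^sup>2 \<le> (\<integral>x. (u' x)\<^sup>2 \<partial>IM 0 1)" by simp
      moreover have "(r x)\<^sup>2 \<le> B\<^sup>2" using power_mono[OF B(2)[OF x], of 2] by simp
      ultimately show "(r x * u x)\<^sup>2 \<le> B\<^sup>2 * (\<integral>x. (u' x)\<^sup>2 \<partial>IM 0 1)"
        unfolding power_mult_distrib by (intro mult_mono) auto
    qed auto
  next
    case False
    then obtain L where L: "\<And>x. x \<in> {0..1} \<Longrightarrow> a x \<le> L * \<bar>x - x0\<bar>" using deg by blast
    obtain c where c: "c > 0" "\<And>x. 0 \<le> x \<Longrightarrow> x \<le> 1 \<Longrightarrow> \<bar>r x\<bar> \<le> c * \<bar>x - x0\<bar> powr (1 - K)"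
      using r_bound by blast
    show ?thesis
    \<comment> \<open>\<open>u^2\<close> contributes one power of the distance because
      \<open>u\<close> vanishes at \<open>x0\<close>, and \<open>r^2\<close> contributes the
      exponent \<open>2 - 2 K\<close>; the sum exceeds -1 since \<open>K < 2\<close>.\<close>
    proof (rule gen[of "\<lambda>x. c\<^sup>2 * \<bar>x - x0\<bar> powr (3 - 2 * K)"])
      show "integrable (IM 0 1) (\<lambda>x. c\<^sup>2 * \<bar>x - x0\<bar> powr (3 - 2 * K))"
        using set_integrable_abs_powr[OF x0, of "3 - 2 * K"] K by (simp add: integrable_IM)
      fix u u' :: "real \<Rightarrow> real" and x :: real assume a: "ac_on 0 1 u u'" "u 0 = 0" "integrable (IM 0 1) (\<lambda>x. (u' x)\<^sup>2)" "integrable (IM 0 1) (\<lambda>x. (u x)\<^sup>2 / a x)" and x: "x \<in> {0..1}"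
      let ?S = "\<integral>x. (u' x)\<^sup>2 \<partial>IM 0 1"
      have S: "?S \<ge> 0" by (rule integral_nonneg_AE) auto
      have u0: "u x0 = 0" by (rule vanish_at_x0[OF L ac_on_continuous[OF a(1)] a(4)])
      have 1: "(u x)\<^sup>2 \<le> \<bar>x - x0\<bar> * ?S" by (rule u_sq_bound[OF a(1,3)]) (use u0 x x0 in auto)
      have 2: "(r x)\<^sup>2 \<le> (c * \<bar>x - x0\<bar> powr (1 - K))\<^sup>2" using power_mono[OF c(2)[of x], of 2] x by simp
      have "(r x)\<^sup>2 * (u x)\<^sup>2 \<le> (c * \<bar>x - x0\<bar> powr (1 - K))\<^sup>2 * (\<bar>x - x0\<bar> * ?S)"
        by (rule mult_mono[OF 2 1]) auto
      also have "\<dots> = c\<^sup>2 * \<bar>x - x0\<bar> powr (3 - 2 * K) * ?S"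
      proof (cases "x = x0")
        case False
        have "3 - 2 * K = (1 - K) + (1 - K) + 1" by simp
        hence "\<bar>x - x0\<bar> powr (3 - 2 * K) = \<bar>x - x0\<bar> powr (1 - K) * \<bar>x - x0\<bar> powr (1 - K) * \<bar>x - x0\<bar>"
          using False by (simp only: powr_add) simp
        thus ?thesis by (simp add: power2_eq_square)
      qed simp
      finally show "(r x * u x)\<^sup>2 \<le> c\<^sup>2 * \<bar>x - x0\<bar> powr (3 - 2 * K) * ?S" by (simp add: power_mult_distrib)
    qed auto
  qed
  thus ?thesis using that by blast
qed

lemma abs_mult_le_half_squares: "\<bar>x * y\<bar> \<le> (x\<^sup>2 + y\<^sup>2) / (2::real)"
  using sum_squares_bound[of "\<bar>x\<bar>" "\<bar>y\<bar>"] by (simp add: abs_mult)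

text \<open>Testing with \<open>(x - x\<^sub>0)/a\<close> in the weakly degenerate case and Hardy's inequality (testing with
  \<open>1/(x - x\<^sub>0)\<close>) in the strongly degenerate one.\<close>

lemma weighted_poincare:
  obtains C where "C > 0" "\<And>w z \<sigma>. ac_on 0 1 w z \<Longrightarrow> continuous_on {0..1} z \<Longrightarrow> w 0 = 0 \<Longrightarrow> w 1 = 0 \<Longrightarrow> \<sigma> > 0 \<Longrightarrow>
     integrable (IM 0 1) (\<lambda>x. (w x)\<^sup>2 / a x) \<Longrightarrow> integrable (IM 0 1) (\<lambda>x. (r x * w x)\<^sup>2) \<Longrightarrow>
     \<sigma> * (\<integral>x. (w x)\<^sup>2 / a x \<partial>IM 0 1) \<le> C * ((\<integral>x. (z x)\<^sup>2 \<partial>IM 0 1) + \<sigma>\<^sup>2 * (\<integral>x. (r x * w x)\<^sup>2 \<partial>IM 0 1))"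
proof -
  let ?P = "\<lambda>C. \<forall>w z \<sigma>. ac_on 0 1 w z \<longrightarrow> continuous_on {0..1} z \<longrightarrow> w 0 = 0 \<longrightarrow> w 1 = 0 \<longrightarrow> \<sigma> > 0 \<longrightarrow>
     integrable (IM 0 1) (\<lambda>x. (w x)\<^sup>2 / a x) \<longrightarrow> integrable (IM 0 1) (\<lambda>x. (r x * w x)\<^sup>2) \<longrightarrow>
     \<sigma> * (\<integral>x. (w x)\<^sup>2 / a x \<partial>IM 0 1) \<le> C * ((\<integral>x. (z x)\<^sup>2 \<partial>IM 0 1) + \<sigma>\<^sup>2 * (\<integral>x. (r x * w x)\<^sup>2 \<partial>IM 0 1))"
  have meas: "w \<in> borel_measurable (IM 0 1)" if "continuous_on {0..1} w" for w :: "real \<Rightarrow> real"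
    by (rule measurable_IM_continuous) (rule continuous_on_subset[OF that], auto)
  have sqi: "integrable (IM 0 1) (\<lambda>x. (z x)\<^sup>2)" if "continuous_on {0..1} z" for z :: "real \<Rightarrow> real"
    unfolding integrable_IM by (rule borel_integrable_atLeastAtMost') (intro continuous_intros that)
  \<comment> \<open>\<open>r\<close> without its exponential factor; since \<open>E \<ge> 1\<close>,
    bounds in \<open>\<mu>\<close> pass to \<open>r\<close>.\<close>
  define \<mu> where "\<mu> x = (x - x0) / a x" for x
  have mu_r: "r x = E x * \<mu> x" for x by (simp add: r_def p_def \<mu>_def)
  have mu_le: "\<bar>\<mu> x\<bar> \<le> \<bar>r x\<bar>" for x
    unfolding mu_r abs_mult using mult_right_mono[OF E_ge_1[of x], of "\<bar>\<mu> x\<bar>"] E_ge_1[of x] by simp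
  have mu_sq: "(\<mu> x)\<^sup>2 \<le> (r x)\<^sup>2" for x using mu_le by (simp add: abs_le_square_iff)
  have [measurable]: "\<mu> \<in> borel_measurable (IM 0 1)" unfolding \<mu>_def[abs_def] by measurable
  have "\<exists>C>0. ?P C"
  proof (cases "K < 1")
    case True
    show ?thesis
    \<comment> \<open>The integral of \<open>(\<mu> w^2)'\<close> is 0, and
      \<open>\<mu>' = (1 - b)/a \<ge> (1 - K)/a\<close>; so \<open>(1 - K) \<integral>w^2/a\<close>
      is bounded by the integral of a product, to which Young's inequality applies.\<close>
    proof (intro exI[of _ "1 / (1 - K)"] conjI allI impI)
      fix w z :: "real \<Rightarrow> real" and \<sigma> :: real
      assume ac: "ac_on 0 1 w z" and zc: "continuous_on {0..1} z" and w0: "w 0 = 0" and w1: "w 1 = 0" and s: "\<sigma> > 0"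
        and i1: "integrable (IM 0 1) (\<lambda>x. (w x)\<^sup>2 / a x)" and i2: "integrable (IM 0 1) (\<lambda>x. (r x * w x)\<^sup>2)"
      note wc = ac_on_continuous[OF ac]
      note [measurable] = meas[OF wc] meas[OF zc]
      have muc: "continuous_on {0..1} \<mu>"
      proof -
        have "\<mu> = (\<lambda>x. r x / E x)" using E_pos by (auto simp: mu_r fun_eq_iff less_le)
        moreover have "continuous_on {0..1} (\<lambda>x. r x / E x)"
          by (intro continuous_intros r_cont_WD True E_cont) (use E_pos in \<open>auto simp: less_le\<close>)
        ultimately show ?thesis by simp
      qed
      let ?F = "\<lambda>x. \<mu> x * (w x * w x)"
      let ?F' = "\<lambda>x. (1 - b x) / a x * (w x * w x) + \<mu> x * (z x * w x + w x * z x)"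
      have iA: "integrable (IM 0 1) (\<lambda>x. (1 - b x) * ((w x)\<^sup>2 / a x))"
      proof -
        have "continuous_on {0..1} (\<lambda>x. 1 - b x)" by (intro continuous_intros b_cont)
        then obtain B where "\<And>x. x \<in> {0..1} \<Longrightarrow> \<bar>1 - b x\<bar> \<le> B"
          using continuous_bounded01 by blast
        hence "integrable (IM 0 1) (\<lambda>x. (w x)\<^sup>2 / a x * (1 - b x))"
          by (intro integrable_mult_bounded[OF i1, where B=B] AE_I2) auto
        thus ?thesis by (simp add: mult.commute)
      qed
      have iB: "integrable (IM 0 1) (\<lambda>x. \<mu> x * w x * z x)"
        unfolding integrable_IM by (rule borel_integrable_atLeastAtMost') (intro continuous_intros muc wc zc)
      have F'eq: "?F' x = (1 - b x) * ((w x)\<^sup>2 / a x) + 2 * (\<mu> x * w x * z x)" for x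
        by (simp add: power2_eq_square algebra_simps)
      have F'i: "integrable (IM 0 1) ?F'" unfolding F'eq using iA iB by simp
      have "ac_on 0 1 ?F ?F'"
      proof (rule ac_on_punctured[OF x0])
        show "continuous_on {0..1} ?F" by (intro continuous_intros muc wc)
        show "set_integrable lborel {0..1} ?F'" using F'i by (simp add: integrable_IM)
        fix \<alpha> \<beta> assume ab: "0 < \<alpha>" "\<alpha> \<le> \<beta>" "\<beta> < 1" "x0 \<notin> {\<alpha>..\<beta>}"
        have "ac_on \<alpha> \<beta> \<mu> (\<lambda>x. (1 - b x) / a x)"
        proof (rule ac_on_C1)
          fix x :: real assume x: "\<alpha> \<le> x" "x \<le> \<beta>"
          hence x': "0 < x" "x < 1" "x \<noteq> x0" using ab by auto
          have ax: "a x > 0" using a_pos x' by auto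
          have "(\<mu> has_real_derivative (1 * a x - (x - x0) * (a x * b x / (x - x0))) / (a x * a x)) (at x)"
            unfolding \<mu>_def[abs_def] using ax by (intro DERIV_divide a_deriv x') (auto intro!: derivative_eq_intros)
          also have "(1 * a x - (x - x0) * (a x * b x / (x - x0))) / (a x * a x) = (1 - b x) / a x"
            using ax x' by (simp add: field_simps)
          finally show "(\<mu> has_real_derivative (1 - b x) / a x) (at x within {\<alpha>..\<beta>})"
            by (rule has_field_derivative_at_within)
        next
          have "continuous_on ({0..1} - {x0}) (\<lambda>x. (1 - b x) / a x)"
            by (intro div_a_cont continuous_intros continuous_on_subset[OF b_cont]) auto
          thus "continuous_on {\<alpha>..\<beta>} (\<lambda>x. (1 - b x) / a x)"
            by (rule continuous_on_subset) (use ab in auto)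
        qed
        moreover have "ac_on \<alpha> \<beta> w z" using ac_on_subset[OF ac] ab by auto
        ultimately show "ac_on \<alpha> \<beta> ?F ?F'" by (intro ac_on_mult)
      qed
      from ac_onD(2)[OF this, of 0 1] have "(\<integral>x. ?F' x \<partial>IM 0 1) = 0"
        using w0 w1 by (simp add: integral_IM)
      hence eq: "(\<integral>x. (1 - b x) * ((w x)\<^sup>2 / a x) \<partial>IM 0 1) = - 2 * (\<integral>x. \<mu> x * w x * z x \<partial>IM 0 1)"
        unfolding F'eq using iA iB by simp
      have "(1 - K) * (\<integral>x. (w x)\<^sup>2 / a x \<partial>IM 0 1) = (\<integral>x. (1 - K) * ((w x)\<^sup>2 / a x) \<partial>IM 0 1)"
        by (rule Bochner_Integration.integral_mult_right_zero[symmetric])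
      also have "\<dots> \<le> (\<integral>x. (1 - b x) * ((w x)\<^sup>2 / a x) \<partial>IM 0 1)"
      proof (rule integral_mono[OF _ iA])
        show "integrable (IM 0 1) (\<lambda>x. (1 - K) * ((w x)\<^sup>2 / a x))" by (intro integrable_mult_right i1)
        fix x :: real assume "x \<in> space (IM 0 1)"
        thus "(1 - K) * ((w x)\<^sup>2 / a x) \<le> (1 - b x) * ((w x)\<^sup>2 / a x)"
          using b_le[of x] a_nonneg[of x] by (intro mult_right_mono) auto
      qed
      also note eq
      finally have "\<sigma> * ((1 - K) * (\<integral>x. (w x)\<^sup>2 / a x \<partial>IM 0 1)) \<le> \<sigma> * (- 2 * (\<integral>x. \<mu> x * w x * z x \<partial>IM 0 1))"
        using s by (intro mult_left_mono) auto
      also have "\<dots> = (\<integral>x. - 2 * \<sigma> * (\<mu> x * w x * z x) \<partial>IM 0 1)" by simp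
      also have "\<dots> \<le> (\<integral>x. (z x)\<^sup>2 + \<sigma>\<^sup>2 * (r x * w x)\<^sup>2 \<partial>IM 0 1)"
      proof (rule integral_mono)
        show "integrable (IM 0 1) (\<lambda>x. - 2 * \<sigma> * (\<mu> x * w x * z x))" using iB by simp
        show "integrable (IM 0 1) (\<lambda>x. (z x)\<^sup>2 + \<sigma>\<^sup>2 * (r x * w x)\<^sup>2)" using sqi[OF zc] i2 by simp
        fix x
        have "- 2 * \<sigma> * (\<mu> x * w x * z x) \<le> 2 * \<bar>z x * (\<sigma> * \<mu> x * w x)\<bar>"
          using abs_ge_minus_self[of "z x * (\<sigma> * \<mu> x * w x)"] by (simp add: mult_ac)
        also have "\<dots> \<le> (z x)\<^sup>2 + (\<sigma> * \<mu> x * w x)\<^sup>2" using abs_mult_le_half_squares[of "z x" "\<sigma> * \<mu> x * w x"] by simp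
        also have "(\<sigma> * \<mu> x * w x)\<^sup>2 \<le> \<sigma>\<^sup>2 * (r x * w x)\<^sup>2"
          unfolding power_mult_distrib mult.assoc by (intro mult_left_mono mult_right_mono mu_sq) auto
        finally show "- 2 * \<sigma> * (\<mu> x * w x * z x) \<le> (z x)\<^sup>2 + \<sigma>\<^sup>2 * (r x * w x)\<^sup>2" by simp
      qed
      also have "\<dots> = (\<integral>x. (z x)\<^sup>2 \<partial>IM 0 1) + \<sigma>\<^sup>2 * (\<integral>x. (r x * w x)\<^sup>2 \<partial>IM 0 1)" using sqi[OF zc] i2 by simp
      finally show "\<sigma> * (\<integral>x. (w x)\<^sup>2 / a x \<partial>IM 0 1) \<le> 1 / (1 - K) * ((\<integral>x. (z x)\<^sup>2 \<partial>IM 0 1) + \<sigma>\<^sup>2 * (\<integral>x. (r x * w x)\<^sup>2 \<partial>IM 0 1))"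
        using True by (simp add: field_simps)
    qed (use True in auto)
  next
    case False
    then obtain L where L: "\<And>x. x \<in> {0..1} \<Longrightarrow> a x \<le> L * \<bar>x - x0\<bar>" using deg by blast
    show ?thesis
    proof (intro exI[of _ 2] conjI allI impI)
      fix w z :: "real \<Rightarrow> real" and \<sigma> :: real
      assume ac: "ac_on 0 1 w z" and zc: "continuous_on {0..1} z" and w0: "w 0 = 0" and w1: "w 1 = 0" and s: "\<sigma> > 0"
        and i1: "integrable (IM 0 1) (\<lambda>x. (w x)\<^sup>2 / a x)" and i2: "integrable (IM 0 1) (\<lambda>x. (r x * w x)\<^sup>2)"
      note wc = ac_on_continuous[OF ac]
      note [measurable] = meas[OF wc] meas[OF zc]
      have wx0: "w x0 = 0" by (rule vanish_at_x0[OF L wc i1])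
      obtain B where B: "B > 0" "\<And>x. x \<in> {0..1} \<Longrightarrow> \<bar>w x\<bar> \<le> B * \<bar>x - x0\<bar>"
        using lipschitz_at_x0[OF ac zc wx0] by blast
      \<comment> \<open>The Hardy quotient, with value 0 at \<open>x0\<close> by division by zero;
        it is bounded by the Lipschitz estimate \<open>B\<close>.\<close>
      define h where "h x = w x / (x - x0)" for x
      have hB: "\<bar>h x\<bar> \<le> B" if "x \<in> {0..1}" for x
        using B(2)[OF that] B(1) by (cases "x = x0") (auto simp: h_def field_simps)
      have [measurable]: "h \<in> borel_measurable (IM 0 1)" unfolding h_def[abs_def] by measurable
      have ih: "integrable (IM 0 1) (\<lambda>x. (h x)\<^sup>2)"
        by (rule integrable_IM_bounded[where B="B\<^sup>2"]) (use power_mono[OF hB, of _ 2] in auto)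
      have ihz: "integrable (IM 0 1) (\<lambda>x. h x * z x)"
      proof -
        have "integrable (IM 0 1) z" unfolding integrable_IM by (rule borel_integrable_atLeastAtMost'[OF zc])
        hence "integrable (IM 0 1) (\<lambda>x. z x * h x)"
          by (rule integrable_mult_bounded[where B=B]) (auto intro!: AE_I2 hB)
        thus ?thesis by (simp add: mult.commute)
      qed
      let ?F = "\<lambda>x. 1 / (x - x0) * (w x * w x)"
      let ?F' = "\<lambda>x. - (1 / (x - x0)\<^sup>2) * (w x * w x) + 1 / (x - x0) * (z x * w x + w x * z x)"
      have F'eq: "?F' x = 2 * (h x * z x) - (h x)\<^sup>2" for x
        by (simp add: h_def power2_eq_square add_divide_distrib)
      have F'i: "integrable (IM 0 1) ?F'" unfolding F'eq using ih ihz by simp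
      have "ac_on 0 1 ?F ?F'"
      proof (rule ac_on_punctured[OF x0])
        show "continuous_on {0..1} ?F"
        \<comment> \<open>\<open>?F\<close> equals \<open>h^2 * (x - x0)\<close> with
          \<open>h\<close> bounded.\<close>
        proof (rule continuous_on_punctured[where g="\<lambda>x. B\<^sup>2 * \<bar>x - x0\<bar>"])
          show "continuous_on ({0..1} - {x0}) ?F" by (intro continuous_intros continuous_on_subset[OF wc]) auto
          show "continuous_on {0..1} (\<lambda>x. B\<^sup>2 * \<bar>x - x0\<bar>)" by (intro continuous_intros)
          fix x :: real assume x: "x \<in> {0..1}"
          have "(h x)\<^sup>2 = (w x * w x) / (\<bar>x - x0\<bar> * \<bar>x - x0\<bar>)" by (simp add: h_def power2_eq_square)
          moreover have "t / (c * c) * c = t / c" for t c :: real by (cases "c = 0") auto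

          moreover have "\<bar>?F x\<bar> = (w x * w x) / \<bar>x - x0\<bar>" by (simp add: abs_mult)
          ultimately have "\<bar>?F x\<bar> = (h x)\<^sup>2 * \<bar>x - x0\<bar>" by (simp only:)

          also have "\<dots> \<le> B\<^sup>2 * \<bar>x - x0\<bar>" using power_mono[OF hB[OF x], of 2] by (intro mult_right_mono) auto
          finally show "\<bar>?F x\<bar> \<le> B\<^sup>2 * \<bar>x - x0\<bar>" .
        qed auto
        show "set_integrable lborel {0..1} ?F'" using F'i by (simp add: integrable_IM)
        fix \<alpha> \<beta> assume ab: "0 < \<alpha>" "\<alpha> \<le> \<beta>" "\<beta> < 1" "x0 \<notin> {\<alpha>..\<beta>}"
        have "ac_on \<alpha> \<beta> (\<lambda>x. 1 / (x - x0)) (\<lambda>x. - (1 / (x - x0)\<^sup>2))"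
        proof (rule ac_on_C1)
          fix x :: real assume x: "\<alpha> \<le> x" "x \<le> \<beta>"
          hence x': "x \<noteq> x0" using ab by auto
          show "((\<lambda>x. 1 / (x - x0)) has_real_derivative - (1 / (x - x0)\<^sup>2)) (at x within {\<alpha>..\<beta>})"
            using x' by (auto intro!: derivative_eq_intros simp: power2_eq_square)
        next
          show "continuous_on {\<alpha>..\<beta>} (\<lambda>x. - (1 / (x - x0)\<^sup>2))"
            using ab by (intro continuous_intros) auto
        qed
        moreover have "ac_on \<alpha> \<beta> w z" using ac_on_subset[OF ac] ab by auto
        ultimately show "ac_on \<alpha> \<beta> ?F ?F'" by (intro ac_on_mult)
      qed
      from ac_onD(2)[OF this, of 0 1] have "(\<integral>x. ?F' x \<partial>IM 0 1) = 0"
        using w0 w1 by (simp add: integral_IM)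
      hence eq: "(\<integral>x. (h x)\<^sup>2 \<partial>IM 0 1) = 2 * (\<integral>x. h x * z x \<partial>IM 0 1)"
        unfolding F'eq using ih ihz by simp
      also have "\<dots> = (\<integral>x. 2 * (h x * z x) \<partial>IM 0 1)" by simp
      also have "\<dots> \<le> (\<integral>x. (h x)\<^sup>2 / 2 + 2 * (z x)\<^sup>2 \<partial>IM 0 1)"
      proof (rule integral_mono)
        show "integrable (IM 0 1) (\<lambda>x. 2 * (h x * z x))" using ihz by simp
        show "integrable (IM 0 1) (\<lambda>x. (h x)\<^sup>2 / 2 + 2 * (z x)\<^sup>2)" using ih sqi[OF zc] by simp
        \<comment> \<open>Young's inequality, weighted so that half of \<open>\<integral>h^2\<close>
          can be absorbed; this produces the constant 4 in \<open>hardy\<close>.\<close>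
        show "2 * (h x * z x) \<le> (h x)\<^sup>2 / 2 + 2 * (z x)\<^sup>2" for x
          using zero_le_power2[of "h x - 2 * z x"] by (simp add: power2_eq_square algebra_simps)
      qed
      also have "\<dots> = (\<integral>x. (h x)\<^sup>2 \<partial>IM 0 1) / 2 + 2 * (\<integral>x. (z x)\<^sup>2 \<partial>IM 0 1)" using ih sqi[OF zc] by simp
      finally have hardy: "(\<integral>x. (h x)\<^sup>2 \<partial>IM 0 1) \<le> 4 * (\<integral>x. (z x)\<^sup>2 \<partial>IM 0 1)" by simp
      have "\<sigma> * (\<integral>x. (w x)\<^sup>2 / a x \<partial>IM 0 1) = (\<integral>x. \<sigma> * ((w x)\<^sup>2 / a x) \<partial>IM 0 1)"
        by (rule Bochner_Integration.integral_mult_right_zero[symmetric])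
      also have "\<dots> \<le> (\<integral>x. (\<sigma>\<^sup>2 * (r x * w x)\<^sup>2 + (h x)\<^sup>2) / 2 \<partial>IM 0 1)"
      proof (rule integral_mono)
        show "integrable (IM 0 1) (\<lambda>x. \<sigma> * ((w x)\<^sup>2 / a x))" by (intro integrable_mult_right i1)
        show "integrable (IM 0 1) (\<lambda>x. (\<sigma>\<^sup>2 * (r x * w x)\<^sup>2 + (h x)\<^sup>2) / 2)" using i2 ih by simp
        fix x
        \<comment> \<open>The factorisation \<open>w^2/a = (\<mu> w) h\<close> pairs the Carleman
          weight with the Hardy quotient; at \<open>x0\<close> both sides vanish.\<close>
        have "\<sigma> * ((w x)\<^sup>2 / a x) = (\<sigma> * \<mu> x * w x) * h x"
          using wx0 by (cases "x = x0") (auto simp: \<mu>_def h_def power2_eq_square)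
        also have "\<dots> \<le> \<bar>(\<sigma> * \<mu> x * w x) * h x\<bar>" by simp
        also have "\<dots> \<le> ((\<sigma> * \<mu> x * w x)\<^sup>2 + (h x)\<^sup>2) / 2" by (rule abs_mult_le_half_squares)
        also have "(\<sigma> * \<mu> x * w x)\<^sup>2 \<le> \<sigma>\<^sup>2 * (r x * w x)\<^sup>2"
          unfolding power_mult_distrib mult.assoc by (intro mult_left_mono mult_right_mono mu_sq) auto
        finally show "\<sigma> * ((w x)\<^sup>2 / a x) \<le> (\<sigma>\<^sup>2 * (r x * w x)\<^sup>2 + (h x)\<^sup>2) / 2" by simp
      qed
      also have "\<dots> = (\<sigma>\<^sup>2 * (\<integral>x. (r x * w x)\<^sup>2 \<partial>IM 0 1) + (\<integral>x. (h x)\<^sup>2 \<partial>IM 0 1)) / 2" using i2 ih by simp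
      also have "\<dots> \<le> 2 * ((\<integral>x. (z x)\<^sup>2 \<partial>IM 0 1) + \<sigma>\<^sup>2 * (\<integral>x. (r x * w x)\<^sup>2 \<partial>IM 0 1))"
      proof -
        have "\<sigma>\<^sup>2 * (\<integral>x. (r x * w x)\<^sup>2 \<partial>IM 0 1) \<ge> 0" by (intro mult_nonneg_nonneg integral_nonneg_AE) auto
        moreover have "(s + H) / 2 \<le> 2 * (Z + s)" if "0 \<le> s" "H \<le> 4 * Z" for s H Z :: real using that by simp
        ultimately show ?thesis using hardy by blast

      qed
      finally show "\<sigma> * (\<integral>x. (w x)\<^sup>2 / a x \<partial>IM 0 1) \<le> 2 * ((\<integral>x. (z x)\<^sup>2 \<partial>IM 0 1) + \<sigma>\<^sup>2 * (\<integral>x. (r x * w x)\<^sup>2 \<partial>IM 0 1))" .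
    qed simp
  qed
  thus ?thesis using that by blast
qed

end

section \<open>The pointwise Carleman identity\<close>

text \<open>The letters are values at one point and \<open>ia\<close> stands for \<open>1/a\<close>,
  so this is pure algebra and holds at \<open>x0\<close> too, where \<open>ia\<close> becomes 0. The
  left side is the flux differentiated by the product rule.\<close>

lemma flux_identity:
  fixes p r q ia \<psi>x z zx zt w wt pd qd \<sigma> \<tau> \<upsilon> d1 :: real
  assumes "r = p * ia"
  shows "(zx * wt + z * zt) - \<sigma> * d1 * (pd * (z * z) + p * (zx * z + z * zx)) - \<sigma> * d1 * (qd * (w * z) + q * (z * z + w * zx))
    - \<sigma> * d1 * ((\<sigma>\<^sup>2 * d1\<^sup>2 * (pd * (r * r) + p * ((q * ia) * r + r * (q * ia))) - \<tau> * (d1 * r * r + \<psi>x * (q * ia))) * (w * w)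
       + (\<sigma>\<^sup>2 * d1\<^sup>2 * (p * (r * r)) - \<tau> * (\<psi>x * r)) * (z * w + w * z))
   = (zx + ((\<sigma> * d1 * r)\<^sup>2 - \<tau> * \<psi>x * ia) * w) * (wt - 2 * \<sigma> * d1 * p * z - \<sigma> * d1 * q * w)
     - (- (z * zt) + (2 * \<sigma> * \<tau> * (d1 * r)\<^sup>2 - \<upsilon> * \<psi>x * ia) * w\<^sup>2 / 2 + ((\<sigma> * d1 * r)\<^sup>2 - \<tau> * \<psi>x * ia) * w * wt)
     - (\<sigma> * d1 * (pd + q) * z\<^sup>2 + \<sigma> * d1 * qd * (w * z) + (\<sigma> * d1) ^ 3 * (pd + q) * (r * w)\<^sup>2
        - 2 * \<sigma> * \<tau> * d1\<^sup>2 * (r * w)\<^sup>2 + \<upsilon> * \<psi>x * (w\<^sup>2 * ia) / 2)"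
  unfolding assms by (simp add: field_simps power2_eq_square power3_eq_cube)

context carleman_weight begin

text \<open>At a fixed time, \<open>\<sigma>\<close>, \<open>\<tau>\<close>, \<open>\<upsilon>\<close> stand for \<open>s\<Theta>\<close>, \<open>s\<Theta>'\<close>, \<open>s\<Theta>''\<close>, and \<open>V\<close>, \<open>U\<close> for the slices of \<open>v\<close>, \<open>v\<^sub>t\<close>.
  Then \<open>wf\<close>, \<open>zf\<close>, \<open>zxf\<close>, \<open>wtf\<close>, \<open>ztf\<close> are \<open>w\<close>, \<open>w\<^sub>x\<close>, \<open>w\<^sub>x\<^sub>x\<close>, \<open>w\<^sub>t\<close>, \<open>w\<^sub>t\<^sub>x\<close>, \<open>Lp\<close> and \<open>Lm\<close> are \<open>L\<^sup>+/a\<close> and \<open>L\<^sup>-\<close>,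
  \<open>Pt\<close> is the time derivative of \<open>(Gf w\<^sup>2 - w\<^sub>x\<^sup>2)/2\<close>, and \<open>DD\<close> is the quadratic form \<open>D\<close>.\<close>

definition ew where "ew \<sigma> x = exp (\<sigma> * \<psi> x)"
definition wf where "wf \<sigma> V x = ew \<sigma> x * V x"
definition zf where "zf \<sigma> V Vx x = ew \<sigma> x * (Vx x + \<sigma> * d1 * (r x * V x))"
definition wtf where "wtf \<sigma> \<tau> V U x = ew \<sigma> x * (U x + \<tau> * (\<psi> x * V x))"
definition zxf where "zxf \<sigma> V Vx Vxx x = ew \<sigma> x * (Vxx x + 2 * \<sigma> * d1 * r x * Vx x
  + \<sigma> * d1 * (q x / a x) * V x + (\<sigma> * d1 * r x)\<^sup>2 * V x)"
definition ztf where "ztf \<sigma> \<tau> V Vx U Ux x = ew \<sigma> x * (Ux x + \<sigma> * d1 * (r x * U x) + \<tau> * d1 * (r x * V x)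
  + \<tau> * \<psi> x * (Vx x + \<sigma> * d1 * (r x * V x)))"
definition Gf where "Gf \<sigma> \<tau> x = (\<sigma> * d1 * r x)\<^sup>2 - \<tau> * \<psi> x / a x"
definition Lp where "Lp \<sigma> \<tau> V Vx Vxx x = zxf \<sigma> V Vx Vxx x + Gf \<sigma> \<tau> x * wf \<sigma> V x"
definition Lm where "Lm \<sigma> \<tau> V Vx U x = wtf \<sigma> \<tau> V U x - 2 * \<sigma> * d1 * p x * zf \<sigma> V Vx x - \<sigma> * d1 * q x * wf \<sigma> V x"
definition Pt where "Pt \<sigma> \<tau> \<upsilon> V Vx U Ux x = - (zf \<sigma> V Vx x * ztf \<sigma> \<tau> V Vx U Ux x)
  + (2 * \<sigma> * \<tau> * (d1 * r x)\<^sup>2 - \<upsilon> * \<psi> x / a x) * (wf \<sigma> V x)\<^sup>2 / 2 + Gf \<sigma> \<tau> x * wf \<sigma> V x * wtf \<sigma> \<tau> V U x"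
definition DD where "DD \<sigma> \<tau> \<upsilon> w z x = \<sigma> * d1 * (pd x + q x) * (z x)\<^sup>2 + \<sigma> * d1 * qd x * (w x * z x)
  + (\<sigma> * d1) ^ 3 * (pd x + q x) * (r x * w x)\<^sup>2 - 2 * \<sigma> * \<tau> * d1\<^sup>2 * (r x * w x)\<^sup>2 + \<upsilon> * \<psi> x * ((w x)\<^sup>2 / a x) / 2"

text \<open>In \<open>a * Lp + Lm\<close> all terms with derivatives of the weight cancel, which
  leaves \<open>ew * (U + a Vxx)\<close>. The rest is \<open>4 X Y \<le> (X + Y)^2\<close> with
  \<open>X = a Lp\<close> and \<open>Y = Lm\<close>, divided by \<open>a\<close>.\<close>

lemma Lp_Lm_le: "a x > 0 \<Longrightarrow> 4 * (Lp \<sigma> \<tau> V Vx Vxx x * Lm \<sigma> \<tau> V Vx U x) \<le> (ew \<sigma> x * (U x + a x * Vxx x))\<^sup>2 / a x"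
proof -
  assume ax: "a x > 0"
  have "p x = a x * r x" using ax by (simp add: r_def)
  hence "ew \<sigma> x * (U x + a x * Vxx x) = a x * Lp \<sigma> \<tau> V Vx Vxx x + Lm \<sigma> \<tau> V Vx U x"
    using ax unfolding Lp_def Lm_def zxf_def Gf_def wf_def wtf_def zf_def
    by (simp add: algebra_simps power2_eq_square)
  moreover have "4 * (X * Y) \<le> (c * X + Y)\<^sup>2 / c" if "c > 0" for c X Y :: real
  proof -
    have "4 * (X * Y) * c \<le> (c * X + Y)\<^sup>2"
      using zero_le_power2[of "c * X - Y"] by (simp add: power2_eq_square algebra_simps)
    thus ?thesis using that by (simp add: pos_le_divide_eq)
  qed
  ultimately show ?thesis using ax by simp
qed

lemma ew_ac:
  assumes ab: "0 < \<alpha>" "\<alpha> \<le> \<beta>" "\<beta> < 1" "x0 \<notin> {\<alpha>..\<beta>}"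
  shows "ac_on \<alpha> \<beta> (ew \<sigma>) (\<lambda>x. \<sigma> * d1 * r x * ew \<sigma> x)"
proof (rule ac_on_C1)
  fix x assume x: "\<alpha> \<le> x" "x \<le> \<beta>"
  have "(ew \<sigma> has_real_derivative \<sigma> * d1 * r x * ew \<sigma> x) (at x)"
    unfolding ew_def[abs_def] by (rule derivative_eq_intros psi_deriv refl)+ (use x ab in \<open>auto\<close>)
  thus "(ew \<sigma> has_real_derivative \<sigma> * d1 * r x * ew \<sigma> x) (at x within {\<alpha>..\<beta>})"
    by (rule has_field_derivative_at_within)
next
  show "continuous_on {\<alpha>..\<beta>} (\<lambda>x. \<sigma> * d1 * r x * ew \<sigma> x)" unfolding ew_def[abs_def]
    by (intro continuous_intros continuous_on_subset[OF r_cont_punctured] continuous_on_subset[OF psi_cont]) (use ab in auto)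
qed

lemma r_ac:
  assumes ab: "0 < \<alpha>" "\<alpha> \<le> \<beta>" "\<beta> < 1" "x0 \<notin> {\<alpha>..\<beta>}"
  shows "ac_on \<alpha> \<beta> r (\<lambda>x. q x / a x)"
proof (rule ac_on_C1)
  fix x assume x: "\<alpha> \<le> x" "x \<le> \<beta>"
  show "(r has_real_derivative q x / a x) (at x within {\<alpha>..\<beta>})"
    by (rule has_field_derivative_at_within[OF r_deriv]) (use x ab in auto)
next
  have "continuous_on ({0..1} - {x0}) (\<lambda>x. q x / a x)"
    by (intro div_a_cont continuous_on_subset[OF q_cont]) auto
  thus "continuous_on {\<alpha>..\<beta>} (\<lambda>x. q x / a x)" by (rule continuous_on_subset) (use ab in auto)
qed

lemma p_ac: "ac_on \<alpha> \<beta> p pd"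
  by (rule ac_on_C1[OF has_field_derivative_at_within[OF p_deriv] pd_cont])

lemma wf_ac_local:
  assumes ab: "0 < \<alpha>" "\<alpha> \<le> \<beta>" "\<beta> < 1" "x0 \<notin> {\<alpha>..\<beta>}" and V: "ac_on 0 1 V Vx"
  shows "ac_on \<alpha> \<beta> (wf \<sigma> V) (zf \<sigma> V Vx)"
proof -
  have "ac_on \<alpha> \<beta> (\<lambda>x. ew \<sigma> x * V x) (\<lambda>x. (\<sigma> * d1 * r x * ew \<sigma> x) * V x + ew \<sigma> x * Vx x)"
    by (rule ac_on_mult[OF ew_ac[OF ab] ac_on_subset[OF V]]) (use ab in auto)
  moreover have "(\<lambda>x. (\<sigma> * d1 * r x * ew \<sigma> x) * V x + ew \<sigma> x * Vx x) = zf \<sigma> V Vx"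
    by (auto simp: zf_def algebra_simps)
  ultimately show ?thesis by (simp add: wf_def[abs_def])
qed

text \<open>Off \<open>x0\<close> every ingredient of the flux is absolutely continuous.
  \<open>\<upsilon>\<close> occurs only on the right, where it cancels: the time derivative of
  \<open>Gf\<close> puts a term with \<open>\<Theta>''\<close> into \<open>Pt\<close>, and
  \<open>DD\<close> compensates it.\<close>

lemma flux_ac:
  assumes ab: "0 < \<alpha>" "\<alpha> \<le> \<beta>" "\<beta> < 1" "x0 \<notin> {\<alpha>..\<beta>}"
    and V: "ac_on 0 1 V Vx" and Vx: "ac_on 0 1 Vx Vxx" and U: "ac_on 0 1 U Ux"
  shows "ac_on \<alpha> \<beta> (\<lambda>x. zf \<sigma> V Vx x * wtf \<sigma> \<tau> V U x - \<sigma> * d1 * (p x * (zf \<sigma> V Vx x * zf \<sigma> V Vx x))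
      - \<sigma> * d1 * (q x * (wf \<sigma> V x * zf \<sigma> V Vx x))
      - \<sigma> * d1 * ((\<sigma>\<^sup>2 * d1\<^sup>2 * (p x * (r x * r x)) - \<tau> * (\<psi> x * r x)) * (wf \<sigma> V x * wf \<sigma> V x)))
    (\<lambda>x. Lp \<sigma> \<tau> V Vx Vxx x * Lm \<sigma> \<tau> V Vx U x - Pt \<sigma> \<tau> \<upsilon> V Vx U Ux x - DD \<sigma> \<tau> \<upsilon> (wf \<sigma> V) (zf \<sigma> V Vx) x)"
proof -
  have sub: "ac_on 0 1 f f' \<Longrightarrow> ac_on \<alpha> \<beta> f f'" for f f' by (erule ac_on_subset) (use ab in auto)
  note e = ew_ac[OF ab] and r = r_ac[OF ab] and w = wf_ac_local[OF ab V]
  have "ac_on \<alpha> \<beta> (\<lambda>x. ew \<sigma> x * (Vx x + \<sigma> * d1 * (r x * V x)))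
      (\<lambda>x. (\<sigma> * d1 * r x * ew \<sigma> x) * (Vx x + \<sigma> * d1 * (r x * V x)) + ew \<sigma> x * (Vxx x + \<sigma> * d1 * (q x / a x * V x + r x * Vx x)))"
    by (intro ac_on_mult ac_on_add ac_on_cmult e r sub[OF V] sub[OF Vx])
  moreover have "(\<lambda>x. (\<sigma> * d1 * r x * ew \<sigma> x) * (Vx x + \<sigma> * d1 * (r x * V x)) + ew \<sigma> x * (Vxx x + \<sigma> * d1 * (q x / a x * V x + r x * Vx x)))
     = zxf \<sigma> V Vx Vxx"
    by (auto simp: zxf_def algebra_simps power2_eq_square fun_eq_iff)
  ultimately have z: "ac_on \<alpha> \<beta> (zf \<sigma> V Vx) (zxf \<sigma> V Vx Vxx)" by (simp add: zf_def[abs_def])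
  have "ac_on \<alpha> \<beta> (\<lambda>x. ew \<sigma> x * (U x + \<tau> * (\<psi> x * V x)))
      (\<lambda>x. (\<sigma> * d1 * r x * ew \<sigma> x) * (U x + \<tau> * (\<psi> x * V x)) + ew \<sigma> x * (Ux x + \<tau> * (d1 * r x * V x + \<psi> x * Vx x)))"
    by (intro ac_on_mult ac_on_add ac_on_cmult e sub[OF psi_ac] sub[OF V] sub[OF U])
  moreover have "(\<lambda>x. (\<sigma> * d1 * r x * ew \<sigma> x) * (U x + \<tau> * (\<psi> x * V x)) + ew \<sigma> x * (Ux x + \<tau> * (d1 * r x * V x + \<psi> x * Vx x)))
     = ztf \<sigma> \<tau> V Vx U Ux"
    by (auto simp: ztf_def algebra_simps fun_eq_iff)
  ultimately have wt: "ac_on \<alpha> \<beta> (wtf \<sigma> \<tau> V U) (ztf \<sigma> \<tau> V Vx U Ux)" by (simp add: wtf_def[abs_def])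
  define F' where "F' x = (zxf \<sigma> V Vx Vxx x * wtf \<sigma> \<tau> V U x + zf \<sigma> V Vx x * ztf \<sigma> \<tau> V Vx U Ux x)
     - \<sigma> * d1 * (pd x * (zf \<sigma> V Vx x * zf \<sigma> V Vx x) + p x * (zxf \<sigma> V Vx Vxx x * zf \<sigma> V Vx x + zf \<sigma> V Vx x * zxf \<sigma> V Vx Vxx x))
     - \<sigma> * d1 * (qd x * (wf \<sigma> V x * zf \<sigma> V Vx x) + q x * (zf \<sigma> V Vx x * zf \<sigma> V Vx x + wf \<sigma> V x * zxf \<sigma> V Vx Vxx x))
     - \<sigma> * d1 * ((\<sigma>\<^sup>2 * d1\<^sup>2 * (pd x * (r x * r x) + p x * ((q x / a x) * r x + r x * (q x / a x))) - \<tau> * (d1 * r x * r x + \<psi> x * (q x / a x))) * (wf \<sigma> V x * wf \<sigma> V x)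
        + (\<sigma>\<^sup>2 * d1\<^sup>2 * (p x * (r x * r x)) - \<tau> * (\<psi> x * r x)) * (zf \<sigma> V Vx x * wf \<sigma> V x + wf \<sigma> V x * zf \<sigma> V Vx x))" for x
  have "ac_on \<alpha> \<beta> (\<lambda>x. zf \<sigma> V Vx x * wtf \<sigma> \<tau> V U x - \<sigma> * d1 * (p x * (zf \<sigma> V Vx x * zf \<sigma> V Vx x))
      - \<sigma> * d1 * (q x * (wf \<sigma> V x * zf \<sigma> V Vx x))
      - \<sigma> * d1 * ((\<sigma>\<^sup>2 * d1\<^sup>2 * (p x * (r x * r x)) - \<tau> * (\<psi> x * r x)) * (wf \<sigma> V x * wf \<sigma> V x))) F'"
    unfolding F'_def[abs_def]

    by (intro ac_on_mult ac_on_add ac_on_diff ac_on_cmult p_ac r z wt w sub[OF q_ac] sub[OF psi_ac])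
  moreover have "F' = (\<lambda>x. Lp \<sigma> \<tau> V Vx Vxx x * Lm \<sigma> \<tau> V Vx U x - Pt \<sigma> \<tau> \<upsilon> V Vx U Ux x - DD \<sigma> \<tau> \<upsilon> (wf \<sigma> V) (zf \<sigma> V Vx) x)"
  proof
    fix x
    have ra: "r x = p x * inverse (a x)" by (simp add: r_def divide_inverse)
    show "F' x = Lp \<sigma> \<tau> V Vx Vxx x * Lm \<sigma> \<tau> V Vx U x - Pt \<sigma> \<tau> \<upsilon> V Vx U Ux x - DD \<sigma> \<tau> \<upsilon> (wf \<sigma> V) (zf \<sigma> V Vx) x"
      unfolding F'_def Lp_def Lm_def Pt_def DD_def Gf_def
      using flux_identity[OF ra, of "zxf \<sigma> V Vx Vxx x" "wtf \<sigma> \<tau> V U x" "zf \<sigma> V Vx x" "ztf \<sigma> \<tau> V Vx U Ux x"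
         \<sigma> d1 "pd x" "qd x" "wf \<sigma> V x" "q x" \<tau> "\<psi> x" \<upsilon>]
      by (simp only: divide_inverse)
  qed
  ultimately show ?thesis by simp
qed

lemma ew_cont: "continuous_on {0..1} (ew \<sigma>)"
  unfolding ew_def[abs_def] by (intro continuous_intros psi_cont)

lemma zf_cont:
  assumes V: "ac_on 0 1 V Vx" and c: "continuous_on {0..1} Vx" and i: "integrable (IM 0 1) (\<lambda>x. (V x)\<^sup>2 / a x)"
  shows "continuous_on {0..1} (zf \<sigma> V Vx)"
  unfolding zf_def[abs_def] by (intro continuous_intros ew_cont c rV_cont[OF V c i])

lemma wf_ac:
  assumes V: "ac_on 0 1 V Vx" and c: "continuous_on {0..1} Vx" and i: "integrable (IM 0 1) (\<lambda>x. (V x)\<^sup>2 / a x)"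
  shows "ac_on 0 1 (wf \<sigma> V) (zf \<sigma> V Vx)"
proof (rule ac_on_punctured[OF x0])
  show "continuous_on {0..1} (wf \<sigma> V)" unfolding wf_def[abs_def]
    by (intro continuous_intros ew_cont ac_on_continuous[OF V])
  show "set_integrable lborel {0..1} (zf \<sigma> V Vx)"
    by (rule borel_integrable_atLeastAtMost'[OF zf_cont[OF assms]])
qed (rule wf_ac_local[OF _ _ _ _ V])

text \<open>At the end points \<open>w\<close> and \<open>w_t\<close> vanish, so of the flux only
  the term in \<open>p w_x^2\<close> survives, with \<open>w_x = e^{s\<phi>} v_x\<close>.\<close>

lemma carleman_identity_1d:
  assumes V: "ac_on 0 1 V Vx" and Vx: "ac_on 0 1 Vx Vxx" and U: "ac_on 0 1 U Ux"
    and i: "integrable (IM 0 1) (\<lambda>x. (V x)\<^sup>2 / a x)"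
    and bc: "V 0 = 0" "V 1 = 0" "U 0 = 0" "U 1 = 0"
    and int: "integrable (IM 0 1) (\<lambda>x. Lp \<sigma> \<tau> V Vx Vxx x * Lm \<sigma> \<tau> V Vx U x - Pt \<sigma> \<tau> \<upsilon> V Vx U Ux x - DD \<sigma> \<tau> \<upsilon> (wf \<sigma> V) (zf \<sigma> V Vx) x)"
  shows "(\<integral>x. Lp \<sigma> \<tau> V Vx Vxx x * Lm \<sigma> \<tau> V Vx U x - Pt \<sigma> \<tau> \<upsilon> V Vx U Ux x - DD \<sigma> \<tau> \<upsilon> (wf \<sigma> V) (zf \<sigma> V Vx) x \<partial>IM 0 1)
    = - (\<sigma> * d1 * (p 1 * (ew \<sigma> 1 * Vx 1)\<^sup>2 - p 0 * (ew \<sigma> 0 * Vx 0)\<^sup>2))"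
proof -
  let ?F = "\<lambda>x. zf \<sigma> V Vx x * wtf \<sigma> \<tau> V U x - \<sigma> * d1 * (p x * (zf \<sigma> V Vx x * zf \<sigma> V Vx x))
      - \<sigma> * d1 * (q x * (wf \<sigma> V x * zf \<sigma> V Vx x))
      - \<sigma> * d1 * ((\<sigma>\<^sup>2 * d1\<^sup>2 * (p x * (r x * r x)) - \<tau> * (\<psi> x * r x)) * (wf \<sigma> V x * wf \<sigma> V x))"
  let ?F' = "\<lambda>x. Lp \<sigma> \<tau> V Vx Vxx x * Lm \<sigma> \<tau> V Vx U x - Pt \<sigma> \<tau> \<upsilon> V Vx U Ux x - DD \<sigma> \<tau> \<upsilon> (wf \<sigma> V) (zf \<sigma> V Vx) x"
  note c = ac_on_continuous[OF Vx]
  have "ac_on 0 1 ?F ?F'"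
  proof (rule ac_on_punctured[OF x0])
    \<comment> \<open>Every \<open>r\<close> in the flux comes with a factor \<open>V\<close>;
      grouping them as \<open>r V\<close> shows continuity at \<open>x0\<close>, where
      \<open>r\<close> alone may blow up.\<close>
    define g where "g x = r x * V x" for x
    have gc: "continuous_on {0..1} g" unfolding g_def[abs_def] by (rule rV_cont[OF V c i])
    have wc: "continuous_on {0..1} (wf \<sigma> V)" by (rule ac_on_continuous[OF wf_ac[OF V c i]])
    have wtc: "continuous_on {0..1} (wtf \<sigma> \<tau> V U)" unfolding wtf_def[abs_def]
      by (intro continuous_on_mult continuous_on_add continuous_on_const ew_cont psi_cont ac_on_continuous[OF V] ac_on_continuous[OF U])
    have eq: "?F = (\<lambda>x. zf \<sigma> V Vx x * wtf \<sigma> \<tau> V U x - \<sigma> * d1 * (p x * (zf \<sigma> V Vx x * zf \<sigma> V Vx x))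
      - \<sigma> * d1 * (q x * (wf \<sigma> V x * zf \<sigma> V Vx x))
      - \<sigma> * d1 * (\<sigma>\<^sup>2 * d1\<^sup>2 * (p x * (g x * g x)) - \<tau> * (\<psi> x * g x * V x)) * (ew \<sigma> x * ew \<sigma> x))"
      by (auto simp: wf_def g_def algebra_simps)
    show "continuous_on {0..1} ?F"
      unfolding eq
      by (intro continuous_on_mult continuous_on_add continuous_on_diff continuous_on_const zf_cont[OF V c i] ew_cont gc wc wtc p_cont q_cont psi_cont
          ac_on_continuous[OF V] ac_on_continuous[OF U])

    show "set_integrable lborel {0..1} ?F'" using int by (simp add: integrable_IM)
  qed (rule flux_ac[OF _ _ _ _ V Vx U])
  from ac_onD(2)[OF this, of 0 1] show ?thesis
    using bc by (simp add: integral_IM zf_def wtf_def wf_def power2_eq_square algebra_simps)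
qed

end

section \<open>Coercivity\<close>

definition Theta' :: "real \<Rightarrow> real \<Rightarrow> real" where "Theta' T t = - 4 * (T - 2 * t) / (t * (T - t)) ^ 5"
definition Theta'' :: "real \<Rightarrow> real \<Rightarrow> real" where
  "Theta'' T t = 8 / (t * (T - t)) ^ 5 + 20 * (T - 2 * t)\<^sup>2 / (t * (T - t)) ^ 6"

lemma Theta_deriv: "0 < t \<Longrightarrow> t < T \<Longrightarrow> (Theta T has_real_derivative Theta' T t) (at t)"
proof -
  assume t: "0 < t" "t < T"
  have n: "t * (T - t) \<noteq> 0" using t by simp
  have d: "((\<lambda>t. t * (T - t)) has_real_derivative T - 2 * t) (at t)" by (auto intro!: derivative_eq_intros)
  have "((\<lambda>t. 1 / (t * (T - t)) ^ 4) has_real_derivative (0 * (t * (T - t)) ^ 4 - 1 * (real 4 * ((T - 2 * t) * (t * (T - t)) ^ (4 - Suc 0)))) / ((t * (T - t)) ^ 4 * (t * (T - t)) ^ 4)) (at t)"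
    using n by (intro DERIV_divide DERIV_power d DERIV_const) auto
  also have "(0 * (t * (T - t)) ^ 4 - 1 * (real 4 * ((T - 2 * t) * (t * (T - t)) ^ (4 - Suc 0)))) / ((t * (T - t)) ^ 4 * (t * (T - t)) ^ 4) = Theta' T t"
  proof -
    have "(0 * y ^ 4 - 1 * (real 4 * (d * y ^ (4 - Suc 0)))) / (y ^ 4 * y ^ 4) = - 4 * d / y ^ 5" if "y \<noteq> 0" for y d :: real
      using that by (simp add: divide_simps eval_nat_numeral)
    from this[OF n] show ?thesis unfolding Theta'_def .
  qed
  finally show ?thesis by (simp add: Theta_def[abs_def])
qed

lemma Theta'_deriv: "0 < t \<Longrightarrow> t < T \<Longrightarrow> (Theta' T has_real_derivative Theta'' T t) (at t)"
proof -
  assume t: "0 < t" "t < T"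
  have n: "t * (T - t) \<noteq> 0" using t by simp
  have d: "((\<lambda>t. t * (T - t)) has_real_derivative T - 2 * t) (at t)" by (auto intro!: derivative_eq_intros)
  have d': "((\<lambda>t. - 4 * (T - 2 * t)) has_real_derivative 8) (at t)" by (auto intro!: derivative_eq_intros)
  have "((\<lambda>t. - 4 * (T - 2 * t) / (t * (T - t)) ^ 5) has_real_derivative (8 * (t * (T - t)) ^ 5 - (- 4 * (T - 2 * t)) * (real 5 * ((T - 2 * t) * (t * (T - t)) ^ (5 - Suc 0)))) / ((t * (T - t)) ^ 5 * (t * (T - t)) ^ 5)) (at t)"
    using n by (intro DERIV_divide DERIV_power d d') auto
  also have "(8 * (t * (T - t)) ^ 5 - (- 4 * (T - 2 * t)) * (real 5 * ((T - 2 * t) * (t * (T - t)) ^ (5 - Suc 0)))) / ((t * (T - t)) ^ 5 * (t * (T - t)) ^ 5) = Theta'' T t"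
  proof -
    have "(8 * y ^ 5 - (- 4 * d) * (real 5 * (d * y ^ (5 - Suc 0)))) / (y ^ 5 * y ^ 5) = 8 / y ^ 5 + 20 * d\<^sup>2 / y ^ 6" if "y \<noteq> 0" for y d :: real
      using that by (simp add: divide_simps) (simp add: eval_nat_numeral algebra_simps)
    from this[OF n] show ?thesis unfolding Theta''_def .
  qed
  finally show ?thesis by (simp add: Theta'_def[abs_def])
qed

lemma Theta''_cont: "continuous_on {0<..<T} (Theta'' T)"
  unfolding Theta''_def[abs_def] by (intro continuous_intros) auto

lemma Theta_cont: "continuous_on {0<..<T} (Theta T)" and Theta'_cont: "continuous_on {0<..<T} (Theta' T)"
  by (rule continuous_at_imp_continuous_on, use Theta_deriv Theta'_deriv DERIV_isCont in fastforce)+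

lemma tau_bounds: fixes t T :: real shows "0 < t \<Longrightarrow> t < T \<Longrightarrow> 0 < t * (T - t) \<and> t * (T - t) \<le> T\<^sup>2 / 4"
  using zero_le_power2[of "T - 2 * t"] by (simp add: power2_eq_square algebra_simps)

lemma Theta_pos: "0 < t \<Longrightarrow> t < T \<Longrightarrow> Theta T t > 0"
  using tau_bounds[of t T] by (simp add: Theta_def)

lemma Theta_lower: "0 < t \<Longrightarrow> t < T \<Longrightarrow> (4 / T\<^sup>2) ^ 4 \<le> Theta T t"
proof -
  assume t: "0 < t" "t < T"
  have "1 / (T\<^sup>2 / 4) ^ 4 \<le> 1 / (t * (T - t)) ^ 4"
    by (rule divide_left_mono) (use tau_bounds[OF t] t in \<open>auto intro!: power_mono\<close>)
  thus ?thesis by (simp add: Theta_def power_divide)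
qed

text \<open>Put \<open>y = t (T - t) \<le> T^2/4\<close>, so that \<open>\<Theta>^2 = 1/y^8\<close>.
  Relative to \<open>\<Theta>^2\<close>, the two derivatives are at most \<open>4 T y^3\<close> and
  \<open>8 y^3 + 20 T^2 y^2\<close>; the constant is the sum of the bounds for both. Comparison with
  \<open>\<Theta>^2\<close> is what gives \<open>s \<Theta>'\<close> and \<open>s \<Theta>''\<close>
  the size \<open>\<sigma>^2/s\<close>.\<close>

definition cTheta :: "real \<Rightarrow> real" where
  "cTheta T = 4 * T * (T\<^sup>2 / 4) ^ 3 + 8 * (T\<^sup>2 / 4) ^ 3 + 20 * T\<^sup>2 * (T\<^sup>2 / 4) ^ 2"

lemma Theta_derivs_bound:
  assumes t: "0 < t" "t < T"
  shows "\<bar>Theta' T t\<bar> \<le> cTheta T * (Theta T t)\<^sup>2" "\<bar>Theta'' T t\<bar> \<le> cTheta T * (Theta T t)\<^sup>2"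
proof -
  define y where "y = t * (T - t)"
  have y: "0 < y" "y \<le> T\<^sup>2 / 4" using tau_bounds[OF t] by (auto simp: y_def)
  have d: "\<bar>T - 2 * t\<bar> \<le> T" using t by auto
  have d2: "(T - 2 * t)\<^sup>2 \<le> T\<^sup>2" using d by (simp add: abs_le_square_iff[symmetric])
  have T: "T > 0" using t by simp
  have y3: "y ^ 3 \<le> (T\<^sup>2 / 4) ^ 3" "y ^ 2 \<le> (T\<^sup>2 / 4) ^ 2" using y by (auto intro!: power_mono simp del: power_divide)
  have th: "(Theta T t)\<^sup>2 = 1 / y ^ 8" unfolding Theta_def y_def[symmetric]
    by (simp add: power_one_over flip: power_mult)
  have "\<bar>Theta' T t\<bar> = 4 * \<bar>T - 2 * t\<bar> * y ^ 3 / y ^ 8"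
  proof -
    have "\<bar>- 4 * d / y ^ 5\<bar> = 4 * \<bar>d\<bar> * y ^ 3 / y ^ 8" for d
      using y by (simp add: abs_mult divide_simps eval_nat_numeral)
    thus ?thesis unfolding Theta'_def y_def[symmetric] by blast
  qed
  also have "\<dots> \<le> 4 * T * (T\<^sup>2 / 4) ^ 3 / y ^ 8"
    using y3 d T y by (intro divide_right_mono mult_mono) auto
  also have "\<dots> \<le> cTheta T / y ^ 8"
    using y T by (intro divide_right_mono) (auto simp: cTheta_def)
  finally show "\<bar>Theta' T t\<bar> \<le> cTheta T * (Theta T t)\<^sup>2" by (simp add: th)
  have "\<bar>Theta'' T t\<bar> = (8 * y ^ 3 + 20 * (T - 2 * t)\<^sup>2 * y ^ 2) / y ^ 8"
  proof -
    have "8 / y ^ 5 + 20 * (T - 2 * t)\<^sup>2 / y ^ 6 = (8 * y ^ 3 + 20 * (T - 2 * t)\<^sup>2 * y ^ 2) / y ^ 8"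
      using y by (simp add: divide_simps) (simp add: eval_nat_numeral algebra_simps)
    moreover have "8 / y ^ 5 + 20 * (T - 2 * t)\<^sup>2 / y ^ 6 \<ge> 0" using y by simp
    ultimately show ?thesis unfolding Theta''_def y_def[symmetric] by (metis abs_of_nonneg)

  qed
  also have "\<dots> \<le> (8 * (T\<^sup>2 / 4) ^ 3 + 20 * T\<^sup>2 * (T\<^sup>2 / 4) ^ 2) / y ^ 8"
    using y3 d2 y by (intro divide_right_mono add_mono mult_mono) auto
  also have "\<dots> \<le> cTheta T / y ^ 8"
    using y T by (intro divide_right_mono) (auto simp: cTheta_def)
  finally show "\<bar>Theta'' T t\<bar> \<le> cTheta T * (Theta T t)\<^sup>2" by (simp add: th)
qed

lemma Theta_at_top:
  assumes T: "T > 0" shows "filterlim (Theta T) at_top (at_right 0)" "filterlim (Theta T) at_top (at_left T)"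
proof -
  have 1: "((\<lambda>t. (t * (T - t)) ^ 4) \<longlongrightarrow> (0 * (T - 0)) ^ 4) (at_right 0)" by (intro tendsto_intros)
  have 2: "((\<lambda>t. (t * (T - t)) ^ 4) \<longlongrightarrow> (T * (T - T)) ^ 4) (at_left T)" by (intro tendsto_intros)
  have e1: "\<forall>\<^sub>F t in at_right 0. 0 < (t * (T - t)) ^ 4"
    unfolding eventually_at_right_field using T by (auto intro!: exI[of _ T])
  have e2: "\<forall>\<^sub>F t in at_left T. 0 < (t * (T - t)) ^ 4"
    unfolding eventually_at_left_field using T by (auto intro!: exI[of _ 0])
  have f: "filterlim (\<lambda>t. inverse ((t * (T - t)) ^ 4)) at_top F"
    if "((\<lambda>t. (t * (T - t)) ^ 4) \<longlongrightarrow> 0) F" "\<forall>\<^sub>F t in F. 0 < (t * (T - t)) ^ 4" for F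
    by (rule filterlim_inverse_at_top[OF that])
  show "filterlim (Theta T) at_top (at_right 0)" "filterlim (Theta T) at_top (at_left T)"
    using f[OF _ e1] f[OF _ e2] 1 2 by (auto simp: Theta_def[abs_def] inverse_eq_divide)
qed

section \<open>Lower bound for the quadratic form\<close>

context carleman_weight begin

lemma qd_bounded: obtains B where "B > 0" "\<And>x. x \<in> {0..1} \<Longrightarrow> \<bar>qd x\<bar> \<le> B"
proof -
  have "continuous_on {0..1} (\<lambda>x. E x * (6 * R * (x - x0) + 4 * R\<^sup>2 * (x - x0) ^ 3) - 2 * R * (x - x0) * E x * b x)"
    by (intro continuous_intros E_cont b_cont)
  then obtain B where B: "B > 0" "\<And>x. x \<in> {0..1} \<Longrightarrow> \<bar>E x * (6 * R * (x - x0) + 4 * R\<^sup>2 * (x - x0) ^ 3) - 2 * R * (x - x0) * E x * b x\<bar> \<le> B"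
    using continuous_bounded01 by blast
  have "\<bar>qd x\<bar> \<le> B + exp R * M" if x: "x \<in> {0..1}" for x
  proof -
    have "\<bar>E x * bp x\<bar> \<le> exp R * M"
      unfolding abs_mult using E_le[OF x] E_pos[of x] bp_bound[of x] by (intro mult_mono) auto
    thus ?thesis using B(2)[OF x] unfolding qd_def by linarith
  qed
  moreover have "B + exp R * M > 0" using B bp_bound[of 0] by (intro add_pos_nonneg) auto
  ultimately show ?thesis using that by blast
qed

text \<open>The estimate at one time, isolated because it depends on \<open>Theta\<close> only
  through the sizes of the three coefficients.\<close>

definition coercive_form where
  "coercive_form k \<sigma> \<tau> \<upsilon> \<longleftrightarrow> (\<forall>w z. ac_on 0 1 w z \<longrightarrow> continuous_on {0..1} z \<longrightarrow> w 0 = 0 \<longrightarrow> w 1 = 0 \<longrightarrow>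
     integrable (IM 0 1) (\<lambda>x. (w x)\<^sup>2 / a x) \<longrightarrow> integrable (IM 0 1) (\<lambda>x. (r x * w x)\<^sup>2) \<longrightarrow>
     integrable (IM 0 1) (DD \<sigma> \<tau> \<upsilon> w z) \<longrightarrow>
     k * (\<sigma> * (\<integral>x. (z x)\<^sup>2 \<partial>IM 0 1) + \<sigma> ^ 3 * (\<integral>x. (r x * w x)\<^sup>2 \<partial>IM 0 1)) \<le> (\<integral>x. DD \<sigma> \<tau> \<upsilon> w z x \<partial>IM 0 1))"

text \<open>The leading coefficients are positive by \<open>pq\<close>. Half of the
  \<open>z^2\<close> term absorbs the mixed term with \<open>qd\<close> up to a multiple of
  \<open>w^2/a\<close>. That multiple and the terms with \<open>\<theta>1\<close> and
  \<open>\<theta>2\<close> are, after \<open>weighted_poincare\<close>, at most a constant over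
  \<open>s\<close> times the leading terms.\<close>

lemma coercive:
  assumes c1: "c1 \<ge> 0" and thl: "\<theta>m > 0"
  obtains k s0 where "k > 0" "s0 > 0"
    "\<And>s \<theta> \<theta>1 \<theta>2. s \<ge> s0 \<Longrightarrow> \<theta> \<ge> \<theta>m \<Longrightarrow> \<bar>\<theta>1\<bar> \<le> c1 * \<theta>\<^sup>2 \<Longrightarrow> \<bar>\<theta>2\<bar> \<le> c1 * \<theta>\<^sup>2 \<Longrightarrow>
      coercive_form k (s * \<theta>) (s * \<theta>1) (s * \<theta>2)"
proof -
  obtain C where C: "C > 0" "\<And>w z \<sigma>. ac_on 0 1 w z \<Longrightarrow> continuous_on {0..1} z \<Longrightarrow> w 0 = 0 \<Longrightarrow> w 1 = 0 \<Longrightarrow> \<sigma> > 0 \<Longrightarrow>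
     integrable (IM 0 1) (\<lambda>x. (w x)\<^sup>2 / a x) \<Longrightarrow> integrable (IM 0 1) (\<lambda>x. (r x * w x)\<^sup>2) \<Longrightarrow>
     \<sigma> * (\<integral>x. (w x)\<^sup>2 / a x \<partial>IM 0 1) \<le> C * ((\<integral>x. (z x)\<^sup>2 \<partial>IM 0 1) + \<sigma>\<^sup>2 * (\<integral>x. (r x * w x)\<^sup>2 \<partial>IM 0 1))"
    using weighted_poincare by blast
  define \<kappa> where "\<kappa> = 2 - K"
  have kap: "\<kappa> > 0" using K by (simp add: \<kappa>_def)
  have pq: "\<kappa> \<le> pd x + q x" if "x \<in> {0..1}" for x
  proof -
    have "0 \<le> 4 * R * (x - x0)\<^sup>2" using R by simp
    hence "2 - K \<le> 2 + 4 * R * (x - x0)\<^sup>2 - b x" using b_le[of x] that by auto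
    hence "1 * (2 - K) \<le> E x * (2 + 4 * R * (x - x0)\<^sup>2 - b x)"
      using E_ge_1[of x] K by (intro mult_mono) auto

    also have "\<dots> = pd x + q x" by (simp add: pd_def q_def algebra_simps)
    finally show ?thesis by (simp add: \<kappa>_def)
  qed
  obtain Bb where Bb: "\<And>x. x \<in> {0..1} \<Longrightarrow> \<bar>b x\<bar> \<le> Bb" using continuous_bounded01[OF b_cont] by blast
  obtain Ps where Ps: "Ps > 0" "\<And>x. x \<in> {0..1} \<Longrightarrow> \<bar>\<psi> x\<bar> \<le> Ps" using continuous_bounded01[OF psi_cont] by blast
  obtain A where A: "A > 0" "\<And>x. x \<in> {0..1} \<Longrightarrow> \<bar>a x\<bar> \<le> A" using continuous_bounded01[OF a_cont] by blast
  obtain Mq where Mq: "Mq > 0" "\<And>x. x \<in> {0..1} \<Longrightarrow> \<bar>qd x\<bar> \<le> Mq" using qd_bounded by blast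
  \<comment> \<open>\<open>\<alpha>\<close> is what Young's inequality leaves of the
    \<open>qd\<close> term, using \<open>w^2 \<le> A w^2/a\<close>; \<open>\<beta>\<close> comes
    from the \<open>\<theta>2\<close> term. They multiply \<open>w^2/a\<close> at the orders
    \<open>\<sigma>\<close> and \<open>\<sigma>^2/s\<close>.\<close>
  define \<alpha> where "\<alpha> = d1 * (Mq\<^sup>2 / (2 * \<kappa>)) * A"
  define \<beta> where "\<beta> = c1 * Ps / 2"
  have ab: "\<alpha> \<ge> 0" "\<beta> \<ge> 0" using d1 kap A Ps c1 by (auto simp: \<alpha>_def \<beta>_def)
  \<comment> \<open>As \<open>\<sigma>/s = \<theta> \<ge> \<theta>m\<close>, a term of order
    \<open>\<sigma>\<close> is at most \<open>1/\<theta>m\<close> times one of order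
    \<open>\<sigma>^2/s\<close>; \<open>C\<close> is the constant of
    \<open>weighted_poincare\<close>.\<close>
  define C5 where "C5 = (\<alpha> / \<theta>m + \<beta>) * C"
  have C5: "C5 \<ge> 0" using ab thl C(1) by (auto simp: C5_def)
  \<comment> \<open>The first entry is halved because the other half of the \<open>z^2\<close>
    coefficient is spent on the mixed term.\<close>
  define k0 where "k0 = min (d1 * \<kappa> / 2) (d1 ^ 3 * \<kappa>)"
  have k0: "k0 > 0" "k0 \<le> d1 * \<kappa> / 2" "k0 \<le> d1 ^ 3 * \<kappa>" using d1 kap by (auto simp: k0_def)
  \<comment> \<open>The added summand accounts for the \<open>\<theta>1\<close> term.\<close>
  define C6 where "C6 = C5 + 2 * c1 * d1\<^sup>2"
  have C6: "C6 \<ge> 0" "C6 \<ge> C5" using C5 c1 by (auto simp: C6_def)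
  show ?thesis
  \<comment> \<open>The threshold makes the error factor \<open>C6 / s\<close> at most
    \<open>k0 / 2\<close>, half of what is available; the summand 1 keeps it positive even if
    \<open>C6 = 0\<close>.\<close>
  proof (rule that[of "k0 / 2" "2 * C6 / k0 + 1"])
    show "k0 / 2 > 0" using k0 by simp
    show "2 * C6 / k0 + 1 > 0" using C6 k0 by (simp add: add_nonneg_pos)
    fix s \<theta> \<theta>1 \<theta>2
    assume s: "s \<ge> 2 * C6 / k0 + 1" and th: "\<theta> \<ge> \<theta>m" and th1: "\<bar>\<theta>1\<bar> \<le> c1 * \<theta>\<^sup>2" and th2: "\<bar>\<theta>2\<bar> \<le> c1 * \<theta>\<^sup>2"
    show "coercive_form (k0 / 2) (s * \<theta>) (s * \<theta>1) (s * \<theta>2)"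
      unfolding coercive_form_def
    proof (intro allI impI)
      fix w z :: "real \<Rightarrow> real"
      assume ac: "ac_on 0 1 w z" and zc: "continuous_on {0..1} z" and w01: "w 0 = 0" "w 1 = 0"
        and i1: "integrable (IM 0 1) (\<lambda>x. (w x)\<^sup>2 / a x)" and i2: "integrable (IM 0 1) (\<lambda>x. (r x * w x)\<^sup>2)"
        and iD: "integrable (IM 0 1) (DD (s * \<theta>) (s * \<theta>1) (s * \<theta>2) w z)"
      have "2 * C6 / k0 \<ge> 0" using C6 k0 by simp
      hence s0: "s > 0" "2 * C6 / k0 \<le> s" using s by auto
      hence sC: "C6 / s \<le> k0 / 2" using k0 by (simp add: field_simps)
      define \<sigma> where "\<sigma> = s * \<theta>"
      have sg: "\<sigma> > 0" "s * \<theta>m \<le> \<sigma>" using s0 th thl by (auto simp: \<sigma>_def)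
      have tau: "\<bar>s * \<theta>1\<bar> \<le> c1 * \<sigma>\<^sup>2 / s" "\<bar>s * \<theta>2\<bar> \<le> c1 * \<sigma>\<^sup>2 / s"
      proof -
        have "c1 * \<sigma>\<^sup>2 / s = s * (c1 * \<theta>\<^sup>2)" using s0 by (simp add: \<sigma>_def power2_eq_square)
        thus "\<bar>s * \<theta>1\<bar> \<le> c1 * \<sigma>\<^sup>2 / s" "\<bar>s * \<theta>2\<bar> \<le> c1 * \<sigma>\<^sup>2 / s" using th1 th2 s0 by (simp_all add: abs_mult)
      qed
      have iz: "integrable (IM 0 1) (\<lambda>x. (z x)\<^sup>2)"
        unfolding integrable_IM by (rule borel_integrable_atLeastAtMost') (intro continuous_intros zc)
      define X where "X = (\<integral>x. (z x)\<^sup>2 \<partial>IM 0 1)"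
      define Y where "Y = (\<integral>x. (r x * w x)\<^sup>2 \<partial>IM 0 1)"
      define Z where "Z = (\<integral>x. (w x)\<^sup>2 / a x \<partial>IM 0 1)"
      have XY: "X \<ge> 0" "Y \<ge> 0" unfolding X_def Y_def by (rule integral_nonneg_AE; simp)+
      have Z: "\<sigma> * Z \<le> C * (X + \<sigma>\<^sup>2 * Y)"
        unfolding X_def Y_def Z_def by (rule C(2)[OF ac zc w01 sg(1) i1 i2])
      let ?cz = "\<sigma> * (d1 * \<kappa> / 2)" and ?cy = "\<sigma> ^ 3 * (d1 ^ 3 * \<kappa> - 2 * c1 * d1\<^sup>2 / s)" and ?cw = "\<sigma> * (\<alpha> + \<beta> * \<sigma> / s)"
      have pw: "?cz * (z x)\<^sup>2 + ?cy * (r x * w x)\<^sup>2 - ?cw * ((w x)\<^sup>2 / a x) \<le> DD (s * \<theta>) (s * \<theta>1) (s * \<theta>2) w z x"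
        if x: "0 < x" "x < 1" "x \<noteq> x0" for x
      proof -
        have x': "x \<in> {0..1}" using x by simp
        have ax: "a x > 0" "a x \<le> A" using a_pos[of x] A(2)[OF x'] x by auto
        let ?W = "(w x)\<^sup>2 / a x" and ?rw = "(r x * w x)\<^sup>2"
        have W: "?W \<ge> 0" using ax by simp
        have 1: "\<sigma> * d1 * \<kappa> * (z x)\<^sup>2 \<le> \<sigma> * d1 * (pd x + q x) * (z x)\<^sup>2"
          using pq[OF x'] sg d1 by (intro mult_right_mono mult_left_mono) auto
        have 2: "(\<sigma> * d1) ^ 3 * \<kappa> * ?rw \<le> (\<sigma> * d1) ^ 3 * (pd x + q x) * ?rw"
          using pq[OF x'] sg d1 by (intro mult_right_mono mult_left_mono) auto
        have 3: "- (\<sigma> * d1 * (\<kappa> / 2 * (z x)\<^sup>2 + Mq\<^sup>2 / (2 * \<kappa>) * A * ?W)) \<le> \<sigma> * d1 * qd x * (w x * z x)"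
        proof -
          have "\<bar>qd x * (w x * z x)\<bar> \<le> Mq * (\<bar>w x\<bar> * \<bar>z x\<bar>)"
            unfolding abs_mult by (intro mult_right_mono Mq x') auto
          \<comment> \<open>Young's inequality with the weights for which \<open>z^2\<close>
            receives \<open>\<kappa> / 2\<close>, half of the coefficient in
            \<open>1\<close>.\<close>
          also have "\<dots> \<le> \<kappa> / 2 * (z x)\<^sup>2 + Mq\<^sup>2 / (2 * \<kappa>) * (w x)\<^sup>2"
          proof -
            have "0 \<le> (\<kappa> * \<bar>z x\<bar> - Mq * \<bar>w x\<bar>)\<^sup>2 / (2 * \<kappa>)" using kap by simp
            also have "\<dots> = \<kappa> / 2 * (z x)\<^sup>2 + Mq\<^sup>2 / (2 * \<kappa>) * (w x)\<^sup>2 - Mq * (\<bar>w x\<bar> * \<bar>z x\<bar>)"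
            proof -
              have "(\<kappa> * P - Mq * Q)\<^sup>2 / (2 * \<kappa>) = \<kappa> / 2 * P\<^sup>2 + Mq\<^sup>2 / (2 * \<kappa>) * Q\<^sup>2 - Mq * (Q * P)" for P Q
                using kap by (simp add: field_simps power2_eq_square)
              from this[of "\<bar>z x\<bar>" "\<bar>w x\<bar>"] show ?thesis by (simp only: power2_abs)
            qed

            finally show ?thesis by simp
          qed
          also have "\<dots> \<le> \<kappa> / 2 * (z x)\<^sup>2 + Mq\<^sup>2 / (2 * \<kappa>) * (A * ?W)"
          proof -
            have "(w x)\<^sup>2 = a x * ?W" using ax by simp
            also have "\<dots> \<le> A * ?W" using ax W by (intro mult_right_mono) auto
            finally show ?thesis using kap by (intro add_left_mono mult_left_mono) auto
          qed
          finally have "\<bar>qd x * (w x * z x)\<bar> \<le> \<kappa> / 2 * (z x)\<^sup>2 + Mq\<^sup>2 / (2 * \<kappa>) * (A * ?W)" .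
          hence "- (\<kappa> / 2 * (z x)\<^sup>2 + Mq\<^sup>2 / (2 * \<kappa>) * A * ?W) \<le> qd x * (w x * z x)" by (simp add: abs_le_iff mult.assoc)
          moreover have "0 \<le> \<sigma> * d1" using sg d1 by simp
          ultimately show ?thesis using mult_left_mono[of _ _ "\<sigma> * d1"] by (simp only: mult_minus_right[symmetric] mult.assoc)

        qed
        have 4: "2 * \<sigma> * (s * \<theta>1) * d1\<^sup>2 * ?rw \<le> 2 * \<sigma> * (c1 * \<sigma>\<^sup>2 / s) * d1\<^sup>2 * ?rw"
          using tau(1) sg by (intro mult_right_mono mult_left_mono) auto
        have 5: "- (c1 * \<sigma>\<^sup>2 / s * Ps * ?W / 2) \<le> (s * \<theta>2) * \<psi> x * ?W / 2"
        proof -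
          have "\<bar>(s * \<theta>2) * \<psi> x * ?W\<bar> \<le> c1 * \<sigma>\<^sup>2 / s * Ps * ?W"
            unfolding abs_mult[of _ ?W] abs_mult[of _ "\<psi> x"]
            using tau(2) Ps(2)[OF x'] Ps(1) W c1 s0 by (intro mult_mono) auto
          moreover have "- (B / 2) \<le> X / 2" if "\<bar>X\<bar> \<le> B" for X B :: real using that by (simp add: abs_le_iff)
          ultimately show ?thesis by blast
        qed
        have e:
   "?cz * (z x)\<^sup>2 + ?cy * ?rw - ?cw * ?W = \<sigma> * d1 * \<kappa> * (z x)\<^sup>2 + (\<sigma> * d1) ^ 3 * \<kappa> * ?rw
           - (\<sigma> * d1 * (\<kappa> / 2 * (z x)\<^sup>2 + Mq\<^sup>2 / (2 * \<kappa>) * A * ?W)) - 2 * \<sigma> * (c1 * \<sigma>\<^sup>2 / s) * d1\<^sup>2 * ?rw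
           - c1 * \<sigma>\<^sup>2 / s * Ps * ?W / 2"
        proof -
          have "\<sigma> * (d1 * \<kappa> / 2) * Z2 + \<sigma> ^ 3 * (d1 ^ 3 * \<kappa> - 2 * c1 * d1\<^sup>2 * si) * rw - \<sigma> * (d1 * mm * A + c1 * Ps / 2 * \<sigma> * si) * W
            = \<sigma> * d1 * \<kappa> * Z2 + (\<sigma> * d1) ^ 3 * \<kappa> * rw - (\<sigma> * d1 * (\<kappa> / 2 * Z2 + mm * A * W))
             - 2 * \<sigma> * (c1 * \<sigma>\<^sup>2 * si) * d1\<^sup>2 * rw - c1 * \<sigma>\<^sup>2 * si * Ps * W / 2" for Z2 rw W si mm
            by (simp add: algebra_simps power2_eq_square power3_eq_cube)
          from this[of "(z x)\<^sup>2" "inverse s" ?rw "Mq\<^sup>2 / (2 * \<kappa>)" ?W] show ?thesis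
            by (simp only: \<alpha>_def \<beta>_def divide_inverse[of _ s])
        qed
        show ?thesis using 1 2 3 4 5 unfolding e DD_def \<sigma>_def[symmetric] by linarith
      qed
      have "(\<integral>x. ?cz * (z x)\<^sup>2 + ?cy * (r x * w x)\<^sup>2 - ?cw * ((w x)\<^sup>2 / a x) \<partial>IM 0 1) \<le> (\<integral>x. DD (s * \<theta>) (s * \<theta>1) (s * \<theta>2) w z x \<partial>IM 0 1)"
      proof (rule integral_mono_AE)
        show "integrable (IM 0 1) (\<lambda>x. ?cz * (z x)\<^sup>2 + ?cy * (r x * w x)\<^sup>2 - ?cw * ((w x)\<^sup>2 / a x))"
          by (intro Bochner_Integration.integrable_diff Bochner_Integration.integrable_add integrable_mult_right iz i1 i2)
        show "integrable (IM 0 1) (DD (s * \<theta>) (s * \<theta>1) (s * \<theta>2) w z)" by (rule iD)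
        show "AE x in IM 0 1. ?cz * (z x)\<^sup>2 + ?cy * (r x * w x)\<^sup>2 - ?cw * ((w x)\<^sup>2 / a x) \<le> DD (s * \<theta>) (s * \<theta>1) (s * \<theta>2) w z x"
          unfolding AE_IM_iff using AE_lborel_singleton[of x0] by eventually_elim (use pw in blast)
      qed
      also have "(\<integral>x. ?cz * (z x)\<^sup>2 + ?cy * (r x * w x)\<^sup>2 - ?cw * ((w x)\<^sup>2 / a x) \<partial>IM 0 1) = ?cz * X + ?cy * Y - ?cw * Z"
      proof -
        have "(\<integral>x. ?cz * (z x)\<^sup>2 + ?cy * (r x * w x)\<^sup>2 - ?cw * ((w x)\<^sup>2 / a x) \<partial>IM 0 1) =
           (\<integral>x. ?cz * (z x)\<^sup>2 + ?cy * (r x * w x)\<^sup>2 \<partial>IM 0 1) - (\<integral>x. ?cw * ((w x)\<^sup>2 / a x) \<partial>IM 0 1)"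
          by (intro Bochner_Integration.integral_diff Bochner_Integration.integrable_add integrable_mult_right iz i1 i2)
        also have "(\<integral>x. ?cz * (z x)\<^sup>2 + ?cy * (r x * w x)\<^sup>2 \<partial>IM 0 1) = (\<integral>x. ?cz * (z x)\<^sup>2 \<partial>IM 0 1) + (\<integral>x. ?cy * (r x * w x)\<^sup>2 \<partial>IM 0 1)"
          by (intro Bochner_Integration.integral_add integrable_mult_right iz i2)
        finally show ?thesis unfolding X_def Y_def Z_def
          by (simp only: Bochner_Integration.integral_mult_right_zero)
      qed
      finally have main: "?cz * X + ?cy * Y - ?cw * Z \<le> (\<integral>x. DD (s * \<theta>) (s * \<theta>1) (s * \<theta>2) w z x \<partial>IM 0 1)" .
      have "?cw * Z = (\<alpha> + \<beta> * \<sigma> / s) * (\<sigma> * Z)" by (simp add: mult_ac)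
      also have "\<dots> \<le> (\<alpha> + \<beta> * \<sigma> / s) * (C * (X + \<sigma>\<^sup>2 * Y))"
        using ab sg s0 by (intro mult_left_mono Z) auto
      also have "\<dots> \<le> ((\<alpha> / \<theta>m + \<beta>) * (\<sigma> / s)) * (C * (X + \<sigma>\<^sup>2 * Y))"
      proof (rule mult_right_mono)
        have "1 \<le> \<sigma> / s / \<theta>m" using sg s0 thl by (simp add: field_simps)
        hence "\<alpha> * 1 \<le> \<alpha> * (\<sigma> / s / \<theta>m)" using ab by (intro mult_left_mono) auto
        thus "\<alpha> + \<beta> * \<sigma> / s \<le> (\<alpha> / \<theta>m + \<beta>) * (\<sigma> / s)" by (simp add: algebra_simps)
        show "0 \<le> C * (X + \<sigma>\<^sup>2 * Y)" using C XY by (intro mult_nonneg_nonneg add_nonneg_nonneg) auto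
      qed
      also have "\<dots> = C5 / s * (\<sigma> * X + \<sigma> ^ 3 * Y)"
      proof -
        have "(k * (\<sigma> * si)) * (C * (X + \<sigma>\<^sup>2 * Y)) = k * C * si * (\<sigma> * X + \<sigma> ^ 3 * Y)" for k si
          by (simp add: algebra_simps power2_eq_square power3_eq_cube)
        thus ?thesis by (simp only: C5_def divide_inverse[of _ s])
      qed
      finally
   have cw: "?cw * Z \<le> C5 / s * (\<sigma> * X + \<sigma> ^ 3 * Y)" .
      have "k0 / 2 * (\<sigma> * X) \<le> (d1 * \<kappa> / 2 - C5 / s) * (\<sigma> * X)"
      proof (rule mult_right_mono)
        have "C5 / s \<le> C6 / s" using C6 s0 by (intro divide_right_mono) auto
        thus "k0 / 2 \<le> d1 * \<kappa> / 2 - C5 / s" using sC k0 by linarith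
      qed (use sg XY in auto)
      moreover have "k0 / 2 * (\<sigma> ^ 3 * Y) \<le> (d1 ^ 3 * \<kappa> - C6 / s) * (\<sigma> ^ 3 * Y)"
      proof (rule mult_right_mono)
        show "k0 / 2 \<le> d1 ^ 3 * \<kappa> - C6 / s" using sC k0 by linarith
      qed (use sg XY in auto)
      moreover have "(d1 ^ 3 * \<kappa> - C6 / s) * (\<sigma> ^ 3 * Y) = ?cy * Y - C5 / s * (\<sigma> ^ 3 * Y)"
        by (simp add: C6_def algebra_simps add_divide_distrib)
      moreover have "?cz * X = d1 * \<kappa> / 2 * (\<sigma> * X)" by simp
      moreover have "k * (A + B) \<le> zX + yY - c * (A + B)"
        if "k * A \<le> (a1 - c) * A" "k * B \<le> E'" "E' = yY - c * B" "zX = a1 * A" for k A B c a1 E' zX yY :: real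
        using that by (simp add: algebra_simps)
      ultimately have "k0 / 2 * (\<sigma> * X + \<sigma> ^ 3 * Y) \<le> ?cz * X + ?cy * Y - C5 / s * (\<sigma> * X + \<sigma> ^ 3 * Y)"
        by blast
      with cw main show "k0 / 2 * (s * \<theta> * (\<integral>x. (z x)\<^sup>2 \<partial>IM 0 1) + (s * \<theta>) ^ 3 * (\<integral>x. (r x * w x)\<^sup>2 \<partial>IM 0 1))
          \<le> (\<integral>x. DD (s * \<theta>) (s * \<theta>1) (s * \<theta>2) w z x \<partial>IM 0 1)"
        unfolding \<sigma>_def[symmetric] X_def[symmetric] Y_def[symmetric] by linarith
    qed
  qed
qed

end

section \<open>Integrability on the space-time cylinder\<close>

lemma AE_Q_space: "AE z in cyl T. 0 < fst z \<and> fst z < T \<and> 0 < snd z \<and> snd z < 1"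
  using AE_space by eventually_elim (auto simp: space_pair_measure)

text \<open>A class stable under the operations that occur: sums and multiplication by
  \<open>\<Theta>\<close>, \<open>\<Theta>'\<close>, \<open>\<Theta>''\<close> or bounded functions.
  It contains \<open>e^{s\<phi>}\<close> times any square integrable function, and the product of
  two members is integrable, so integrability of each term of the identity is a matter of factoring
  it.\<close>

definition rapid :: "real \<Rightarrow> (real \<times> real \<Rightarrow> real) \<Rightarrow> bool" where
  "rapid T f \<longleftrightarrow> f \<in> borel_measurable (cyl T) \<and>
     (\<forall>n. integrable (cyl T) (\<lambda>z. (Theta T (fst z) ^ n * f z)\<^sup>2))"

lemma Theta_meas [measurable]: "Theta T \<in> borel_measurable borel"
  unfolding Theta_def[abs_def] by measurable
lemma Theta'_meas [measurable]: "Theta' T \<in> borel_measurable borel"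
  unfolding Theta'_def[abs_def] by measurable
lemma Theta''_meas [measurable]: "Theta'' T \<in> borel_measurable borel"
  unfolding Theta''_def[abs_def] by measurable

lemma rapid_meas: "rapid T f \<Longrightarrow> f \<in> borel_measurable (cyl T)"
  by (simp add: rapid_def)

lemma rapidD: "rapid T f \<Longrightarrow> integrable (cyl T) (\<lambda>z. (Theta T (fst z) ^ n * f z)\<^sup>2)"
  by (simp add: rapid_def)

lemma rapid_cong_AE:
  assumes "rapid T f" "g \<in> borel_measurable (cyl T)" "AE z in cyl T. f z = g z"
  shows "rapid T g"
  unfolding rapid_def
proof (intro conjI allI)
  note [measurable] = assms(2) rapid_meas[OF assms(1)]
  show "g \<in> borel_measurable (cyl T)" by fact
  fix n
  show "integrable (cyl T) (\<lambda>z. (Theta T (fst z) ^ n * g z)\<^sup>2)"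
  proof (rule integrable_cong_AE_imp)
    show "integrable (cyl T) (\<lambda>z. (Theta T (fst z) ^ n * f z)\<^sup>2)"
      using assms(1) by (simp add: rapid_def)
    show "AE z in cyl T. (Theta T (fst z) ^ n * f z)\<^sup>2 = (Theta T (fst z) ^ n * g z)\<^sup>2"
      using assms(3) by eventually_elim simp
  qed measurable
qed

lemma rapid_growth_mult:
  assumes f: "rapid T f" and g: "g \<in> borel_measurable (cyl T)"
    and le: "AE z in cyl T. \<bar>g z\<bar> \<le> C * Theta T (fst z) ^ k"
  shows "rapid T (\<lambda>z. g z * f z)"
  unfolding rapid_def
proof (intro conjI allI)
  note [measurable] = g rapid_meas[OF f]
  show "(\<lambda>z. g z * f z) \<in> borel_measurable (cyl T)" by measurable
  fix n
  show "integrable (cyl T) (\<lambda>z. (Theta T (fst z) ^ n * (g z * f z))\<^sup>2)"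
  proof (rule Bochner_Integration.integrable_bound)
    show "integrable (cyl T) (\<lambda>z. C\<^sup>2 * (Theta T (fst z) ^ (n + k) * f z)\<^sup>2)"
      by (intro integrable_mult_right rapidD f)
    show "AE z in cyl T. norm ((Theta T (fst z) ^ n * (g z * f z))\<^sup>2) \<le> norm (C\<^sup>2 * (Theta T (fst z) ^ (n + k) * f z)\<^sup>2)"
      using le
    proof eventually_elim
      case (elim z)
      have "(g z)\<^sup>2 \<le> (C * Theta T (fst z) ^ k)\<^sup>2" using power_mono[OF elim, of 2] by simp
      hence "(g z)\<^sup>2 * (Theta T (fst z) ^ n * f z)\<^sup>2 \<le> (C * Theta T (fst z) ^ k)\<^sup>2 * (Theta T (fst z) ^ n * f z)\<^sup>2"
        by (rule mult_right_mono) simp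
      thus ?case by (simp add: power_mult_distrib power_add mult_ac)
    qed
  qed measurable
qed

lemma rapid_bounded_mult:
  assumes "rapid T f" "g \<in> borel_measurable (cyl T)" "AE z in cyl T. \<bar>g z\<bar> \<le> C"
  shows "rapid T (\<lambda>z. g z * f z)"
  by (rule rapid_growth_mult[where k=0 and C=C]) (use assms in auto)

lemma rapid_cmult: "rapid T f \<Longrightarrow> rapid T (\<lambda>z. c * f z)"
  by (rule rapid_bounded_mult[where C="\<bar>c\<bar>"]) auto

lemma rapid_Theta: "rapid T f \<Longrightarrow> rapid T (\<lambda>z. Theta T (fst z) * f z)"
proof (rule rapid_growth_mult[where C=1 and k=1])
  show "AE z in cyl T. \<bar>Theta T (fst z)\<bar> \<le> 1 * Theta T (fst z) ^ 1"
    using AE_Q_space by eventually_elim (use Theta_pos in \<open>fastforce simp: less_imp_le\<close>)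
qed auto

lemma rapid_Theta': "rapid T f \<Longrightarrow> rapid T (\<lambda>z. Theta' T (fst z) * f z)"
proof (rule rapid_growth_mult[where C="cTheta T" and k=2])
  show "AE z in cyl T. \<bar>Theta' T (fst z)\<bar> \<le> cTheta T * Theta T (fst z) ^ 2"
    using AE_Q_space by eventually_elim (use Theta_derivs_bound in auto)
qed auto

lemma rapid_Theta'': "rapid T f \<Longrightarrow> rapid T (\<lambda>z. Theta'' T (fst z) * f z)"
proof (rule rapid_growth_mult[where C="cTheta T" and k=2])
  show "AE z in cyl T. \<bar>Theta'' T (fst z)\<bar> \<le> cTheta T * Theta T (fst z) ^ 2"
    using AE_Q_space by eventually_elim (use Theta_derivs_bound in auto)
qed auto

lemma rapid_add:
  assumes f: "rapid T f" and g: "rapid T g" shows "rapid T (\<lambda>z. f z + g z)"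
  unfolding rapid_def
proof (intro conjI allI)
  note [measurable] = rapid_meas[OF g] rapid_meas[OF f]
  show "(\<lambda>z. f z + g z) \<in> borel_measurable (cyl T)" by measurable
  fix n
  show "integrable (cyl T) (\<lambda>z. (Theta T (fst z) ^ n * (f z + g z))\<^sup>2)"
  proof (rule Bochner_Integration.integrable_bound)
    show "integrable (cyl T) (\<lambda>z. 2 * (Theta T (fst z) ^ n * f z)\<^sup>2 + 2 * (Theta T (fst z) ^ n * g z)\<^sup>2)"
      by (intro Bochner_Integration.integrable_add integrable_mult_right rapidD f g)
    have "(c * (x + y))\<^sup>2 \<le> 2 * (c * x)\<^sup>2 + 2 * (c * y)\<^sup>2" for c x y :: real
      using zero_le_power2[of "c * x - c * y"] by (simp add: power2_eq_square algebra_simps)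
    thus "AE z in cyl T. norm ((Theta T (fst z) ^ n * (f z + g z))\<^sup>2) \<le> norm (2 * (Theta T (fst z) ^ n * f z)\<^sup>2 + 2 * (Theta T (fst z) ^ n * g z)\<^sup>2)"
      by (intro AE_I2) simp
  qed measurable
qed

lemma rapid_diff: "rapid T f \<Longrightarrow> rapid T g \<Longrightarrow> rapid T (\<lambda>z. f z - g z)"
  using rapid_add[OF _ rapid_cmult[of T g "-1"]] by simp

lemma rapid_prod_integrable:
  assumes f: "rapid T f" and g: "rapid T g" shows "integrable (cyl T) (\<lambda>z. f z * g z)"
proof (rule Bochner_Integration.integrable_bound)
  note [measurable] = rapid_meas[OF g] rapid_meas[OF f]
  have "integrable (cyl T) (\<lambda>z. (Theta T (fst z) ^ 0 * f z)\<^sup>2)" "integrable (cyl T) (\<lambda>z. (Theta T (fst z) ^ 0 * g z)\<^sup>2)"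
    by (rule rapidD[OF f] rapidD[OF g])+
  thus "integrable (cyl T) (\<lambda>z. ((f z)\<^sup>2 + (g z)\<^sup>2) / 2)" by simp
  have "\<bar>x * y\<bar> \<le> (x\<^sup>2 + y\<^sup>2) / (2::real)" for x y
    using sum_squares_bound[of "\<bar>x\<bar>" "\<bar>y\<bar>"] by (simp add: abs_mult)
  thus "AE z in cyl T. norm (f z * g z) \<le> norm (((f z)\<^sup>2 + (g z)\<^sup>2) / 2)"
    by (intro AE_I2) (simp add: abs_mult)
  show "(\<lambda>z. f z * g z) \<in> borel_measurable (cyl T)" by measurable
qed

text \<open>A single term of the exponential series, \<open>(c y)^n / n! \<le> exp (c y)\<close>,
  gives the bound \<open>n! / c^n\<close>.\<close>

lemma power_exp_bounded:
  assumes "c > (0::real)" obtains B where "B \<ge> 0" "\<And>y. y \<ge> 0 \<Longrightarrow> y ^ n * exp (- c * y) \<le> B"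
proof -
  have "y ^ n * exp (- c * y) \<le> fact n / c ^ n" if y: "y \<ge> 0" for y
  proof -
    have "(c * y) ^ n / fact n \<le> exp (c * y)"
    proof -
      have "(\<Sum>k\<in>{n}. (c * y) ^ k /\<^sub>R fact k) \<le> (\<Sum>k. (c * y) ^ k /\<^sub>R fact k)"
        by (rule sum_le_suminf[OF summable_exp_generic]) (use assms y in auto)
      thus ?thesis by (simp add: exp_def divide_inverse mult.commute)
    qed
    hence "(c * y) ^ n \<le> fact n * exp (c * y)" by (simp add: pos_divide_le_eq mult.commute)
    hence "c ^ n * y ^ n * exp (- c * y) \<le> fact n * exp (c * y) * exp (- c * y)"
      by (intro mult_right_mono) (auto simp: power_mult_distrib)
    also have "\<dots> = fact n" by (simp add: mult.assoc flip: exp_add)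
    finally show ?thesis using assms by (simp add: pos_le_divide_eq mult_ac)
  qed
  thus ?thesis using that[of "fact n / c ^ n"] assms by auto
qed

context carleman_weight begin

lemma psi_meas_snd [measurable]: "(\<lambda>z. \<psi> (snd z)) \<in> borel_measurable (N \<Otimes>\<^sub>M IM 0 1)"
  by (rule measurable_compose[OF measurable_snd psi_meas])

lemma ew_meas [measurable]: "(\<lambda>z. ew (s * Theta T (fst z)) (snd z)) \<in> borel_measurable (cyl T)"
  unfolding ew_def by measurable

text \<open>\<open>\<psi> \<le> -\<kappa>\<close> gives
  \<open>e^{s\<phi>} \<le> exp (- s \<kappa> \<Theta>)\<close>, which absorbs every power of
  \<open>\<Theta>\<close>.\<close>

lemma rapid_ew:
  assumes s: "s > 0" and f: "f \<in> borel_measurable (cyl T)" and i: "integrable (cyl T) (\<lambda>z. (f z)\<^sup>2)"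
  shows "rapid T (\<lambda>z. ew (s * Theta T (fst z)) (snd z) * f z)"
  unfolding rapid_def
proof (intro conjI allI)
  note [measurable] = f
  show "(\<lambda>z. ew (s * Theta T (fst z)) (snd z) * f z) \<in> borel_measurable (cyl T)" by measurable
  fix n
  obtain \<kappa> where kap: "\<kappa> > 0" "\<And>x. 0 \<le> x \<Longrightarrow> x \<le> 1 \<Longrightarrow> \<psi> x \<le> - \<kappa>" using psi_neg by blast
  obtain B where B: "B \<ge> 0" "\<And>y. y \<ge> 0 \<Longrightarrow> y ^ n * exp (- (s * \<kappa>) * y) \<le> B"
    using power_exp_bounded[of "s * \<kappa>" n] s kap by auto
  show "integrable (cyl T) (\<lambda>z. (Theta T (fst z) ^ n * (ew (s * Theta T (fst z)) (snd z) * f z))\<^sup>2)"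
  proof (rule Bochner_Integration.integrable_bound)
    show "integrable (cyl T) (\<lambda>z. B\<^sup>2 * (f z)\<^sup>2)" using i by simp
    show "AE z in cyl T. norm ((Theta T (fst z) ^ n * (ew (s * Theta T (fst z)) (snd z) * f z))\<^sup>2) \<le> norm (B\<^sup>2 * (f z)\<^sup>2)"
      using AE_Q_space
    proof eventually_elim
      case (elim z)
      let ?y = "Theta T (fst z)"
      have y: "?y > 0" using Theta_pos elim by auto
      have "s * ?y * \<psi> (snd z) \<le> s * ?y * (- \<kappa>)" using kap(2)[of "snd z"] elim s y by (intro mult_left_mono) auto
      hence "ew (s * ?y) (snd z) \<le> exp (- (s * \<kappa>) * ?y)" by (simp add: ew_def mult_ac)
      hence "?y ^ n * ew (s * ?y) (snd z) \<le> ?y ^ n * exp (- (s * \<kappa>) * ?y)" using y by (intro mult_left_mono) auto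
      also have "\<dots> \<le> B" using B y by simp
      finally have "?y ^ n * ew (s * ?y) (snd z) \<le> B" .
      moreover have "0 \<le> ?y ^ n * ew (s * ?y) (snd z)" using y by (simp add: ew_def)
      ultimately have "(?y ^ n * ew (s * ?y) (snd z))\<^sup>2 \<le> B\<^sup>2" by (rule power_mono)
      hence "(?y ^ n * ew (s * ?y) (snd z))\<^sup>2 * (f z)\<^sup>2 \<le> B\<^sup>2 * (f z)\<^sup>2" by (rule mult_right_mono) simp
      thus ?case by (simp add: power_mult_distrib mult.assoc)
    qed
  qed measurable
qed

end

text \<open>\<open>U\<close> is a representative of \<open>v\<^sub>t\<close> whose slices are absolutely continuous in \<open>x\<close>, with derivative \<open>Ux\<close>
  representing \<open>v\<^sub>t\<^sub>x\<close>.\<close>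

locale carleman_solution = carleman_weight +
  fixes T :: real and v vx vxx U Ux :: "real \<Rightarrow> real \<Rightarrow> real" and cv cx :: "real \<Rightarrow> real"
  assumes T: "T > 0"
    and meas: "case_prod v \<in> borel_measurable (borel \<Otimes>\<^sub>M borel)" "case_prod vx \<in> borel_measurable (borel \<Otimes>\<^sub>M borel)"
      "case_prod vxx \<in> borel_measurable (borel \<Otimes>\<^sub>M borel)" "case_prod U \<in> borel_measurable (borel \<Otimes>\<^sub>M borel)"
      "case_prod Ux \<in> borel_measurable (borel \<Otimes>\<^sub>M borel)"
    and L2: "integrable (cyl T) (\<lambda>z. (vx (fst z) (snd z))\<^sup>2)"
      "integrable (cyl T) (\<lambda>z. (vxx (fst z) (snd z))\<^sup>2)"
      "integrable (cyl T) (\<lambda>z. (Ux (fst z) (snd z))\<^sup>2)"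
    and L2a: "integrable (cyl T) (\<lambda>z. (v (fst z) (snd z))\<^sup>2 / a (snd z))"
      "integrable (cyl T) (\<lambda>z. (U (fst z) (snd z))\<^sup>2 / a (snd z))"
    and ac: "AE t in IM 0 T. ac_on 0 1 (v t) (vx t)" "AE t in IM 0 T. ac_on 0 1 (vx t) (vxx t)"
      "AE t in IM 0 T. ac_on 0 1 (U t) (Ux t)"
    and bc: "AE t in IM 0 T. v t 0 = 0 \<and> v t 1 = 0 \<and> U t 0 = 0 \<and> U t 1 = 0"
    and L1: "integrable (cyl T) (case_prod U)" "integrable (cyl T) (case_prod Ux)"
    and repv: "AE z in cyl T. v (fst z) (snd z) = cv (snd z) + (LBINT u:{0..fst z}. U u (snd z))"
    and repx: "AE z in cyl T. vx (fst z) (snd z) = cx (snd z) + (LBINT u:{0..fst z}. Ux u (snd z))"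
begin

abbreviation QM where "QM \<equiv> cyl T"

lemma meas_Q:
  assumes "case_prod f \<in> borel_measurable (borel \<Otimes>\<^sub>M borel)"
  shows "(\<lambda>z. f (fst z) (snd z)) \<in> borel_measurable QM"
  using measurable_pair_IM[OF assms, of 0 T 0 1] by (simp add: case_prod_unfold)

lemmas fun_meas [measurable] = meas_Q[OF meas(1)] meas_Q[OF meas(2)] meas_Q[OF meas(3)] meas_Q[OF meas(4)] meas_Q[OF meas(5)]

lemma AE_Q_pos: "AE z in QM. 0 < fst z \<and> fst z < T \<and> 0 < snd z \<and> snd z < 1 \<and> a (snd z) > 0"
proof -
  have "AE x in IM 0 1. x \<noteq> x0" unfolding AE_IM_iff using AE_lborel_singleton[of x0] by eventually_elim auto
  hence "AE z in QM. snd z \<noteq> x0" by (rule Q.AE_pair_snd)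
  with AE_Q_space show ?thesis by eventually_elim (use a_pos in auto)
qed

text \<open>\<open>ru_square_integral\<close> on each time slice, with a constant independent of
  \<open>t\<close>; Fubini assembles the slices.\<close>

lemma ru_L2:
  assumes mu: "case_prod u \<in> borel_measurable (borel \<Otimes>\<^sub>M borel)"
    and i': "integrable QM (\<lambda>z. (u' (fst z) (snd z))\<^sup>2)" and ia: "integrable QM (\<lambda>z. (u (fst z) (snd z))\<^sup>2 / a (snd z))"
    and ac: "AE t in IM 0 T. ac_on 0 1 (u t) (u' t)" and u0: "AE t in IM 0 T. u t 0 = 0"
  shows "integrable QM (\<lambda>z. (r (snd z) * u (fst z) (snd z))\<^sup>2)"
proof -
  obtain C where C: "C > 0" "\<And>u u'. ac_on 0 1 u u' \<Longrightarrow> u 0 = 0 \<Longrightarrow> integrable (IM 0 1) (\<lambda>x. (u' x)\<^sup>2) \<Longrightarrow>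
      integrable (IM 0 1) (\<lambda>x. (u x)\<^sup>2 / a x) \<Longrightarrow>
      integrable (IM 0 1) (\<lambda>x. (r x * u x)\<^sup>2) \<and> (\<integral>x. (r x * u x)\<^sup>2 \<partial>IM 0 1) \<le> C * (\<integral>x. (u' x)\<^sup>2 \<partial>IM 0 1)"
    using ru_square_integral by blast
  note [measurable] = meas_Q[OF mu]
  have m: "(\<lambda>z. (r (snd z) * u (fst z) (snd z))\<^sup>2) \<in> borel_measurable QM" by measurable
  have ae: "AE t in IM 0 T. integrable (IM 0 1) (\<lambda>x. (r x * u t x)\<^sup>2) \<and> (\<integral>x. (r x * u t x)\<^sup>2 \<partial>IM 0 1) \<le> C * (\<integral>x. (u' t x)\<^sup>2 \<partial>IM 0 1)"
    using Q.AE_integrable_fst'[OF i'] Q.AE_integrable_fst'[OF ia] ac u0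
    by eventually_elim (use C(2) in auto)
  show ?thesis
  proof (rule Q.Fubini_integrable[OF m])
    show "AE t in IM 0 T. integrable (IM 0 1) (\<lambda>x. (r (snd (t, x)) * u (fst (t, x)) (snd (t, x)))\<^sup>2)"
      using ae by eventually_elim simp
    show "integrable (IM 0 T) (\<lambda>t. \<integral>x. norm ((r (snd (t, x)) * u (fst (t, x)) (snd (t, x)))\<^sup>2) \<partial>IM 0 1)"
    proof (rule Bochner_Integration.integrable_bound)
      show "integrable (IM 0 T) (\<lambda>t. C * (\<integral>x. (u' t x)\<^sup>2 \<partial>IM 0 1))"
        using Q.integrable_fst'[OF i'] by simp
      show "AE t in IM 0 T. norm (\<integral>x. norm ((r (snd (t, x)) * u (fst (t, x)) (snd (t, x)))\<^sup>2) \<partial>IM 0 1) \<le> norm (C * (\<integral>x. (u' t x)\<^sup>2 \<partial>IM 0 1))"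
        using ae
      proof eventually_elim
        case (elim t)
        have "(\<integral>x. (r x * u t x)\<^sup>2 \<partial>IM 0 1) \<ge> 0" by (rule integral_nonneg_AE) auto
        moreover have "(\<integral>x. (r x * u t x)\<^sup>2 \<partial>IM 0 1) \<le> \<bar>C * (\<integral>x. (u' t x)\<^sup>2 \<partial>IM 0 1)\<bar>"
          using elim by linarith
        ultimately show ?case by simp
      qed
    qed measurable
  qed
qed

abbreviation en where "en s z \<equiv> ew (s * Theta T (fst z)) (snd z)"
abbreviation th where "th z \<equiv> Theta T (fst z)"
abbreviation th' where "th' z \<equiv> Theta' T (fst z)"
abbreviation th'' where "th'' z \<equiv> Theta'' T (fst z)"

text \<open>These seven factors are square integrable already before weighting, with a power of
  \<open>sqrt a\<close> or a factor \<open>r\<close> attached where needed. Up to coefficients, the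
  integrands below are sums of products of two of them.\<close>

definition \<alpha> where "\<alpha> s z = en s z * (v (fst z) (snd z) / sqrt (a (snd z)))"
definition \<beta> where "\<beta> s z = en s z * vx (fst z) (snd z)"
definition \<gamma> where "\<gamma> s z = en s z * (sqrt (a (snd z)) * vxx (fst z) (snd z))"
definition \<delta> where "\<delta> s z = en s z * (U (fst z) (snd z) / sqrt (a (snd z)))"
definition \<epsilon> where "\<epsilon> s z = en s z * Ux (fst z) (snd z)"
definition \<zeta> where "\<zeta> s z = en s z * (r (snd z) * v (fst z) (snd z))"
definition \<eta> where "\<eta> s z = en s z * (r (snd z) * U (fst z) (snd z))"

lemma sq_div_sqrt: "integrable QM (\<lambda>z. (f z)\<^sup>2 / a (snd z)) \<Longrightarrow> integrable QM (\<lambda>z. (f z / sqrt (a (snd z)))\<^sup>2)"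
  by (erule Bochner_Integration.integrable_cong[THEN iffD1, rotated 2])
     (auto simp: space_pair_measure power_divide a_nonneg)

lemma rapid_basic:
  assumes s: "s > 0"
  shows "rapid T (\<alpha> s)" "rapid T (\<beta> s)" "rapid T (\<gamma> s)" "rapid T (\<delta> s)" "rapid T (\<epsilon> s)" "rapid T (\<zeta> s)" "rapid T (\<eta> s)"
proof -
  show "rapid T (\<alpha> s)" unfolding \<alpha>_def[abs_def] by (rule rapid_ew[OF s]) (measurable, rule sq_div_sqrt[OF L2a(1)])
  show "rapid T (\<beta> s)" unfolding \<beta>_def[abs_def] by (rule rapid_ew[OF s]) (measurable, rule L2(1))
  show "rapid T (\<delta> s)" unfolding \<delta>_def[abs_def] by (rule rapid_ew[OF s]) (measurable, rule sq_div_sqrt[OF L2a(2)])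
  show "rapid T (\<epsilon> s)" unfolding \<epsilon>_def[abs_def] by (rule rapid_ew[OF s]) (measurable, rule L2(3))
  have u0: "AE t in IM 0 T. v t 0 = 0" "AE t in IM 0 T. U t 0 = 0" using bc by (eventually_elim, simp)+
  show "rapid T (\<zeta> s)" unfolding \<zeta>_def[abs_def]
    by (rule rapid_ew[OF s]) (measurable, rule ru_L2[OF meas(1) L2(1) L2a(1) ac(1) u0(1)])
  show "rapid T (\<eta> s)" unfolding \<eta>_def[abs_def]
    by (rule rapid_ew[OF s]) (measurable, rule ru_L2[OF meas(4) L2(3) L2a(2) ac(3) u0(2)])
  show "rapid T (\<gamma> s)" unfolding \<gamma>_def[abs_def]
  proof (rule rapid_ew[OF s])
    obtain A where A: "A > 0" "\<And>x. x \<in> {0..1} \<Longrightarrow> \<bar>a x\<bar> \<le> A" using continuous_bounded01[OF a_cont] by blast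
    have "integrable QM (\<lambda>z. (vxx (fst z) (snd z))\<^sup>2 * a (snd z))"
    proof (rule integrable_mult_bounded[OF L2(2), where B=A])
      show "(\<lambda>z. a (snd z)) \<in> borel_measurable QM" by (rule measurable_compose[OF measurable_snd a_meas])
      show "AE z in QM. \<bar>a (snd z)\<bar> \<le> A" using AE_Q_space by eventually_elim (use A in auto)
    qed

    thus "integrable QM (\<lambda>z. (sqrt (a (snd z)) * vxx (fst z) (snd z))\<^sup>2)"
      by - (erule Bochner_Integration.integrable_cong[THEN iffD1, rotated 2],
         auto simp: space_pair_measure power_mult_distrib a_nonneg mult.commute)
  qed measurable
qed

lemma rapid_x_mult:
  assumes f: "rapid T f" and g: "g \<in> borel_measurable (IM 0 1)" and b: "\<And>x. x \<in> {0..1} \<Longrightarrow> \<bar>g x\<bar> \<le> B"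
  shows "rapid T (\<lambda>z. g (snd z) * f z)"
proof (rule rapid_bounded_mult[OF f])
  show "(\<lambda>z. g (snd z)) \<in> borel_measurable QM" by (rule measurable_compose[OF measurable_snd g])
  show "AE z in QM. \<bar>g (snd z)\<bar> \<le> B" using AE_Q_space by eventually_elim (use b in auto)
qed

lemma rapid_cont: "continuous_on {0..1} g \<Longrightarrow> rapid T f \<Longrightarrow> rapid T (\<lambda>z. g (snd z) * f z)"
proof -
  assume g: "continuous_on {0..1} g" and f: "rapid T f"
  obtain B where B: "\<And>x. x \<in> {0..1} \<Longrightarrow> \<bar>g x\<bar> \<le> B" using continuous_bounded01[OF g] by blast
  have "g \<in> borel_measurable (IM 0 1)" by (rule measurable_IM_continuous) (rule continuous_on_subset[OF g], auto)
  thus ?thesis by (rule rapid_x_mult[OF f _ B])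
qed

lemmas rapid_psi = rapid_cont[OF psi_cont] and rapid_q = rapid_cont[OF q_cont] and rapid_pd = rapid_cont[OF pd_cont]

lemma rapid_sqrt_a: "rapid T f \<Longrightarrow> rapid T (\<lambda>z. sqrt (a (snd z)) * f z)"
  by (rule rapid_cont[of "\<lambda>x. sqrt (a x)"]) (intro continuous_intros a_cont)

lemma rapid_qd: "rapid T f \<Longrightarrow> rapid T (\<lambda>z. qd (snd z) * f z)"
  using qd_bounded rapid_x_mult[OF _ qd_meas] by metis

text \<open>The square of \<open>sqrt a * r\<close> is \<open>E^2 m\<close>, which is bounded
  although \<open>r\<close> need not be.\<close>

lemma rapid_sar: "rapid T f \<Longrightarrow> rapid T (\<lambda>z. sqrt (a (snd z)) * r (snd z) * f z)"
proof -
  assume f: "rapid T f"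
  obtain B where B: "B > 0" "\<And>x. x \<in> {0..1} \<Longrightarrow> m x \<le> B" using m_bounded by blast
  show ?thesis
  proof (rule rapid_x_mult[OF f, where g="\<lambda>x. sqrt (a x) * r x"])
    show "(\<lambda>x. sqrt (a x) * r x) \<in> borel_measurable (IM 0 1)" by measurable
    fix x :: real assume x: "x \<in> {0..1}"
    have "(sqrt (a x) * r x)\<^sup>2 = (E x)\<^sup>2 * m x"
    proof -
      have "(sqrt (a x) * r x)\<^sup>2 = a x * (r x)\<^sup>2" using a_nonneg[of x] x by (simp add: power_mult_distrib)
      also have "\<dots> = (E x)\<^sup>2 * m x"
        by (cases "a x = 0") (auto simp: r_def p_def m_def power_divide power_mult_distrib power2_eq_square)
      finally show ?thesis .
    qed
    also have "\<dots> \<le> (exp R)\<^sup>2 * B"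
      using E_le[OF x] E_pos[of x] B(2)[OF x] m_nonneg[of x] x by (intro mult_mono power_mono) auto
    finally show "\<bar>sqrt (a x) * r x\<bar> \<le> sqrt ((exp R)\<^sup>2 * B)"
      by (metis real_sqrt_abs real_sqrt_le_mono)
  qed
qed

abbreviation zQ where "zQ s z \<equiv> zf (s * th z) (v (fst z)) (vx (fst z)) (snd z)"
abbreviation wQ where "wQ s z \<equiv> wf (s * th z) (v (fst z)) (snd z)"
abbreviation LpQ where "LpQ s z \<equiv> Lp (s * th z) (s * th' z) (v (fst z)) (vx (fst z)) (vxx (fst z)) (snd z)"
abbreviation LmQ where "LmQ s z \<equiv> Lm (s * th z) (s * th' z) (v (fst z)) (vx (fst z)) (U (fst z)) (snd z)"
abbreviation PtQ where "PtQ s z \<equiv> Pt (s * th z) (s * th' z) (s * th'' z) (v (fst z)) (vx (fst z)) (U (fst z)) (Ux (fst z)) (snd z)"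
abbreviation DDQ where "DDQ s z \<equiv> DD (s * th z) (s * th' z) (s * th'' z) (wf (s * th z) (v (fst z))) (zf (s * th z) (v (fst z)) (vx (fst z))) (snd z)"

lemma rapid_z: assumes s: "s > 0" shows "rapid T (zQ s)"
proof -
  have "rapid T (\<lambda>z. \<beta> s z + s * d1 * (th z * \<zeta> s z))"
    by (intro rapid_add rapid_cmult rapid_Theta rapid_basic s)
  moreover have "(\<lambda>z. \<beta> s z + s * d1 * (th z * \<zeta> s z)) = zQ s"
    by (auto simp: zf_def \<beta>_def \<zeta>_def algebra_simps)
  ultimately show ?thesis by simp
qed

lemma rapid_zt: assumes s: "s > 0"
  shows "rapid T (\<lambda>z. ztf (s * th z) (s * th' z) (v (fst z)) (vx (fst z)) (U (fst z)) (Ux (fst z)) (snd z))"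
proof -
  have "rapid T (\<lambda>z. \<epsilon> s z + s * d1 * (th z * \<eta> s z) + s * d1 * (th' z * \<zeta> s z) + s * (th' z * (\<psi> (snd z) * zQ s z)))"
    by (intro rapid_add rapid_cmult rapid_Theta rapid_Theta' rapid_psi rapid_basic rapid_z s)
  moreover have "(\<lambda>z. \<epsilon> s z + s * d1 * (th z * \<eta> s z) + s * d1 * (th' z * \<zeta> s z) + s * (th' z * (\<psi> (snd z) * zQ s z)))
     = (\<lambda>z. ztf (s * th z) (s * th' z) (v (fst z)) (vx (fst z)) (U (fst z)) (Ux (fst z)) (snd z))"
    by (auto simp: zf_def ztf_def \<epsilon>_def \<eta>_def \<zeta>_def algebra_simps)
  ultimately show ?thesis by simp
qed

lemma comp_meas:
  "(\<lambda>z. LpQ s z) \<in> borel_measurable QM" "(\<lambda>z. LmQ s z) \<in> borel_measurable QM" "(\<lambda>z. PtQ s z) \<in> borel_measurable QM"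
  "(\<lambda>z. DDQ s z) \<in> borel_measurable QM" "(\<lambda>z. wQ s z) \<in> borel_measurable QM" "(\<lambda>z. zQ s z) \<in> borel_measurable QM"
  unfolding Lp_def Lm_def Pt_def DD_def zxf_def Gf_def zf_def wf_def wtf_def ztf_def
  by measurable

text \<open>The degenerate factor is shared evenly: \<open>sqrt a * Lp\<close> and
  \<open>Lm / sqrt a\<close> are both in the class, and their product is
  \<open>Lp * Lm\<close>.\<close>

lemma Lp_rapid: assumes s: "s > 0" shows "rapid T (\<lambda>z. sqrt (a (snd z)) * LpQ s z)"
proof (rule rapid_cong_AE)
  \<comment> \<open>The square of \<open>s \<Theta> d1 r\<close> enters twice, once from
    \<open>w_xx\<close> and once from \<open>Gf\<close>, hence the coefficient 2.\<close>
  let ?f = "\<lambda>z. \<gamma> s z + 2 * s * d1 * (th z * (sqrt (a (snd z)) * r (snd z) * \<beta> s z)) + s * d1 * (th z * (q (snd z) * \<alpha> s z))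
     + 2 * (s * d1)\<^sup>2 * (th z * (th z * (sqrt (a (snd z)) * r (snd z) * (sqrt (a (snd z)) * r (snd z) * \<alpha> s z))))
     - s * (th' z * (\<psi> (snd z) * \<alpha> s z))"
  show "rapid T ?f"
    by (intro rapid_add rapid_diff rapid_cmult rapid_Theta rapid_Theta' rapid_psi rapid_q rapid_sar rapid_basic s)
  show "(\<lambda>z. sqrt (a (snd z)) * LpQ s z) \<in> borel_measurable QM" using comp_meas(1) by measurable
  show "AE z in QM. ?f z = sqrt (a (snd z)) * LpQ s z"
    using AE_Q_pos
  proof eventually_elim
    case (elim z)
    \<comment> \<open>With \<open>a = k^2\<close> the claim becomes a rational identity.\<close>
    define k where "k = sqrt (a (snd z))"
    have k: "k > 0" "a (snd z) = k * k" using elim by (auto simp: k_def)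
    show ?case
      unfolding \<alpha>_def \<beta>_def \<gamma>_def Lp_def zxf_def Gf_def wf_def k_def[symmetric] k(2)
      using k(1) by (simp add: divide_simps) (simp add: algebra_simps power2_eq_square)
  qed
qed

lemma Lm_rapid: assumes s: "s > 0" shows "rapid T (\<lambda>z. LmQ s z / sqrt (a (snd z)))"
proof (rule rapid_cong_AE)
  let ?f = "\<lambda>z. \<delta> s z + s * (th' z * (\<psi> (snd z) * \<alpha> s z)) - 2 * s * d1 * (th z * (sqrt (a (snd z)) * r (snd z) * zQ s z))
     - s * d1 * (th z * (q (snd z) * \<alpha> s z))"
  show "rapid T ?f"
    by (intro rapid_add rapid_diff rapid_cmult rapid_Theta rapid_Theta' rapid_psi rapid_q rapid_sar rapid_basic rapid_z s)
  show "(\<lambda>z. LmQ s z / sqrt (a (snd z))) \<in> borel_measurable QM" using comp_meas(2) by measurable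
  show "AE z in QM. ?f z = LmQ s z / sqrt (a (snd z))"
    using AE_Q_pos
  proof eventually_elim
    case (elim z)
    define k where "k = sqrt (a (snd z))"
    have k: "k > 0" "a (snd z) = k * k" using elim by (auto simp: k_def)
    have pk: "p (snd z) = k * k * r (snd z)" using k by (simp add: r_def)
    show ?case
      unfolding \<alpha>_def \<delta>_def Lm_def wtf_def wf_def k_def[symmetric] pk
      using k(1) by (simp add: divide_simps) (simp add: algebra_simps)
  qed
qed

lemma LL_integrable: assumes s: "s > 0" shows "integrable QM (\<lambda>z. LpQ s z * LmQ s z)"
proof (rule integrable_cong_AE_imp[OF rapid_prod_integrable[OF Lp_rapid[OF s] Lm_rapid[OF s]]])
  show "(\<lambda>z. LpQ s z * LmQ s z) \<in> borel_measurable QM" using comp_meas(1,2) by measurable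
  show "AE z in QM. sqrt (a (snd z)) * LpQ s z * (LmQ s z / sqrt (a (snd z))) = LpQ s z * LmQ s z"
    using AE_Q_pos by eventually_elim auto
qed

text \<open>The factors \<open>1/a\<close> and \<open>r^2\<close> are split evenly between the two
  members of each product.\<close>

lemma Pt_integrable: assumes s: "s > 0" shows "integrable QM (PtQ s)"
proof (rule integrable_cong_AE_imp)
  let ?zt = "\<lambda>z. ztf (s * th z) (s * th' z) (v (fst z)) (vx (fst z)) (U (fst z)) (Ux (fst z)) (snd z)"
  let ?f = "\<lambda>z. (- 1) * (zQ s z * ?zt z) + (s * d1)\<^sup>2 * ((th z * \<zeta> s z) * (th' z * \<zeta> s z)) - s / 2 * ((th'' z * \<alpha> s z) * (\<psi> (snd z) * \<alpha> s z))
    + (s * d1)\<^sup>2 * ((th z * (th z * \<zeta> s z)) * (\<eta> s z + s * (th' z * (\<psi> (snd z) * \<zeta> s z))))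
    - s * ((th' z * (\<psi> (snd z) * \<alpha> s z)) * (\<delta> s z + s * (th' z * (\<psi> (snd z) * \<alpha> s z))))"
  show "integrable QM ?f"
    by (intro Bochner_Integration.integrable_add Bochner_Integration.integrable_diff integrable_mult_right rapid_prod_integrable
         rapid_add rapid_cmult rapid_Theta rapid_Theta' rapid_Theta'' rapid_psi rapid_basic rapid_z rapid_zt s)
  show "PtQ s \<in> borel_measurable QM" by (rule comp_meas)
  show "AE z in QM. ?f z = PtQ s z"
    using AE_Q_pos
  proof eventually_elim
    case (elim z)
    define k where "k = sqrt (a (snd z))"
    have k: "k > 0" "a (snd z) = k * k" using elim by (auto simp: k_def)
    show ?case
      unfolding \<alpha>_def \<delta>_def \<zeta>_def \<eta>_def Pt_def Gf_def wtf_def wf_def k_def[symmetric] k(2)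
      using k(1) by (simp add: divide_simps) (simp add: algebra_simps power2_eq_square)
  qed
qed

lemma DD_integrable: assumes s: "s > 0" shows "integrable QM (DDQ s)"
proof (rule integrable_cong_AE_imp)
  \<comment> \<open>In the mixed term \<open>w\<close> itself appears as
    \<open>sqrt a * \<alpha>\<close>.\<close>
  let ?f = "\<lambda>z. s * d1 * ((th z * zQ s z) * (pd (snd z) * zQ s z + q (snd z) * zQ s z)) + s * d1 * ((th z * (qd (snd z) * (sqrt (a (snd z)) * \<alpha> s z))) * zQ s z)
    + (s * d1) ^ 3 * ((th z * (th z * (th z * \<zeta> s z))) * (pd (snd z) * \<zeta> s z + q (snd z) * \<zeta> s z))
    - 2 * s\<^sup>2 * d1\<^sup>2 * ((th z * \<zeta> s z) * (th' z * \<zeta> s z)) + s / 2 * ((th'' z * \<alpha> s z) * (\<psi> (snd z) * \<alpha> s z))"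
  show "integrable QM ?f"
    by (intro Bochner_Integration.integrable_add Bochner_Integration.integrable_diff integrable_mult_right rapid_prod_integrable
         rapid_add rapid_cmult rapid_Theta rapid_Theta' rapid_Theta'' rapid_psi rapid_q rapid_qd rapid_pd rapid_sqrt_a rapid_basic rapid_z s)
  show "DDQ s \<in> borel_measurable QM" by (rule comp_meas)
  show "AE z in QM. ?f z = DDQ s z"
    using AE_Q_pos
  proof eventually_elim
    case (elim z)
    define k where "k = sqrt (a (snd z))"
    have k: "k > 0" "a (snd z) = k * k" using elim by (auto simp: k_def)
    show ?case
      unfolding \<alpha>_def \<zeta>_def DD_def wf_def k_def[symmetric] k(2)
      using k(1) by (simp add: divide_simps) (simp add: algebra_simps power2_eq_square power3_eq_cube)
  qed
qed

end

section \<open>The energy term\<close>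

lemma Theta_exp_tendsto:
  assumes T: "T > 0" and k: "k > 0"
  shows "((\<lambda>t. Theta T t ^ n * exp (- k * Theta T t)) \<longlongrightarrow> 0) (at_right 0)"
    "((\<lambda>t. Theta T t ^ n * exp (- k * Theta T t)) \<longlongrightarrow> 0) (at_left T)"
proof -
  have "((\<lambda>y::real. y ^ n / exp y) \<longlongrightarrow> 0) at_top" by (rule tendsto_power_div_exp_0)
  moreover have "filterlim (\<lambda>y. k * y) at_top at_top"
    by (rule filterlim_tendsto_pos_mult_at_top[OF tendsto_const k filterlim_ident])
  ultimately have "((\<lambda>y. (k * y) ^ n / exp (k * y)) \<longlongrightarrow> 0) at_top" by (rule filterlim_compose)
  hence "((\<lambda>y. (k * y) ^ n / exp (k * y) / k ^ n) \<longlongrightarrow> 0 / k ^ n) at_top"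
    by (rule tendsto_divide[OF _ tendsto_const]) (use k in simp)
  moreover have "(k * y) ^ n / exp (k * y) / k ^ n = y ^ n * exp (- k * y)" for y
    using k by (simp add: power_mult_distrib exp_minus divide_simps)
  ultimately have 1: "((\<lambda>y. y ^ n * exp (- k * y)) \<longlongrightarrow> 0) at_top" by simp
  show "((\<lambda>t. Theta T t ^ n * exp (- k * Theta T t)) \<longlongrightarrow> 0) (at_right 0)"
    "((\<lambda>t. Theta T t ^ n * exp (- k * Theta T t)) \<longlongrightarrow> 0) (at_left T)"
    by (rule filterlim_compose[OF 1 Theta_at_top(1)[OF T]], rule filterlim_compose[OF 1 Theta_at_top(2)[OF T]])
qed

lemma Theta_null_comparison:
  assumes T: "T > 0" and k: "k > 0"
    and le: "\<And>t. 0 < t \<Longrightarrow> t < T \<Longrightarrow> \<bar>f t\<bar> \<le> C * (Theta T t ^ n * exp (- k * Theta T t))"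
  shows "(f \<longlongrightarrow> 0) (at_right 0)" "(f \<longlongrightarrow> 0) (at_left T)"
proof -
  have l: "((\<lambda>t. C * (Theta T t ^ n * exp (- k * Theta T t))) \<longlongrightarrow> 0) (at_right 0)"
    "((\<lambda>t. C * (Theta T t ^ n * exp (- k * Theta T t))) \<longlongrightarrow> 0) (at_left T)"
    using tendsto_mult[OF tendsto_const Theta_exp_tendsto(1)[OF T k]] tendsto_mult[OF tendsto_const Theta_exp_tendsto(2)[OF T k]] by fastforce+
  have e1: "\<forall>\<^sub>F t in at_right 0. norm (f t) \<le> C * (Theta T t ^ n * exp (- k * Theta T t))"
    unfolding eventually_at_right_field using T le by (auto intro!: exI[of _ T])
  have e2: "\<forall>\<^sub>F t in at_left T. norm (f t) \<le> C * (Theta T t ^ n * exp (- k * Theta T t))"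
    unfolding eventually_at_left_field using T le by (auto intro!: exI[of _ 0])
  show "(f \<longlongrightarrow> 0) (at_right 0)" by (rule Lim_null_comparison[OF e1 l(1)])
  show "(f \<longlongrightarrow> 0) (at_left T)" by (rule Lim_null_comparison[OF e2 l(2)])
qed

text \<open>The time derivative of \<open>(Gf w^2 - w_x^2)/2\<close>, expanded in \<open>v\<close>
  and \<open>v_x\<close>. The terms in \<open>r^2 v^2\<close> of the two squares cancel, so the
  energy is \<open>- e^{2s\<phi>}/2\<close> times
  \<open>v_x^2 + 2 s d1 \<Theta> r v v_x + s \<Theta>' \<psi> v^2/a\<close>, and each line on the
  right differentiates one summand. \<open>h\<close>, \<open>y\<close>, \<open>ia\<close> stand for
  \<open>\<Theta>\<close>, \<open>\<psi>\<close>, \<open>1/a\<close>.\<close>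

lemma energy_derivative_identity:
  fixes e r ia v vx U Ux y h h' h'' s d :: real
  shows "- (e * (vx + s * h * d * (r * v)) * (e * (Ux + s * h * d * (r * U) + s * h' * d * (r * v) + s * h' * y * (vx + s * h * d * (r * v)))))
     + (2 * (s * h) * (s * h') * (d * r)\<^sup>2 - s * h'' * y * ia) * (e * v)\<^sup>2 / 2
     + ((s * h * d * r)\<^sup>2 - s * h' * y * ia) * (e * v) * (e * (U + s * h' * (y * v)))
   = (- 1 / 2 * (2 * s * h' * y * (e * e)) * (vx * vx) + - 1 / 2 * (e * e) * (Ux * vx + vx * Ux))
   + (- (s * d * r) * (h' * (e * e) + h * (2 * s * h' * y * (e * e))) * (v * vx) + - (s * d * r) * (h * (e * e)) * (U * vx + v * Ux))
   + (- (s * y * ia / 2) * (h'' * (e * e) + h' * (2 * s * h' * y * (e * e))) * (v * v) + - (s * y * ia / 2) * (h' * (e * e)) * (U * v + v * U))"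
  by (simp add: field_simps power2_eq_square)

context carleman_solution begin

definition e2 where "e2 s t x = exp (2 * s * Theta T t * \<psi> x)"

lemma e2_en: "e2 s (fst z) (snd z) = en s z * en s z"
  by (simp add: e2_def ew_def mult_ac flip: exp_add)

lemma e2_deriv: "0 < t \<Longrightarrow> t < T \<Longrightarrow> ((\<lambda>t. e2 s t x) has_real_derivative 2 * s * Theta' T t * \<psi> x * e2 s t x) (at t)"
  unfolding e2_def[abs_def] by (auto intro!: derivative_eq_intros Theta_deriv)

lemma e2_cont: "continuous_on {0<..<T} (\<lambda>t. e2 s t x)"
  unfolding e2_def by (intro continuous_intros Theta_cont)

lemma e2_le: "s > 0 \<Longrightarrow> 0 < x \<Longrightarrow> x < 1 \<Longrightarrow> \<exists>k>0. \<forall>t. 0 < t \<longrightarrow> t < T \<longrightarrow> \<bar>e2 s t x\<bar> \<le> exp (- k * Theta T t)"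
proof -
  assume s: "s > 0" and x: "0 < x" "x < 1"
  obtain \<kappa> where kap: "\<kappa> > 0" "\<And>x. 0 \<le> x \<Longrightarrow> x \<le> 1 \<Longrightarrow> \<psi> x \<le> - \<kappa>" using psi_neg by blast
  have "\<psi> x < 0" using kap(2)[of x] kap(1) x by simp
  thus ?thesis using s by (intro exI[of _ "- (2 * s * \<psi> x)"]) (auto simp: e2_def mult_pos_neg mult_ac)
qed

text \<open>Primitives in \<open>t\<close> are available for \<open>v\<close> and
  \<open>v_x\<close>, so the energy is treated as three products of these, with coefficients
  differentiable in \<open>t\<close> that tend to 0 at both ends.\<close>

lemma Pt_integral_zero:
  assumes s: "s > 0" shows "(\<integral>z. PtQ s z \<partial>QM) = 0"
proof -
  let ?v = "\<lambda>z. v (fst z) (snd z)" and ?vx = "\<lambda>z. vx (fst z) (snd z)" and ?U = "\<lambda>z. U (fst z) (snd z)" and ?Ux = "\<lambda>z. Ux (fst z) (snd z)"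
  \<comment> \<open>\<open>?c1\<close>, \<open>?c2\<close>, \<open>?c3\<close> are the coefficients
    of \<open>v_x^2\<close>, \<open>v v_x\<close>, \<open>v^2\<close> in the energy, and
    \<open>?d1\<close>, \<open>?d2\<close>, \<open>?d3\<close> their time derivatives.\<close>
  let ?c1 = "\<lambda>t x. - 1 / 2 * e2 s t x" and ?d1 = "\<lambda>t x. - 1 / 2 * (2 * s * Theta' T t * \<psi> x * e2 s t x)"
  let ?c2 = "\<lambda>t x. - (s * d1 * r x) * (Theta T t * e2 s t x)"
  let ?d2 = "\<lambda>t x. - (s * d1 * r x) * (Theta' T t * e2 s t x + Theta T t * (2 * s * Theta' T t * \<psi> x * e2 s t x))"
  let ?c3 = "\<lambda>t x. - (s * \<psi> x / a x / 2) * (Theta' T t * e2 s t x)"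
  let ?d3 = "\<lambda>t x. - (s * \<psi> x / a x / 2) * (Theta'' T t * e2 s t x + Theta' T t * (2 * s * Theta' T t * \<psi> x * e2 s t x))"
  let ?I = "\<lambda>c d u1 w1 u2 w2 z. d (fst z) (snd z) * (u1 z * u2 z) + c (fst z) (snd z) * (w1 z * u2 z + u1 z * w2 z)"
  have [measurable]: "(\<lambda>z. e2 s (fst z) (snd z)) \<in> borel_measurable QM" unfolding e2_def by measurable
  have i1: "integrable QM (?I ?c1 ?d1 ?vx ?Ux ?vx ?Ux)"
  proof (rule integrable_cong_AE_imp)
    show "integrable QM (\<lambda>z. (- s) * ((th' z * (\<psi> (snd z) * \<beta> s z)) * \<beta> s z) - \<epsilon> s z * \<beta> s z)"
      by (intro Bochner_Integration.integrable_diff integrable_mult_right rapid_prod_integrable rapid_Theta' rapid_psi rapid_basic s)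
    show "?I ?c1 ?d1 ?vx ?Ux ?vx ?Ux \<in> borel_measurable QM" by measurable
    show "AE z in QM. (- s) * ((th' z * (\<psi> (snd z) * \<beta> s z)) * \<beta> s z) - \<epsilon> s z * \<beta> s z = ?I ?c1 ?d1 ?vx ?Ux ?vx ?Ux z"
      by (intro AE_I2) (simp add: e2_en \<beta>_def \<epsilon>_def algebra_simps)
  qed
  have i2: "integrable QM (?I ?c2 ?d2 ?v ?U ?vx ?Ux)"
  proof (rule integrable_cong_AE_imp)
    show "integrable QM (\<lambda>z. (- (s * d1)) * ((th' z * \<zeta> s z) * \<beta> s z) - 2 * s\<^sup>2 * d1 * ((th z * \<zeta> s z) * (th' z * (\<psi> (snd z) * \<beta> s z)))
        - s * d1 * ((th z * \<eta> s z) * \<beta> s z) - s * d1 * ((th z * \<zeta> s z) * \<epsilon> s z))"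
      by (intro Bochner_Integration.integrable_diff integrable_mult_right rapid_prod_integrable rapid_Theta rapid_Theta' rapid_psi rapid_basic s)
    show "?I ?c2 ?d2 ?v ?U ?vx ?Ux \<in> borel_measurable QM" by measurable
    show "AE z in QM. (- (s * d1)) * ((th' z * \<zeta> s z) * \<beta> s z) - 2 * s\<^sup>2 * d1 * ((th z * \<zeta> s z) * (th' z * (\<psi> (snd z) * \<beta> s z)))
        - s * d1 * ((th z * \<eta> s z) * \<beta> s z) - s * d1 * ((th z * \<zeta> s z) * \<epsilon> s z) = ?I ?c2 ?d2 ?v ?U ?vx ?Ux z"
      by (intro AE_I2) (simp add: e2_en \<beta>_def \<epsilon>_def \<zeta>_def \<eta>_def algebra_simps power2_eq_square)
  qed
  have i3: "integrable QM (?I ?c3 ?d3 ?v ?U ?v ?U)"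
  proof (rule integrable_cong_AE_imp)
    show "integrable QM (\<lambda>z. (- (s / 2)) * ((th'' z * \<alpha> s z) * (\<psi> (snd z) * \<alpha> s z)) - s\<^sup>2 * ((th' z * (\<psi> (snd z) * \<alpha> s z)) * (th' z * (\<psi> (snd z) * \<alpha> s z)))
        - s * ((th' z * (\<psi> (snd z) * \<alpha> s z)) * \<delta> s z))"
      by (intro Bochner_Integration.integrable_diff integrable_mult_right rapid_prod_integrable rapid_Theta' rapid_Theta'' rapid_psi rapid_basic s)
    show "?I ?c3 ?d3 ?v ?U ?v ?U \<in> borel_measurable QM" by measurable
    show "AE z in QM. (- (s / 2)) * ((th'' z * \<alpha> s z) * (\<psi> (snd z) * \<alpha> s z)) - s\<^sup>2 * ((th' z * (\<psi> (snd z) * \<alpha> s z)) * (th' z * (\<psi> (snd z) * \<alpha> s z)))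
        - s * ((th' z * (\<psi> (snd z) * \<alpha> s z)) * \<delta> s z) = ?I ?c3 ?d3 ?v ?U ?v ?U z"
      using AE_Q_pos
    proof eventually_elim
      case (elim z)
      define k where "k = sqrt (a (snd z))"
      have k: "k > 0" "a (snd z) = k * k" using elim by (auto simp: k_def)
      show ?case
        unfolding e2_en \<alpha>_def \<delta>_def k_def[symmetric] k(2)
        using k(1) by (simp add: divide_simps) (simp add: algebra_simps power2_eq_square)
    qed
  qed
  have z1: "(\<integral>z. ?I ?c1 ?d1 ?vx ?Ux ?vx ?Ux z \<partial>QM) = 0"
  proof (rule integral_time_derivative_zero[OF T meas(5) meas(5) L1(2) L1(2) repx repx])
    fix t x :: real assume "0 < t" "t < T" "0 < x" "x < 1"
    thus "((\<lambda>t. ?c1 t x) has_real_derivative ?d1 t x) (at t)" by (intro DERIV_cmult e2_deriv)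
  next
    fix x :: real assume x: "0 < x" "x < 1"
    show "continuous_on {0<..<T} (\<lambda>t. ?d1 t x)" by (intro continuous_intros e2_cont Theta'_cont)
    obtain k where k: "k > 0" "\<And>t. 0 < t \<Longrightarrow> t < T \<Longrightarrow> \<bar>e2 s t x\<bar> \<le> exp (- k * Theta T t)" using e2_le[OF s x] by blast
    have "\<bar>?c1 t x\<bar> \<le> 1 / 2 * (Theta T t ^ 0 * exp (- k * Theta T t))" if "0 < t" "t < T" for t
      using k(2)[OF that] by (simp add: abs_mult)
    from Theta_null_comparison[OF T k(1) this]
    show "((\<lambda>t. ?c1 t x) \<longlongrightarrow> 0) (at_right 0)" "((\<lambda>t. ?c1 t x) \<longlongrightarrow> 0) (at_left T)" by blast+
  next
    show "integrable QM (\<lambda>(t, x). ?d1 t x * (vx t x * vx t x) + ?c1 t x * (Ux t x * vx t x + vx t x * Ux t x))"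
      using i1 by (simp add: case_prod_unfold)
  qed
  have z2: "(\<integral>z. ?I ?c2 ?d2 ?v ?U ?vx ?Ux z \<partial>QM) = 0"
  proof (rule integral_time_derivative_zero[OF T meas(4) meas(5) L1(1) L1(2) repv repx])
    fix t x :: real assume t: "0 < t" "t < T" "0 < x" "x < 1"
    have "((\<lambda>t. ?c2 t x) has_real_derivative - (s * d1 * r x) * (Theta' T t * e2 s t x + (2 * s * Theta' T t * \<psi> x * e2 s t x) * Theta T t)) (at t)"
      by (intro DERIV_cmult DERIV_mult e2_deriv Theta_deriv t)
    thus "((\<lambda>t. ?c2 t x) has_real_derivative ?d2 t x) (at t)" by (simp add: mult.commute)
  next
    fix x :: real assume x: "0 < x" "x < 1"
    show "continuous_on {0<..<T} (\<lambda>t. ?d2 t x)" by (intro continuous_intros e2_cont Theta'_cont Theta_cont)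
    obtain k where k: "k > 0" "\<And>t. 0 < t \<Longrightarrow> t < T \<Longrightarrow> \<bar>e2 s t x\<bar> \<le> exp (- k * Theta T t)" using e2_le[OF s x] by blast
    have "\<bar>?c2 t x\<bar> \<le> \<bar>s * d1 * r x\<bar> * (Theta T t ^ 1 * exp (- k * Theta T t))" if "0 < t" "t < T" for t
    proof -
      have "\<bar>?c2 t x\<bar> = \<bar>s * d1 * r x\<bar> * (Theta T t * \<bar>e2 s t x\<bar>)" using Theta_pos[OF that] by (simp add: abs_mult)
      also have "\<dots> \<le> \<bar>s * d1 * r x\<bar> * (Theta T t * exp (- k * Theta T t))"
        using k(2)[OF that] Theta_pos[OF that] by (intro mult_left_mono) auto
      finally show ?thesis by simp
    qed
    from Theta_null_comparison[OF T k(1) this]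
    show "((\<lambda>t. ?c2 t x) \<longlongrightarrow> 0) (at_right 0)" "((\<lambda>t. ?c2 t x) \<longlongrightarrow> 0) (at_left T)" by blast+
  next
    show "integrable QM (\<lambda>(t, x). ?d2 t x * (v t x * vx t x) + ?c2 t x * (U t x * vx t x + v t x * Ux t x))"
      using i2 by (simp add: case_prod_unfold)
  qed
  have z3: "(\<integral>z. ?I ?c3 ?d3 ?v ?U ?v ?U z \<partial>QM) = 0"
  proof (rule integral_time_derivative_zero[OF T meas(4) meas(4) L1(1) L1(1) repv repv])
    fix t x :: real assume t: "0 < t" "t < T" "0 < x" "x < 1"
    have "((\<lambda>t. ?c3 t x) has_real_derivative - (s * \<psi> x / a x / 2) * (Theta'' T t * e2 s t x + (2 * s * Theta' T t * \<psi> x * e2 s t x) * Theta' T t)) (at t)"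
      by (intro DERIV_cmult DERIV_mult e2_deriv Theta'_deriv t)
    thus "((\<lambda>t. ?c3 t x) has_real_derivative ?d3 t x) (at t)" by (simp only: mult.commute)
  next
    fix x :: real assume x: "0 < x" "x < 1"
    show "continuous_on {0<..<T} (\<lambda>t. ?d3 t x)"
      by (intro continuous_on_mult continuous_on_add continuous_on_const e2_cont Theta'_cont Theta''_cont)
    obtain k where k: "k > 0" "\<And>t. 0 < t \<Longrightarrow> t < T \<Longrightarrow> \<bar>e2 s t x\<bar> \<le> exp (- k * Theta T t)" using e2_le[OF s x] by blast
    have "\<bar>?c3 t x\<bar> \<le> \<bar>s * \<psi> x / a x / 2\<bar> * cTheta T * (Theta T t ^ 2 * exp (- k * Theta T t))" if "0 < t" "t < T" for t
    proof -
      have "\<bar>?c3 t x\<bar> = \<bar>s * \<psi> x / a x / 2\<bar> * (\<bar>Theta' T t\<bar> * \<bar>e2 s t x\<bar>)" by (simp only: abs_mult abs_minus_cancel)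
      also have "\<dots> \<le> \<bar>s * \<psi> x / a x / 2\<bar> * (cTheta T * (Theta T t)\<^sup>2 * exp (- k * Theta T t))"
        using k(2)[OF that] Theta_derivs_bound(1)[OF that] by (intro mult_left_mono mult_mono) auto
      finally show ?thesis by (simp only: mult.assoc)
    qed
    from Theta_null_comparison[OF T k(1) this]
    show "((\<lambda>t. ?c3 t x) \<longlongrightarrow> 0) (at_right 0)" "((\<lambda>t. ?c3 t x) \<longlongrightarrow> 0) (at_left T)" by blast+
  next
    show "integrable QM (\<lambda>(t, x). ?d3 t x * (v t x * v t x) + ?c3 t x * (U t x * v t x + v t x * U t x))"
      using i3 by (simp add: case_prod_unfold)
  qed
  have "PtQ s z = ?I ?c1 ?d1 ?vx ?Ux ?vx ?Ux z + ?I ?c2 ?d2 ?v ?U ?vx ?Ux z + ?I ?c3 ?d3 ?v ?U ?v ?U z" for z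
    unfolding e2_en Pt_def Gf_def zf_def ztf_def wf_def wtf_def
    unfolding divide_inverse[of _ "a (snd z)"] by (rule energy_derivative_identity)
  hence "(\<integral>z. PtQ s z \<partial>QM) = (\<integral>z. ?I ?c1 ?d1 ?vx ?Ux ?vx ?Ux z + ?I ?c2 ?d2 ?v ?U ?vx ?Ux z + ?I ?c3 ?d3 ?v ?U ?v ?U z \<partial>QM)"
    by simp
  also have "\<dots> = (\<integral>z. ?I ?c1 ?d1 ?vx ?Ux ?vx ?Ux z \<partial>QM) + (\<integral>z. ?I ?c2 ?d2 ?v ?U ?vx ?Ux z \<partial>QM) + (\<integral>z. ?I ?c3 ?d3 ?v ?U ?v ?U z \<partial>QM)"
    by (subst Bochner_Integration.integral_add[OF Bochner_Integration.integrable_add[OF i1 i2] i3],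
        subst Bochner_Integration.integral_add[OF i1 i2], rule refl)
  finally show ?thesis unfolding z1 z2 z3 by simp
qed

end

section \<open>The estimate for solutions\<close>

context carleman_solution begin

text \<open>\<open>k \<integral>G \<le> \<integral>DD = \<integral>Lp Lm + \<integral>BT\<close>,
  the time derivative having integral 0, and \<open>4 \<integral>Lp Lm \<le> \<integral>H\<close>.
  It remains to return from \<open>w\<close> to \<open>v\<close> and, in the boundary term, from
  \<open>p\<close> to \<open>x - x0\<close>.\<close>

lemma main_estimate:
  assumes s: "s > 0" and k: "k > 0"
    and coer: "\<And>t. 0 < t \<Longrightarrow> t < T \<Longrightarrow> coercive_form k (s * Theta T t) (s * Theta' T t) (s * Theta'' T t)"
    and hm: "(\<lambda>z. h (fst z) (snd z)) \<in> borel_measurable QM"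
    and heq: "AE z in QM. U (fst z) (snd z) + a (snd z) * vxx (fst z) (snd z) = h (fst z) (snd z)"
  shows "(\<integral>\<^sup>+z. ennreal ((s * th z * (vx (fst z) (snd z))\<^sup>2 + s ^ 3 * th z ^ 3 * ((snd z - x0) / a (snd z))\<^sup>2 * (v (fst z) (snd z))\<^sup>2)
        * e2 s (fst z) (snd z)) \<partial>QM)
    \<le> ennreal ((2 + 2 * d1\<^sup>2) / k * exp R) * ((\<integral>\<^sup>+z. ennreal ((h (fst z) (snd z))\<^sup>2 * e2 s (fst z) (snd z) / a (snd z)) \<partial>QM)
        + ennreal (s * d1) * (\<integral>\<^sup>+t. ennreal (Theta T t * e2 s t 1 * (1 - x0) * (vx t 1)\<^sup>2 - Theta T t * e2 s t 0 * (0 - x0) * (vx t 0)\<^sup>2) \<partial>IM 0 T))"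
proof -
  note [measurable] = comp_meas hm
  define F where "F z = LpQ s z * LmQ s z - PtQ s z - DDQ s z" for z
  define BT where "BT t = s * Theta T t * d1 * (p 1 * (ew (s * Theta T t) 1 * vx t 1)\<^sup>2 - p 0 * (ew (s * Theta T t) 0 * vx t 0)\<^sup>2)" for t
  define g where "g t = Theta T t * e2 s t 1 * (1 - x0) * (vx t 1)\<^sup>2 - Theta T t * e2 s t 0 * (0 - x0) * (vx t 0)\<^sup>2" for t
  define G where "G z = s * th z * (zQ s z)\<^sup>2 + (s * th z) ^ 3 * (r (snd z) * wQ s z)\<^sup>2" for z
  define H where "H z = (en s z * (U (fst z) (snd z) + a (snd z) * vxx (fst z) (snd z)))\<^sup>2 / a (snd z)" for z
  have rw: "r (snd z) * wQ s z = \<zeta> s z" for z by (simp add: wf_def \<zeta>_def)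
  note LLi = LL_integrable[OF s] and Pti = Pt_integrable[OF s] and DDi = DD_integrable[OF s]
  have iF: "integrable QM F" unfolding F_def using LLi Pti DDi by (intro Bochner_Integration.integrable_diff)
  have trace_meas: "(\<lambda>t. vx t x) \<in> borel_measurable (IM 0 T)" for x
    by (rule measurable_IM[OF measurable_section_snd[OF meas(2)]])
  note [measurable] = trace_meas
  have BTm [measurable]: "BT \<in> borel_measurable (IM 0 T)" unfolding BT_def[abs_def] ew_def by measurable
  have gm [measurable]: "g \<in> borel_measurable (IM 0 T)" unfolding g_def[abs_def] e2_def by measurable
  have v2: "AE t in IM 0 T. integrable (IM 0 1) (\<lambda>x. (v t x)\<^sup>2 / a x)"
    using Q.AE_integrable_fst'[OF L2a(1)] by simp
  have idt: "AE t in IM 0 T. (\<integral>x. F (t, x) \<partial>IM 0 1) = - BT t"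
    using ac bc v2 Q.AE_integrable_fst'[OF iF]
  proof eventually_elim
    case (elim t)
    show ?case
      using carleman_identity_1d[OF elim(1,2,3,5) _ _ _ _, of "s * Theta T t" "s * Theta' T t" "s * Theta'' T t"] elim(4,6)
      by (simp add: F_def BT_def)
  qed
  have BTi: "integrable (IM 0 T) BT"
  proof (rule integrable_cong_AE_imp[OF _ BTm])
    show "integrable (IM 0 T) (\<lambda>t. - (\<integral>x. F (t, x) \<partial>IM 0 1))" using Q.integrable_fst'[OF iF] by simp
    show "AE t in IM 0 T. - (\<integral>x. F (t, x) \<partial>IM 0 1) = BT t" using idt by eventually_elim simp
  qed
  have "(\<integral>z. F z \<partial>QM) = (\<integral>t. (\<integral>x. F (t, x) \<partial>IM 0 1) \<partial>IM 0 T)" using Q.integral_fst'[OF iF] by simp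
  also have "\<dots> = (\<integral>t. - BT t \<partial>IM 0 T)" using idt Q.integrable_fst'[OF iF] by (intro integral_cong_AE) auto
  finally have FB: "(\<integral>z. F z \<partial>QM) = - (\<integral>t. BT t \<partial>IM 0 T)" by simp
  have "(\<integral>z. F z \<partial>QM) = (\<integral>z. LpQ s z * LmQ s z \<partial>QM) - (\<integral>z. PtQ s z \<partial>QM) - (\<integral>z. DDQ s z \<partial>QM)"
    unfolding F_def
    by (subst Bochner_Integration.integral_diff[OF Bochner_Integration.integrable_diff[OF LLi Pti] DDi],
        subst Bochner_Integration.integral_diff[OF LLi Pti], rule refl)
  hence DJ: "(\<integral>z. DDQ s z \<partial>QM) = (\<integral>z. LpQ s z * LmQ s z \<partial>QM) + (\<integral>t. BT t \<partial>IM 0 T)"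
    using FB Pt_integral_zero[OF s] by simp
  have iz: "integrable QM (\<lambda>z. (zQ s z)\<^sup>2)"
    using rapid_prod_integrable[OF rapid_z[OF s] rapid_z[OF s]] by (simp add: power2_eq_square)
  have iw: "integrable QM (\<lambda>z. (r (snd z) * wQ s z)\<^sup>2)"
    unfolding rw using rapid_prod_integrable[OF rapid_basic(6)[OF s] rapid_basic(6)[OF s]] by (simp add: power2_eq_square)
  have iwa: "integrable QM (\<lambda>z. (wQ s z)\<^sup>2 / a (snd z))"
  proof (rule integrable_cong_AE_imp[OF rapid_prod_integrable[OF rapid_basic(1)[OF s] rapid_basic(1)[OF s]]])
    show "(\<lambda>z. (wQ s z)\<^sup>2 / a (snd z)) \<in> borel_measurable QM" by measurable
    show "AE z in QM. \<alpha> s z * \<alpha> s z = (wQ s z)\<^sup>2 / a (snd z)"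
      using AE_Q_pos by eventually_elim (simp add: \<alpha>_def wf_def power2_eq_square)
  qed
  have iG: "integrable QM G"
  proof -
    have "integrable QM (\<lambda>z. s * ((th z * zQ s z) * zQ s z) + s ^ 3 * ((th z * (th z * (th z * \<zeta> s z))) * \<zeta> s z))"
      by (intro Bochner_Integration.integrable_add integrable_mult_right rapid_prod_integrable rapid_Theta rapid_basic rapid_z s)
    thus ?thesis unfolding G_def[abs_def] rw
      by (simp add: power2_eq_square power3_eq_cube mult_ac)
  qed
  have kS: "k * (\<integral>z. G z \<partial>QM) \<le> (\<integral>z. DDQ s z \<partial>QM)"
  proof -
    have "k * (\<integral>z. G z \<partial>QM) = (\<integral>t. k * (\<integral>x. G (t, x) \<partial>IM 0 1) \<partial>IM 0 T)"
      using Q.integral_fst'[OF iG] by simp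
    also have "\<dots> \<le> (\<integral>t. (\<integral>x. DDQ s (t, x) \<partial>IM 0 1) \<partial>IM 0 T)"
    proof (rule integral_mono_AE)
      show "integrable (IM 0 T) (\<lambda>t. k * (\<integral>x. G (t, x) \<partial>IM 0 1))" using Q.integrable_fst'[OF iG] by simp
      show "integrable (IM 0 T) (\<lambda>t. \<integral>x. DDQ s (t, x) \<partial>IM 0 1)" by (rule Q.integrable_fst'[OF DDi])
      show "AE t in IM 0 T. k * (\<integral>x. G (t, x) \<partial>IM 0 1) \<le> (\<integral>x. DDQ s (t, x) \<partial>IM 0 1)"
        using ac(1,2) bc v2 Q.AE_integrable_fst'[OF iz] Q.AE_integrable_fst'[OF iw] Q.AE_integrable_fst'[OF iwa]
          Q.AE_integrable_fst'[OF DDi] AE_space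
      proof eventually_elim
        case (elim t)
        let ?w = "wf (s * Theta T t) (v t)" and ?z = "zf (s * Theta T t) (v t) (vx t)"
        have t: "0 < t" "t < T" using elim(9) by auto
        note c = ac_on_continuous[OF elim(2)]
        have i: "integrable (IM 0 1) (\<lambda>x. (?z x)\<^sup>2)" "integrable (IM 0 1) (\<lambda>x. (r x * ?w x)\<^sup>2)" using elim(5,6) by simp_all
        have "(\<integral>x. G (t, x) \<partial>IM 0 1) = s * Theta T t * (\<integral>x. (?z x)\<^sup>2 \<partial>IM 0 1) + (s * Theta T t) ^ 3 * (\<integral>x. (r x * ?w x)\<^sup>2 \<partial>IM 0 1)"
          unfolding G_def fst_conv snd_conv
          by (subst Bochner_Integration.integral_add) (use i in \<open>auto intro!: integrable_mult_right\<close>)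
        moreover have "k * (s * Theta T t * (\<integral>x. (?z x)\<^sup>2 \<partial>IM 0 1) + (s * Theta T t) ^ 3 * (\<integral>x. (r x * ?w x)\<^sup>2 \<partial>IM 0 1))
           \<le> (\<integral>x. DD (s * Theta T t) (s * Theta' T t) (s * Theta'' T t) ?w ?z x \<partial>IM 0 1)"
        proof (rule coer[OF t, unfolded coercive_form_def, rule_format, OF wf_ac[OF elim(1) c elim(4)] zf_cont[OF elim(1) c elim(4)]])
          show "?w 0 = 0" "?w 1 = 0" using elim(3) by (simp_all add: wf_def)
        qed (use elim(6,7,8) in simp_all)
        ultimately show ?case by simp
      qed
    qed
    also have "\<dots> = (\<integral>z. DDQ s z \<partial>QM)" using Q.integral_fst'[OF DDi] by simp
    finally show ?thesis .
  qed
  have iH: "integrable QM H"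
  proof (rule integrable_cong_AE_imp)
    have "rapid T (\<lambda>z. \<delta> s z + \<gamma> s z)" by (intro rapid_add rapid_basic s)
    thus "integrable QM (\<lambda>z. (\<delta> s z + \<gamma> s z) * (\<delta> s z + \<gamma> s z))" by (intro rapid_prod_integrable)
    show "H \<in> borel_measurable QM" unfolding H_def[abs_def] by measurable
    show "AE z in QM. (\<delta> s z + \<gamma> s z) * (\<delta> s z + \<gamma> s z) = H z"
      using AE_Q_pos
    proof eventually_elim
      case (elim z)
      define k where "k = sqrt (a (snd z))"
      have k: "k > 0" "a (snd z) = k * k" using elim by (auto simp: k_def)
      show ?case unfolding \<delta>_def \<gamma>_def H_def k_def[symmetric] k(2)
        using k(1) by (simp add: divide_simps) (simp add: algebra_simps power2_eq_square)
    qed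
  qed
  have JH: "4 * (\<integral>z. LpQ s z * LmQ s z \<partial>QM) \<le> (\<integral>z. H z \<partial>QM)"
  proof -
    have "4 * (\<integral>z. LpQ s z * LmQ s z \<partial>QM) = (\<integral>z. 4 * (LpQ s z * LmQ s z) \<partial>QM)" by simp
    also have "\<dots> \<le> (\<integral>z. H z \<partial>QM)"
    proof (rule integral_mono_AE[OF _ iH])
      show "integrable QM (\<lambda>z. 4 * (LpQ s z * LmQ s z))" using LLi by simp
      show "AE z in QM. 4 * (LpQ s z * LmQ s z) \<le> H z"
        using AE_Q_pos by eventually_elim (unfold H_def, intro Lp_Lm_le, auto)
    qed
    finally show ?thesis .
  qed
  \<comment> \<open>Both traces count positively because \<open>0 - x0 < 0\<close>, so
    \<open>ennreal\<close> truncates nothing in the boundary term.\<close>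
  have g0: "g t \<ge> 0" if "0 < t" "t < T" for t
    using Theta_pos[OF that] x0 by (simp add: g_def e2_def add_nonneg_nonneg)
  have BTg: "0 \<le> BT t" "BT t \<le> exp R * (s * d1) * g t" if t: "0 < t" "t < T" for t
  proof -
    have e: "e2 s t x = ew (s * Theta T t) x * ew (s * Theta T t) x" for x
      using e2_en[of s "(t, x)"] by simp
    let ?A = "Theta T t * e2 s t 1 * (1 - x0) * (vx t 1)\<^sup>2" and ?B = "Theta T t * e2 s t 0 * x0 * (vx t 0)\<^sup>2"
    have BT: "BT t = s * d1 * (E 1 * ?A + E 0 * ?B)"
      by (simp add: BT_def p_def e power2_eq_square algebra_simps)
    have AB: "?A \<ge> 0" "?B \<ge> 0" using Theta_pos[OF t] x0 by (auto simp: e2_def)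
    have "0 \<le> E 1 * ?A + E 0 * ?B"
      by (intro add_nonneg_nonneg mult_nonneg_nonneg[OF less_imp_le[OF E_pos]] AB)
    moreover have "0 \<le> s * d1" using s d1 by simp
    ultimately show "0 \<le> BT t" unfolding BT by (rule mult_nonneg_nonneg[rotated])
    \<comment> \<open>\<open>p\<close> carries the factor \<open>E \<le> exp R\<close>; this is the
      source of \<open>exp R\<close> in the constant.\<close>
    have "E 1 * ?A + E 0 * ?B \<le> exp R * ?A + exp R * ?B"
      using E_le[of 1] E_le[of 0] AB by (intro add_mono mult_right_mono) auto
    hence "s * d1 * (E 1 * ?A + E 0 * ?B) \<le> s * d1 * (exp R * ?A + exp R * ?B)"
      using s d1 by (intro mult_left_mono) auto
    also have "\<dots> = exp R * (s * d1) * g t" by (simp add: g_def algebra_simps)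
    finally show "BT t \<le> exp R * (s * d1) * g t" unfolding BT .
  qed
  have G0: "AE z in QM. G z \<ge> 0"
    using AE_Q_pos by eventually_elim (use Theta_pos s in \<open>auto simp: G_def less_imp_le\<close>)
  have H0: "AE z in QM. H z \<ge> 0" using AE_Q_pos by eventually_elim (auto simp: H_def)
  have BT0: "AE t in IM 0 T. BT t \<ge> 0" using AE_space by eventually_elim (use BTg(1) in auto)
  \<comment> \<open>From \<open>e^{s\<phi>} v_x = w_x - s \<Theta> d1 r w\<close>: its square is at
    most \<open>2 w_x^2 + 2 (s \<Theta> d1)^2 (r w)^2\<close>. The zeroth-order term adds 1 to the
    second coefficient.\<close>
  let ?c = "2 + 2 * d1\<^sup>2"
  let ?S = "\<integral>z. G z \<partial>QM" and ?H = "\<integral>z. H z \<partial>QM" and ?B = "\<integral>t. BT t \<partial>IM 0 T"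
  have HB: "?H \<ge> 0" "?B \<ge> 0" using H0 BT0 by (auto intro: integral_nonneg_AE)
  have S: "?c * ?S \<le> ?c / k * (?H + ?B)"
  proof -
    \<comment> \<open>Since \<open>?H \<ge> 0\<close>, the factor 4 in \<open>JH\<close> may be
      dropped.\<close>
    have "k * ?S \<le> ?H + ?B" using kS DJ JH HB by linarith
    hence "?S \<le> (?H + ?B) / k" using k by (simp add: pos_le_divide_eq mult.commute)
    hence "?c * ?S \<le> ?c * ((?H + ?B) / k)" by (intro mult_left_mono) auto
    thus ?thesis by simp
  qed
  have "(\<integral>\<^sup>+z. ennreal ((s * th z * (vx (fst z) (snd z))\<^sup>2 + s ^ 3 * th z ^ 3 * ((snd z - x0) / a (snd z))\<^sup>2 * (v (fst z) (snd z))\<^sup>2)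
        * e2 s (fst z) (snd z)) \<partial>QM) \<le> (\<integral>\<^sup>+z. ennreal (?c * G z) \<partial>QM)"
  proof (rule nn_integral_mono_AE)
    show "AE z in QM. ennreal ((s * th z * (vx (fst z) (snd z))\<^sup>2 + s ^ 3 * th z ^ 3 * ((snd z - x0) / a (snd z))\<^sup>2 * (v (fst z) (snd z))\<^sup>2)
        * e2 s (fst z) (snd z)) \<le> ennreal (?c * G z)"
      using AE_Q_pos
    proof eventually_elim
      case (elim z)
      let ?e = "en s z" and ?V = "v (fst z) (snd z)" and ?Vx = "vx (fst z) (snd z)" and ?\<mu> = "(snd z - x0) / a (snd z)"
      have th0: "th z > 0" using elim Theta_pos by auto
      have st: "s * th z > 0" using th0 s by simp
      have 1: "(?e * ?Vx)\<^sup>2 \<le> 2 * (zQ s z)\<^sup>2 + 2 * (s * th z * d1)\<^sup>2 * (\<zeta> s z)\<^sup>2"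
      proof -
        have "?e * ?Vx = zQ s z - s * th z * d1 * \<zeta> s z" by (simp add: zf_def \<zeta>_def algebra_simps)
        moreover have "(A - c * B)\<^sup>2 \<le> 2 * A\<^sup>2 + 2 * c\<^sup>2 * B\<^sup>2" for A B c :: real
          using zero_le_power2[of "A + c * B"] by (simp add: power2_eq_square algebra_simps)
        ultimately show ?thesis by (simp only:)
      qed
      have 2: "(?\<mu> * (?e * ?V))\<^sup>2 \<le> (\<zeta> s z)\<^sup>2"
      proof -
        have "r (snd z) = E (snd z) * ?\<mu>" by (simp add: r_def p_def)
        hence "\<bar>?\<mu>\<bar> \<le> \<bar>r (snd z)\<bar>"
          using mult_right_mono[OF E_ge_1[of "snd z"], of "\<bar>?\<mu>\<bar>"] E_ge_1[of "snd z"] by (simp add: abs_mult)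
        hence "\<bar>?\<mu>\<bar> * \<bar>?e * ?V\<bar> \<le> \<bar>r (snd z)\<bar> * \<bar>?e * ?V\<bar>" by (rule mult_right_mono) simp
        hence "\<bar>?\<mu> * (?e * ?V)\<bar> \<le> \<bar>\<zeta> s z\<bar>" by (simp add: abs_mult \<zeta>_def mult_ac)
        thus ?thesis by (rule abs_le_square_iff[THEN iffD1])
      qed
      have "(s * th z * ?Vx\<^sup>2 + s ^ 3 * th z ^ 3 * ?\<mu>\<^sup>2 * ?V\<^sup>2) * e2 s (fst z) (snd z)
        = s * th z * (?e * ?Vx)\<^sup>2 + (s * th z) ^ 3 * (?\<mu> * (?e * ?V))\<^sup>2"
        unfolding e2_en by (simp only: power_mult_distrib power2_eq_square distrib_left distrib_right mult_ac)
      also have "\<dots> \<le> s * th z * (2 * (zQ s z)\<^sup>2 + 2 * (s * th z * d1)\<^sup>2 * (\<zeta> s z)\<^sup>2) + (s * th z) ^ 3 * (\<zeta> s z)\<^sup>2"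
        using st by (intro add_mono mult_left_mono 1 2) auto
      also have "\<dots> = 2 * (s * th z * (zQ s z)\<^sup>2) + (2 * d1\<^sup>2 + 1) * ((s * th z) ^ 3 * (\<zeta> s z)\<^sup>2)"
        by (simp add: algebra_simps power2_eq_square power3_eq_cube)
      also have "\<dots> \<le> ?c * (s * th z * (zQ s z)\<^sup>2) + ?c * ((s * th z) ^ 3 * (\<zeta> s z)\<^sup>2)"
      proof -
        have "2 * X + (2 * D + 1) * Y \<le> (2 + 2 * D) * X + (2 + 2 * D) * Y" if "0 \<le> X" "0 \<le> Y" "0 \<le> D" for X Y D :: real
          using mult_nonneg_nonneg[OF that(3,1)] that by (simp add: algebra_simps)
        thus ?thesis using st by simp
      qed
      also have "\<dots> = ?c * G z" by (simp add: G_def rw distrib_left)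
      finally show ?case by (rule ennreal_leI)
    qed
  qed
  also have "\<dots> = ennreal (?c * ?S)"
  proof -
    have "(\<integral>\<^sup>+z. ennreal (?c * G z) \<partial>QM) = ennreal (\<integral>z. ?c * G z \<partial>QM)"
      by (rule nn_integral_eq_integral) (use iG G0 in auto)
    thus ?thesis by simp
  qed
  also have "\<dots> \<le> ennreal (?c / k * (?H + ?B))" by (rule ennreal_leI[OF S])
  also have "\<dots> = ennreal (?c / k) * (ennreal ?H + ennreal ?B)"
  proof -
    have "ennreal (c * (x + y)) = ennreal c * (ennreal x + ennreal y)" if "0 \<le> x" "0 \<le> y" "0 \<le> c" for c x y :: real
      using that by (simp add: ennreal_mult)
    moreover have "0 \<le> ?c / k" using k by simp
    ultimately show ?thesis using HB by blast
  qed
  also have "\<dots> \<le> ennreal (?c / k) * (ennreal (exp R) * (\<integral>\<^sup>+z. ennreal ((h (fst z) (snd z))\<^sup>2 * e2 s (fst z) (snd z) / a (snd z)) \<partial>QM)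
      + ennreal (exp R) * (ennreal (s * d1) * (\<integral>\<^sup>+t. ennreal (g t) \<partial>IM 0 T)))"
  proof (rule mult_left_mono[OF add_mono])
    have "ennreal ?H = (\<integral>\<^sup>+z. ennreal (H z) \<partial>QM)"
      by (rule nn_integral_eq_integral[symmetric]) (use iH H0 in auto)
    also have "\<dots> = (\<integral>\<^sup>+z. ennreal ((h (fst z) (snd z))\<^sup>2 * e2 s (fst z) (snd z) / a (snd z)) \<partial>QM)"
      using heq by (intro nn_integral_cong_AE, eventually_elim) (auto simp: H_def e2_en power2_eq_square mult_ac)
    \<comment> \<open>The factor \<open>exp R \<ge> 1\<close> is inserted so that both terms share
      one constant.\<close>
    also have "\<dots> = 1 * (\<integral>\<^sup>+z. ennreal ((h (fst z) (snd z))\<^sup>2 * e2 s (fst z) (snd z) / a (snd z)) \<partial>QM)" by simp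
    also have "\<dots> \<le> ennreal (exp R) * (\<integral>\<^sup>+z. ennreal ((h (fst z) (snd z))\<^sup>2 * e2 s (fst z) (snd z) / a (snd z)) \<partial>QM)"
      using R by (intro mult_right_mono) auto
    finally show "ennreal ?H \<le> ennreal (exp R) * (\<integral>\<^sup>+z. ennreal ((h (fst z) (snd z))\<^sup>2 * e2 s (fst z) (snd z) / a (snd z)) \<partial>QM)" .
    have "ennreal ?B = (\<integral>\<^sup>+t. ennreal (BT t) \<partial>IM 0 T)"
      by (rule nn_integral_eq_integral[symmetric]) (use BTi BT0 in auto)
    also have "\<dots> \<le> (\<integral>\<^sup>+t. ennreal (exp R * (s * d1)) * ennreal (g t) \<partial>IM 0 T)"
    proof (rule nn_integral_mono)
      fix t assume "t \<in> space (IM 0 T)"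
      hence t: "0 < t" "t < T" by auto
      have "ennreal (BT t) \<le> ennreal (exp R * (s * d1) * g t)" by (rule ennreal_leI[OF BTg(2)[OF t]])
      also have "\<dots> = ennreal (exp R * (s * d1)) * ennreal (g t)" using g0[OF t] s d1 by (intro ennreal_mult) auto
      finally show "ennreal (BT t) \<le> ennreal (exp R * (s * d1)) * ennreal (g t)" .
    qed
    also have "\<dots> = ennreal (exp R * (s * d1)) * (\<integral>\<^sup>+t. ennreal (g t) \<partial>IM 0 T)" by (rule nn_integral_cmult) measurable
    also have "\<dots> = ennreal (exp R) * (ennreal (s * d1) * (\<integral>\<^sup>+t. ennreal (g t) \<partial>IM 0 T))"
      using s d1 by (simp add: ennreal_mult mult.assoc)
    finally show "ennreal ?B \<le> ennreal (exp R) * (ennreal (s * d1) * (\<integral>\<^sup>+t. ennreal (g t) \<partial>IM 0 T))" .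
  qed simp
  also have "\<dots> = ennreal (?c / k * exp R) * ((\<integral>\<^sup>+z. ennreal ((h (fst z) (snd z))\<^sup>2 * e2 s (fst z) (snd z) / a (snd z)) \<partial>QM)
      + ennreal (s * d1) * (\<integral>\<^sup>+t. ennreal (g t) \<partial>IM 0 T))"
  proof -
    have "ennreal c * (ennreal e * X + ennreal e * Y) = ennreal (c * e) * (X + Y)" if "0 \<le> c" "0 \<le> e" for c e X Y
      using that by (simp add: ennreal_mult distrib_left mult.assoc)
    moreover have "0 \<le> ?c / k" using k by simp
    ultimately show ?thesis by simp
  qed
  finally show ?thesis unfolding g_def .
qed

end

section \<open>From the hypotheses to the weight and the solution\<close>

lemma ac_on_if_W11:
  assumes "W11_with_deriv f g" shows "ac_on 0 1 f g"
proof (rule ac_onI)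
  show "set_integrable lborel {0..1} g" using assms by (simp add: W11_with_deriv_def)
  fix x :: real assume x: "0 \<le> x" "x \<le> 1"
  show "f x = f 0 + (LBINT u:{0..x}. g u)"
  proof -
    have "\<forall>x\<in>{0..1}. f x = f 0 + (LBINT y=ereal 0..ereal x. g y)"
      using assms unfolding W11_with_deriv_def by blast
    from bspec[OF this, of x] x have "f x = f 0 + (LBINT y=ereal 0..ereal x. g y)" by simp
    thus ?thesis unfolding interval_integral_Icc[OF x(1)] .
  qed
qed

lemma continuous_le_if_AE_le:
  fixes g :: "real \<Rightarrow> real"
  assumes g: "continuous_on {0..1} g" and ae: "AE x in IM 0 1. g x \<le> K" and x: "x \<in> {0..1}"
  shows "g x \<le> K"
proof -
  have *: "g x \<le> K" if "x \<in> {0<..<1}" for x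
  proof -
    have o: "open ({0<..<1} \<inter> g -` {K<..})"
      by (rule continuous_open_preimage) (auto intro: continuous_on_subset[OF g])
    have "AE x in lborel. x \<notin> {0<..<1} \<inter> g -` {K<..}"
      using ae unfolding AE_IM_iff by eventually_elim auto
    hence "{0<..<1} \<inter> g -` {K<..} \<in> null_sets lborel"
      using o by (subst (asm) AE_iff_null_sets[symmetric]) auto
    hence "negligible ({0<..<1} \<inter> g -` {K<..})"
      by (simp add: negligible_iff_null_sets null_sets_completionI)
    hence "{0<..<1} \<inter> g -` {K<..} = {}" using o open_not_negligible by blast
    thus ?thesis using that by force
  qed
  have "closed {x \<in> {0..1}. g x \<le> K}"
    using continuous_closed_preimage[OF g closed_real_atLeastAtMost, of "{..K}"]
    by (simp add: vimage_def Int_def)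
  moreover have "{0<..<1} \<subseteq> {x \<in> {0..1}. g x \<le> K}" using * by auto
  ultimately have "closure {0<..<1} \<subseteq> {x \<in> {0..1}. g x \<le> K}" by (rule closure_minimal[rotated])
  thus ?thesis using x by auto
qed

text \<open>A derivative matters only up to null sets, so truncation turns an essential bound into a
  bound at every point.\<close>

lemma ac_on_clamp:
  assumes ac: "ac_on 0 1 f f'" and m: "f' \<in> borel_measurable borel" and B: "AE x in lborel. x \<in> {0..1} \<longrightarrow> \<bar>f' x\<bar> \<le> B"
  shows "ac_on 0 1 f (\<lambda>x. max (- \<bar>B\<bar>) (min \<bar>B\<bar> (f' x)))"
proof (rule ac_on_cong[OF ac])
  show "AE x in lborel. 0 \<le> x \<longrightarrow> x \<le> 1 \<longrightarrow> f' x = max (- \<bar>B\<bar>) (min \<bar>B\<bar> (f' x))"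
    using B by eventually_elim auto
  show "set_borel_measurable lborel {0..1} (\<lambda>x. max (- \<bar>B\<bar>) (min \<bar>B\<bar> (f' x)))"
    unfolding set_borel_measurable_def
    by (intro borel_measurable_scaleR borel_measurable_indicator borel_measurable_max borel_measurable_min)
       (use m in auto)
qed simp

text \<open>Almost everywhere \<open>a' = a b / (x - x0)\<close>, and the right side is continuous
  off \<open>x0\<close>, so \<open>a\<close> is C^1 there with this derivative. The bound
  \<open>b \<le> K\<close> extends to every point by continuity, and in the strongly degenerate case
  the bound on \<open>a'\<close> gives \<open>deg\<close>.\<close>

lemma Hnd_carleman_weight:
  assumes hnd: "Hnd a x0 K" and R: "R > 0" and d1: "d1 > 0"
    and d2: "d2 > max ((1 - x0)\<^sup>2 * exp (R * (1 - x0)\<^sup>2) / ((2 - K) * a 1)) (x0\<^sup>2 * exp (R * x0\<^sup>2) / ((2 - K) * a 0))"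
  obtains b bp M where "carleman_weight a b bp x0 K M R d1 d2"
proof -
  obtain a' where wd: "WD_with a a' x0 K \<or> SD_with a a' x0 K" and w: "in_W1inf (\<lambda>x. (x - x0) * a' x / a x)"
    using hnd by (auto simp: Hnd_def)
  have base: "degenerate_base a x0" and W: "W11_with_deriv a a'" and K: "0 < K" "K < 2"
    and ineq: "AE x in lborel. x \<in> {0..1} \<longrightarrow> (x - x0) * a' x \<le> K * a x"
    using wd by (auto simp: WD_with_def SD_with_def W1inf_with_deriv_def)
  have x0: "0 < x0" "x0 < 1" and a0: "a x0 = 0" and ap: "\<And>x. 0 \<le> x \<Longrightarrow> x \<le> 1 \<Longrightarrow> x \<noteq> x0 \<Longrightarrow> a x > 0"
    using base by (auto simp: degenerate_base_def)
  have aac: "ac_on 0 1 a a'" by (rule ac_on_if_W11[OF W])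
  have a'm: "a' \<in> borel_measurable borel" using W by (simp add: W11_with_deriv_def)
  note acont = ac_on_continuous[OF aac]
  obtain b b' where W1: "W1inf_with_deriv b b'" and bae: "AE x in lborel. x \<in> {0..1} \<longrightarrow> b x = (x - x0) * a' x / a x"
    using w unfolding in_W1inf_def by blast
  obtain B where Wb: "W11_with_deriv b b'" and B: "AE x in lborel. x \<in> {0..1} \<longrightarrow> \<bar>b' x\<bar> \<le> B"
    using W1 by (auto simp: W1inf_with_deriv_def)
  have b'm [measurable]: "b' \<in> borel_measurable borel" using Wb by (simp add: W11_with_deriv_def)
  define bp where "bp = (\<lambda>x. max (- \<bar>B\<bar>) (min \<bar>B\<bar> (b' x)))"
  have bac: "ac_on 0 1 b bp" unfolding bp_def by (rule ac_on_clamp[OF ac_on_if_W11[OF Wb] b'm B])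
  note bcont = ac_on_continuous[OF bac]
  have nx0: "AE x in lborel. x \<noteq> x0" by (rule AE_lborel_singleton)
  have a'eq: "AE x in lborel. x \<in> {0..1} \<longrightarrow> a' x = a x * b x / (x - x0)"
    using bae nx0
  proof eventually_elim
    case (elim x)
    show ?case
    proof
      assume x: "x \<in> {0..1}"
      hence "b x = (x - x0) * a' x / a x" "a x > 0" "x \<noteq> x0" using elim ap[of x] by auto
      thus "a' x = a x * b x / (x - x0)" by simp
    qed
  qed
  have ader: "(a has_real_derivative a x * b x / (x - x0)) (at x)" if x: "0 < x" "x < 1" "x \<noteq> x0" for x
  proof -
    define l u where "l = (if x < x0 then 0 else (x0 + x) / 2)" and "u = (if x < x0 then (x0 + x) / 2 else 1)"
    have lu: "0 \<le> l" "l < x" "x < u" "u \<le> 1" "x0 \<notin> {l..u}" using x x0 by (auto simp: l_def u_def)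
    have c: "continuous_on {l..u} (\<lambda>x. a x * b x / (x - x0))"
      by (intro continuous_intros continuous_on_subset[OF acont] continuous_on_subset[OF bcont]) (use lu in auto)
    have "ac_on l u a (\<lambda>x. a x * b x / (x - x0))"
    proof (rule ac_on_cong[OF ac_on_subset[OF aac lu(1,4)]])
      show "AE x in lborel. l \<le> x \<longrightarrow> x \<le> u \<longrightarrow> a' x = a x * b x / (x - x0)"
        using a'eq by eventually_elim (use lu in auto)
      show "set_borel_measurable lborel {l..u} (\<lambda>x. a x * b x / (x - x0))"
        using borel_integrable_atLeastAtMost'[OF c] by (auto simp: set_integrable_def set_borel_measurable_def)
    qed simp
    from ac_on_DERIV[OF this lu(2,3) c] show ?thesis .
  qed
  have ble: "b x \<le> K" if "0 \<le> x" "x \<le> 1" for x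
  proof (rule continuous_le_if_AE_le[OF bcont])
    show "AE x in IM 0 1. b x \<le> K" unfolding AE_IM_iff
      using bae ineq nx0
    proof eventually_elim
      case (elim x)
      show ?case
      proof (intro impI)
        assume x: "0 < x" "x < 1"
        hence "a x > 0" using ap[of x] elim by auto
        thus "b x \<le> K" using elim x by (simp add: pos_divide_le_eq)
      qed
    qed
  qed (use that in auto)
  have deg: "K < 1 \<or> (\<exists>L. \<forall>x\<in>{0..1}. a x \<le> L * \<bar>x - x0\<bar>)"
    using wd
  proof
    assume "WD_with a a' x0 K" thus ?thesis by (simp add: WD_with_def)
  next
    assume "SD_with a a' x0 K"
    then obtain L where L: "AE x in lborel. x \<in> {0..1} \<longrightarrow> \<bar>a' x\<bar> \<le> L" by (auto simp: SD_with_def W1inf_with_deriv_def)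
    let ?c = "\<lambda>x. max (- \<bar>L\<bar>) (min \<bar>L\<bar> (a' x))"
    have c: "ac_on 0 1 a ?c" by (rule ac_on_clamp[OF aac a'm L])
    have cl: "\<bar>?c x\<bar> \<le> \<bar>L\<bar>" for x by auto
    have "a x \<le> \<bar>L\<bar> * \<bar>x - x0\<bar>" if "x \<in> {0..1}" for x
      using ac_on_lipschitz[OF c cl, of x x0] ac_on_lipschitz[OF c cl, of x0 x] that x0 a0
      by (cases "x \<le> x0") (auto simp: abs_le_iff)
    thus ?thesis by blast
  qed
  have "carleman_weight a b bp x0 K \<bar>B\<bar> R d1 d2"
  proof
    show "bp \<in> borel_measurable borel" unfolding bp_def by measurable
    show "\<bar>bp x\<bar> \<le> \<bar>B\<bar>" for x by (auto simp: bp_def)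
  qed (fact x0 a0 ap acont ader bac ble K deg R d1 d2)+
  thus ?thesis using that by blast
qed

section \<open>From the solution space to slices and representatives\<close>

lemma Qset_sets: "Qset T \<inter> space lborel \<in> sets lborel"
  unfolding Qset_def by (auto intro!: borel_open open_Times)

lemma nn_integral_Qset:
  "(\<integral>\<^sup>+z. indicator (Qset T) z * f z \<partial>lborel) = (\<integral>\<^sup>+z. f z \<partial>(cyl T))"
  unfolding restrict_space_Qset[symmetric] nn_integral_restrict_space[OF Qset_sets] by (simp add: mult.commute)

lemma AE_Qset:
  "(AE z in lborel. z \<in> Qset T \<longrightarrow> P z) \<longleftrightarrow> (AE z in cyl T. P z)"
  unfolding restrict_space_Qset[symmetric] AE_restrict_space_iff[OF Qset_sets] ..

lemma meas_pair_iff: "(\<lambda>z. f (fst z) (snd z)) \<in> borel_measurable lborel \<longleftrightarrow> case_prod f \<in> borel_measurable (borel \<Otimes>\<^sub>M borel)"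
  for f :: "real \<Rightarrow> real \<Rightarrow> real"
  by (simp add: case_prod_unfold borel_prod)

lemma L2Q_meas: "L2Q T w f \<Longrightarrow> case_prod f \<in> borel_measurable (borel \<Otimes>\<^sub>M borel)"
  unfolding L2Q_def meas_pair_iff by blast

lemma L2Q_integrable:
  assumes f: "L2Q T w f" and w: "w \<in> borel_measurable (IM 0 1)" "\<And>x. 0 < x \<Longrightarrow> x < 1 \<Longrightarrow> w x \<ge> 0"
  shows "integrable (cyl T) (\<lambda>z. (f (fst z) (snd z))\<^sup>2 * w (snd z))"
proof (rule integrableI_nonneg)
  have [measurable]: "(\<lambda>z. f (fst z) (snd z)) \<in> borel_measurable (cyl T)"
    using measurable_pair_IM[OF L2Q_meas[OF f], of 0 T 0 1] unfolding case_prod_unfold .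
  have [measurable]: "(\<lambda>z. w (snd z)) \<in> borel_measurable (cyl T)"
    by (rule measurable_compose[OF measurable_snd w(1)])
  show "(\<lambda>z. (f (fst z) (snd z))\<^sup>2 * w (snd z)) \<in> borel_measurable (cyl T)" by measurable
  show "AE z in cyl T. 0 \<le> (f (fst z) (snd z))\<^sup>2 * w (snd z)"
    using AE_Q_space by eventually_elim (use w in auto)
  show "(\<integral>\<^sup>+ z. ennreal ((f (fst z) (snd z))\<^sup>2 * w (snd z)) \<partial>(cyl T)) < \<infinity>"
    using f unfolding L2Q_def nn_integral_Qset by blast
qed

lemma L2_imp_L1_Q:
  assumes "f \<in> borel_measurable (cyl T)" "integrable (cyl T) (\<lambda>z. (f z)\<^sup>2)"
  shows "integrable (cyl T) (f :: _ \<Rightarrow> real)"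
proof (rule Bochner_Integration.integrable_bound)
  have "integrable (cyl T) (\<lambda>z. 1 * 1 :: real)"
    by (rule Q.integrable_prod_mult) auto
  thus "integrable (cyl T) (\<lambda>z. 1 + (f z)\<^sup>2)" using assms(2) by simp
  have "\<bar>y\<bar> \<le> 1 + y\<^sup>2" for y :: real
    using sum_squares_bound[of "\<bar>y\<bar>" 1] zero_le_power2[of y] by (simp add: power2_eq_square) 
  thus "AE z in cyl T. norm (f z) \<le> norm (1 + (f z)\<^sup>2)"
    by (intro AE_I2) (auto intro: order_trans[OF _ abs_ge_self])
qed fact

text \<open>\<open>vt\<close> is replaced by the \<open>x\<close>-primitive \<open>U\<close> of
  \<open>vtx\<close>. By \<open>mixed_derivative\<close> it agrees with \<open>vt\<close> almost
  everywhere, and for almost every \<open>t\<close> its slice is absolutely continuous and vanishes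
  at both ends.\<close>

lemma S2_carleman_solution:
  assumes cw: "carleman_weight a b bp x0 K M R d1 d2" and T: "T > 0" and S: "S2 T a v vt vx vxx"
  obtains U Ux cv cx where "carleman_solution a b bp x0 K M R d1 d2 T v vx vxx U Ux cv cx"
    "AE z in cyl T. vt (fst z) (snd z) = U (fst z) (snd z)"
proof -
  interpret carleman_weight a b bp x0 K M R d1 d2 by fact
  let ?Q = "cyl T"
  obtain vtx where L: "L2Q T (\<lambda>_. 1) v" "L2Q T (\<lambda>x. 1 / a x) v" "L2Q T (\<lambda>_. 1) vx" "L2Q T (\<lambda>_. 1) vxx"
      "L2Q T (\<lambda>_. 1) vt" "L2Q T (\<lambda>x. 1 / a x) vt" "L2Q T (\<lambda>_. 1) vtx"
    and ae: "AE t in lborel. t \<in> {0<..<T} \<longrightarrow>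
          set_integrable lborel {0..1} (vx t) \<and> set_integrable lborel {0..1} (vxx t) \<and>
          (\<forall>x\<in>{0..1}. v t x = (LBINT y=ereal 0..ereal x. vx t y)) \<and>
          (\<forall>x\<in>{0..1}. vx t x = vx t 0 + (LBINT y=ereal 0..ereal x. vxx t y)) \<and>
          v t 0 = 0 \<and> v t 1 = 0"
    and wd: "weak_dt T v vt" "weak_dt T vx vtx"
    using S unfolding S2_def by blast
  have m: "case_prod v \<in> borel_measurable (borel \<Otimes>\<^sub>M borel)" "case_prod vt \<in> borel_measurable (borel \<Otimes>\<^sub>M borel)"
    "case_prod vx \<in> borel_measurable (borel \<Otimes>\<^sub>M borel)" "case_prod vxx \<in> borel_measurable (borel \<Otimes>\<^sub>M borel)" "case_prod vtx \<in> borel_measurable (borel \<Otimes>\<^sub>M borel)"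
    by (rule L2Q_meas[OF L(1)] L2Q_meas[OF L(5)] L2Q_meas[OF L(3)] L2Q_meas[OF L(4)] L2Q_meas[OF L(7)])+
  have mQ: "(\<lambda>z. f (fst z) (snd z)) \<in> borel_measurable ?Q" if "case_prod f \<in> borel_measurable (borel \<Otimes>\<^sub>M borel)" for f :: "real \<Rightarrow> real \<Rightarrow> real"
    using measurable_pair_IM[OF that, of 0 T 0 1] by (simp add: case_prod_unfold)
  have sq: "integrable ?Q (\<lambda>z. (f (fst z) (snd z))\<^sup>2)" if "L2Q T (\<lambda>_. 1) f" for f
    using L2Q_integrable[OF that] by simp
  have sqa: "integrable ?Q (\<lambda>z. (f (fst z) (snd z))\<^sup>2 / a (snd z))" if "L2Q T (\<lambda>x. 1 / a x) f" for f
  proof -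
    have "integrable ?Q (\<lambda>z. (f (fst z) (snd z))\<^sup>2 * (1 / a (snd z)))"
      by (rule L2Q_integrable[OF that]) (measurable, use a_nonneg in auto)
    thus ?thesis by simp
  qed
  have L1': "integrable ?Q (case_prod f)" if "L2Q T (\<lambda>_. 1) f" for f
    using L2_imp_L1_Q[OF mQ[OF L2Q_meas[OF that]] sq[OF that]] unfolding case_prod_unfold .
  obtain cv where cv: "integrable (IM 0 1) cv" "AE z in ?Q. v (fst z) (snd z) = cv (snd z) + (LBINT u:{0..fst z}. vt u (snd z))"
    using weak_dt_repr[OF T m(1,2) L1'[OF L(1)] L1'[OF L(5)] wd(1)] by blast
  obtain cx where cx: "integrable (IM 0 1) cx" "AE z in ?Q. vx (fst z) (snd z) = cx (snd z) + (LBINT u:{0..fst z}. vtx u (snd z))"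
    using weak_dt_repr[OF T m(3,5) L1'[OF L(3)] L1'[OF L(7)] wd(2)] by blast
  have acv: "AE t in IM 0 T. ac_on 0 1 (v t) (vx t) \<and> ac_on 0 1 (vx t) (vxx t) \<and> (\<forall>x\<in>{0..1}. v t x = (LBINT y:{0..x}. vx t y)) \<and> v t 0 = 0 \<and> v t 1 = 0"
    unfolding AE_IM_iff using ae
  proof eventually_elim
    case (elim t)
    show ?case
    proof (intro impI)
      assume t: "0 < t" "t < T"
      have i: "set_integrable lborel {0..1} (vx t)" "set_integrable lborel {0..1} (vxx t)"
        and e: "\<And>x. 0 \<le> x \<Longrightarrow> x \<le> 1 \<Longrightarrow> v t x = (LBINT y:{0..x}. vx t y)"
          "\<And>x. 0 \<le> x \<Longrightarrow> x \<le> 1 \<Longrightarrow> vx t x = vx t 0 + (LBINT y:{0..x}. vxx t y)"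
        and z: "v t 0 = 0" "v t 1 = 0"
      proof -
        have "t \<in> {0<..<T}" using t by simp
        note c = mp[OF elim this]
        show "set_integrable lborel {0..1} (vx t)" "set_integrable lborel {0..1} (vxx t)" "v t 0 = 0" "v t 1 = 0"
          using c by blast+
        have c1: "\<forall>x\<in>{0..1}. v t x = (LBINT y=ereal 0..ereal x. vx t y)"
          and c2: "\<forall>x\<in>{0..1}. vx t x = vx t 0 + (LBINT y=ereal 0..ereal x. vxx t y)" using c by blast+
        fix x :: real assume x: "0 \<le> x" "x \<le> 1"
        hence x': "x \<in> {0..1}" by simp
        show "v t x = (LBINT y:{0..x}. vx t y)"
          using bspec[OF c1 x'] unfolding interval_integral_Icc[OF x(1)] .
        show "vx t x = vx t 0 + (LBINT y:{0..x}. vxx t y)"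
          using bspec[OF c2 x'] unfolding interval_integral_Icc[OF x(1)] .
      qed
      have "ac_on 0 1 (v t) (vx t)" by (rule ac_onI[OF i(1), of _ 0]) (use e(1) in simp)
      moreover have "ac_on 0 1 (vx t) (vxx t)" by (rule ac_onI[OF i(2) e(2)])
      ultimately show "ac_on 0 1 (v t) (vx t) \<and> ac_on 0 1 (vx t) (vxx t) \<and> (\<forall>x\<in>{0..1}. v t x = (LBINT y:{0..x}. vx t y)) \<and> v t 0 = 0 \<and> v t 1 = 0"
        using e z by auto
    qed
  qed
  define U where "U t x = (LBINT y:{0..x}. vtx t y)" for t x
  have md: "AE z in ?Q. vt (fst z) (snd z) = U (fst z) (snd z)" "AE t in IM 0 T. U t 1 = 0"
    unfolding U_def
    by (rule mixed_derivative[OF T m(1,2,3,5) L1'[OF L(5)] L1'[OF L(7)] cv(2) cx(2) cx(1)],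
        use acv in \<open>eventually_elim, simp\<close>, use acv in \<open>eventually_elim, simp\<close>)+
  have Um: "case_prod U \<in> borel_measurable (borel \<Otimes>\<^sub>M borel)"
    unfolding U_def by (rule primitive_measurable_snd[OF m(5)])
  note [measurable] = mQ[OF Um]
  have U0: "U t 0 = 0" for t
    using interval_integral_Icc[of 0 0 "vtx t"] interval_integral_endpoints_same[of "ereal 0" "vtx t"] unfolding U_def by simp
  have Uac: "AE t in IM 0 T. ac_on 0 1 (U t) (vtx t)"
    using Q.AE_integrable_fst[OF L1'[OF L(7)]]
    by eventually_elim (rule ac_onI[where c=0], auto simp: U_def integrable_IM)
  have Uint: "integrable ?Q (case_prod U)"
    using integrable_cong_AE_imp[OF L1'[OF L(5), unfolded case_prod_unfold] mQ[OF Um] md(1)] unfolding case_prod_unfold .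
  have Ua: "integrable ?Q (\<lambda>z. (U (fst z) (snd z))\<^sup>2 / a (snd z))"
  proof (rule integrable_cong_AE_imp[OF sqa[OF L(6)]])
    show "AE z in ?Q. (vt (fst z) (snd z))\<^sup>2 / a (snd z) = (U (fst z) (snd z))\<^sup>2 / a (snd z)" using md(1) by eventually_elim simp
  qed measurable
  have rep: "AE z in ?Q. v (fst z) (snd z) = cv (snd z) + (LBINT u:{0..fst z}. U u (snd z))"
  proof -
    \<comment> \<open>For almost every \<open>x\<close> the two primitives agree at all times at
      once, so the exceptional set depends on \<open>x\<close> only.\<close>
    have "AE x in IM 0 1. \<forall>t. 0 < t \<and> t < T \<longrightarrow> (LBINT u:{0..t}. vt u x) = (LBINT u:{0..t}. U u x)"
      using Q.AE_pair_swapped[OF md(1)]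
    proof eventually_elim
      case (elim x)
      have e: "AE u in lborel. 0 \<le> u \<longrightarrow> u \<le> T \<longrightarrow> vt u x = U u x" using elim by (simp add: AE_IM_Icc)
      have mm: "(\<lambda>u. vt u x) \<in> borel_measurable lborel" "(\<lambda>u. U u x) \<in> borel_measurable lborel"
        using measurable_section_snd[OF m(2)] measurable_section_snd[OF Um] by simp_all
      show ?case
      proof (intro allI impI)
        fix t assume t: "0 < t \<and> t < T"
        show "(LBINT u:{0..t}. vt u x) = (LBINT u:{0..t}. U u x)"
        proof (rule set_lebesgue_integral_cong_AE[OF _ mm])
          show "AE u\<in>{0..t} in lborel. vt u x = U u x" using e by eventually_elim (use t in auto)
        qed simp
      qed
    qed
    from Q.AE_pair_snd[OF this] cv(2) AE_Q_space show ?thesis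
      by eventually_elim simp
  qed
  have "carleman_solution a b bp x0 K M R d1 d2 T v vx vxx U vtx cv cx"
  proof
    show "AE t in IM 0 T. ac_on 0 1 (v t) (vx t)" using acv by eventually_elim simp
    show "AE t in IM 0 T. ac_on 0 1 (vx t) (vxx t)" using acv by eventually_elim simp
    show "AE t in IM 0 T. v t 0 = 0 \<and> v t 1 = 0 \<and> U t 0 = 0 \<and> U t 1 = 0"
      using acv md(2) by eventually_elim (simp add: U0)
  qed (fact T m Um Uac Uint rep cx(2) Ua sqa[OF L(2)] sq[OF L(3)] sq[OF L(4)] sq[OF L(7)] L1'[OF L(7)])+
  thus ?thesis using that md(1) by blast
qed

theorem theorem4p2:
  fixes T R d1 d2 x0 K :: real and a :: "real \<Rightarrow> real"
  assumes "T > 0" and "Hnd a x0 K" and "R > 0" and "d1 > 0"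
    and "d2 > max ((1 - x0)\<^sup>2 * exp (R * (1 - x0)\<^sup>2) / ((2 - K) * a 1))
                  (x0\<^sup>2 * exp (R * x0\<^sup>2) / ((2 - K) * a 0))"
  shows "\<exists>C s0. C > 0 \<and> s0 > 0 \<and>
    (\<forall>v vt vx vxx h :: real \<Rightarrow> real \<Rightarrow> real.
       S2 T a v vt vx vxx \<and>
       (\<lambda>z. h (fst z) (snd z)) \<in> borel_measurable lborel \<and>
       (AE z in lborel. z \<in> Qset T \<longrightarrow>
          vt (fst z) (snd z) + a (snd z) * vxx (fst z) (snd z) = h (fst z) (snd z))
       \<longrightarrow>
       (\<forall>s\<ge>s0.
          (\<integral>\<^sup>+ z. indicator (Qset T) z * ennreal
             ((s * Theta T (fst z) * (vx (fst z) (snd z))\<^sup>2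
               + s ^ 3 * (Theta T (fst z)) ^ 3 * ((snd z - x0) / a (snd z))\<^sup>2
                 * (v (fst z) (snd z))\<^sup>2)
              * exp (2 * s * varphi T a x0 R d1 d2 (fst z) (snd z))) \<partial>lborel)
          \<le> ennreal C *
            ((\<integral>\<^sup>+ z. indicator (Qset T) z * ennreal
                ((h (fst z) (snd z))\<^sup>2 * exp (2 * s * varphi T a x0 R d1 d2 (fst z) (snd z))
                 / a (snd z)) \<partial>lborel)
             + ennreal (s * d1) *
               (\<integral>\<^sup>+ t. indicator {0<..<T} t * ennreal
                  (Theta T t * exp (2 * s * varphi T a x0 R d1 d2 t 1) * (1 - x0) * (vx t 1)\<^sup>2
                   - Theta T t * exp (2 * s * varphi T a x0 R d1 d2 t 0) * (0 - x0) * (vx t 0)\<^sup>2)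
                  \<partial>lborel))))"
proof -
  obtain b bp M where cw: "carleman_weight a b bp x0 K M R d1 d2"
    using Hnd_carleman_weight[OF assms(2-5)] by blast
  interpret carleman_weight a b bp x0 K M R d1 d2 by fact
  have T: "T > 0" by fact
  \<comment> \<open>\<open>(4 / T^2)^4\<close> is the minimum of \<open>Theta\<close> on the open
    interval, attained at \<open>T / 2\<close>.\<close>
  have c0: "cTheta T \<ge> 0" and m0: "(4 / T\<^sup>2) ^ 4 > 0" using T by (auto simp: cTheta_def)
  obtain k s0 where k: "k > 0" and s0: "s0 > 0"
    and coer: "\<And>s \<theta> \<theta>1 \<theta>2. s \<ge> s0 \<Longrightarrow> \<theta> \<ge> (4 / T\<^sup>2) ^ 4 \<Longrightarrow> \<bar>\<theta>1\<bar> \<le> cTheta T * \<theta>\<^sup>2 \<Longrightarrow> \<bar>\<theta>2\<bar> \<le> cTheta T * \<theta>\<^sup>2 \<Longrightarrow>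
      coercive_form k (s * \<theta>) (s * \<theta>1) (s * \<theta>2)"
    using coercive[OF c0 m0] by blast
  let ?C = "(2 + 2 * d1\<^sup>2) / k * exp R"
  show ?thesis
  proof (rule exI[of _ ?C], rule exI[of _ s0], intro conjI allI impI)
    show "?C > 0" using k by (simp add: add_pos_nonneg)
    show "s0 > 0" by fact
    fix v vt vx vxx h :: "real \<Rightarrow> real \<Rightarrow> real" and s
    assume H: "S2 T a v vt vx vxx \<and> (\<lambda>z. h (fst z) (snd z)) \<in> borel_measurable lborel \<and>
       (AE z in lborel. z \<in> Qset T \<longrightarrow> vt (fst z) (snd z) + a (snd z) * vxx (fst z) (snd z) = h (fst z) (snd z))"
      and s: "s0 \<le> s"
    obtain U Ux cv cx where cs: "carleman_solution a b bp x0 K M R d1 d2 T v vx vxx U Ux cv cx"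
      and vtU: "AE z in cyl T. vt (fst z) (snd z) = U (fst z) (snd z)"
      using S2_carleman_solution[OF cw T conjunct1[OF H]] by blast
    interpret S: carleman_solution a b bp x0 K M R d1 d2 T v vx vxx U Ux cv cx by fact
    have hm: "(\<lambda>z. h (fst z) (snd z)) \<in> borel_measurable S.QM"
      by (rule S.meas_Q) (rule meas_pair_iff[THEN iffD1, OF conjunct1[OF conjunct2[OF H]]])
    have heq: "AE z in S.QM. U (fst z) (snd z) + a (snd z) * vxx (fst z) (snd z) = h (fst z) (snd z)"
    proof -
      have "AE z in S.QM. vt (fst z) (snd z) + a (snd z) * vxx (fst z) (snd z) = h (fst z) (snd z)"
        by (rule AE_Qset[THEN iffD1, OF conjunct2[OF conjunct2[OF H]]])
      thus ?thesis using vtU by eventually_elim simp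
    qed
    have ve: "exp (2 * s * varphi T a x0 R d1 d2 t x) = S.e2 s t x" for t x
      by (simp add: varphi_def S.e2_def mult.assoc)
    have nnT: "(\<integral>\<^sup>+t. indicator {0<..<T} t * f t \<partial>lborel) = (\<integral>\<^sup>+t. f t \<partial>IM 0 T)" for f
      by (subst nn_integral_restrict_space) (auto simp: mult.commute)
    show "(\<integral>\<^sup>+ z. indicator (Qset T) z * ennreal
             ((s * Theta T (fst z) * (vx (fst z) (snd z))\<^sup>2
               + s ^ 3 * (Theta T (fst z)) ^ 3 * ((snd z - x0) / a (snd z))\<^sup>2
                 * (v (fst z) (snd z))\<^sup>2)
              * exp (2 * s * varphi T a x0 R d1 d2 (fst z) (snd z))) \<partial>lborel)
          \<le> ennreal ?C *
            ((\<integral>\<^sup>+ z. indicator (Qset T) z * ennreal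
                ((h (fst z) (snd z))\<^sup>2 * exp (2 * s * varphi T a x0 R d1 d2 (fst z) (snd z))
                 / a (snd z)) \<partial>lborel)
             + ennreal (s * d1) *
               (\<integral>\<^sup>+ t. indicator {0<..<T} t * ennreal
                  (Theta T t * exp (2 * s * varphi T a x0 R d1 d2 t 1) * (1 - x0) * (vx t 1)\<^sup>2
                   - Theta T t * exp (2 * s * varphi T a x0 R d1 d2 t 0) * (0 - x0) * (vx t 0)\<^sup>2)
                  \<partial>lborel))"
      unfolding nn_integral_Qset nnT ve
    proof (rule S.main_estimate[OF _ k _ hm heq])
      show "s > 0" using s s0 by simp
      show "coercive_form k (s * Theta T t) (s * Theta' T t) (s * Theta'' T t)" if "0 < t" "t < T" for t
        by (rule coer[OF s Theta_lower[OF that] Theta_derivs_bound[OF that]])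
    qed
  qed
qed

end
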